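(* Let $\delta\in(0,1)$, $\gamma_u>1$, $0<\rho_*\le\rho^*<\infty$, and let $c_{\rm LSE}>0$ (depending only on $\rho_*,\rho^*$) and $C_{\rm LSE}>0$ be suitable constants. There exist a constant $c_0>0$ and positive constants $C',C''$ (not depending on $n,d,s,\lambda,\varepsilon_t$) such that the following holds. Suppose the LSE condition holds with constants $\rho_*,\rho^*,c_{\rm LSE},C_{\rm LSE}$ and radius $r$, that $\mathrm{w}\in\mathcal T$ and $\mathrm{w}(u)\ge1/2$ for $u=18\rho_*^{-1}\delta^{-1}\lambda$, and that $$4\big(\|\nabla\mathcal L(\boldsymbol\beta^* )\|_\infty+\max\{\varepsilon_t,\varepsilon_c\}\big)\le\lambda\le c_0\,\frac r{\sqrt s},\qquad \varepsilon_c,\varepsilon_t>0 .$$ Then in each tightening step $\ell\ge2$ of the algorithm described in the context, obtaining an approximate solution $\widetilde{\boldsymbol\beta}^{(\ell)}$ with $\omega_{\boldsymbol\lambda^{(\ell-1)}}(\widetilde{\boldsymbol\beta}^{(\ell)})\le\varepsilon_t$ requires at most $$C'\log\Big(C''\,\frac{\lambda\sqrt s}{\varepsilon_t}\Big)$$ LAMM iterations.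
   Context: Setting. $\boldsymbol\beta^*\in\mathbb R^d$ is the true parameter, $S=\mathrm{supp}(\boldsymbol\beta^* )$, $s=|S|\ge1$. $\mathbf v_I$ keeps the coordinates of $\mathbf v$ in $I$ and sets the others to $0$; $\odot$ is the entrywise product; $B_2(r,\boldsymbol\beta^* )=\{\boldsymbol\beta:\|\boldsymbol\beta-\boldsymbol\beta^*\|_2\le r\}$. The loss $\mathcal L:\mathbb R^d\to\mathbb R$ is convex, with continuous gradient that is differentiable on $B_2(r,\boldsymbol\beta^* )$. Localized sparse eigenvalues: $\rho_+(m,r)$ and $\rho_-(m,r)$ are the supremum and infimum of $\mathbf u_J^{T}\nabla^2\mathcal L(\boldsymbol\beta)\mathbf u_J$ over $\|\mathbf u_J\|_2=1$, $|J|\le m$, $\|\boldsymbol\beta-\boldsymbol\beta^*\|_2\le r$. LSE condition with constants $\rho_*,\rho^*,c_{\rm LSE},C_{\rm LSE}$ and radius $r$: there is an integer $\widetilde s\ge c_{\rm LSE}s$ with $0<\rho_*\le\rho_-(2s+2\widetilde s,r)<\rho_+(2s+2\widetilde s,r)\le\rho^*<\infty$ and $\rho_+(\widetilde s,r)/\rho_-(2s+2\widetilde s,r)\le1+C_{\rm LSE}\,\widetilde s/s$. Tightening class $\mathcal T$: functions $\mathrm{w}:\mathbb R\to\mathbb R$ with $\mathrm{w}(t_1)\le\mathrm{w}(t_2)$ for $t_1\ge t_2\ge0$, $0\le\mathrm{w}(t)\le1$ for $t\ge0$, and $\mathrm{w}(t)=1$ for $t\le0$. Algorithm (I-LAMM).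 $\lambda>0$, $\widetilde{\boldsymbol\beta}^{(0)}=\mathbf 0$, $\boldsymbol\lambda^{(\ell-1)}=(\lambda\mathrm{w}(|\widetilde\beta^{(\ell-1)}_j|))_{j=1}^d$ (so $\boldsymbol\lambda^{(0)}=\lambda\mathbf 1$). For a weight vector $\boldsymbol\lambda$: $F(\boldsymbol\beta,\boldsymbol\lambda)=\mathcal L(\boldsymbol\beta)+\sum_j\lambda_j|\beta_j|$ and $\omega_{\boldsymbol\lambda}(\boldsymbol\beta)=\min_{\boldsymbol\xi\in\partial\|\boldsymbol\beta\|_1}\|\nabla\mathcal L(\boldsymbol\beta)+\boldsymbol\lambda\odot\boldsymbol\xi\|_\infty$. For $\phi>0$, $$\Psi_{\boldsymbol\lambda,\phi}(\boldsymbol\beta;\boldsymbol\beta')=\mathcal L(\boldsymbol\beta')+\langle\nabla\mathcal L(\boldsymbol\beta'),\boldsymbol\beta-\boldsymbol\beta'\rangle+\tfrac{\phi}{2}\|\boldsymbol\beta-\boldsymbol\beta'\|_2^2+\sum_j\lambda_j|\beta_j|,$$ whose unique minimizer in $\boldsymbol\beta$ is $T_{\boldsymbol\lambda,\phi}(\boldsymbol\beta')=\big(\mathrm{sign}(z_j)\max\{|z_j|-\lambda_j/\phi,0\}\big)_j$ with $\mathbf z=\boldsymbol\beta'-\phi^{-1}\nabla\mathcal L(\boldsymbol\beta')$. The parameters are $\gamma_u>1$ and a sufficiently small $\phi_0>0$. For $\ell=1,2,\dots$: set $\boldsymbol\beta^{(\ell,0)}=\widetilde{\boldsymbol\beta}^{(\ell-1)}$,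 and let $\phi^{(\ell,0)}$ be the last value of $\phi$ used in problem $\ell-1$ ($\phi^{(1,0)}=\phi_0$). One LAMM iteration passes from $(\boldsymbol\beta^{(\ell,k-1)},\phi^{(\ell,k-1)})$ to $(\boldsymbol\beta^{(\ell,k)},\phi^{(\ell,k)})$: start with $\phi=\max\{\phi_0,\gamma_u^{-1}\phi^{(\ell,k-1)}\}$ and repeatedly replace $\phi$ by $\gamma_u\phi$ until $\boldsymbol\beta=T_{\boldsymbol\lambda^{(\ell-1)},\phi}(\boldsymbol\beta^{(\ell,k-1)})$ satisfies $F(\boldsymbol\beta,\boldsymbol\lambda^{(\ell-1)})\le\Psi_{\boldsymbol\lambda^{(\ell-1)},\phi}(\boldsymbol\beta;\boldsymbol\beta^{(\ell,k-1)})$; put $\boldsymbol\beta^{(\ell,k)}=\boldsymbol\beta$, $\phi^{(\ell,k)}=\phi$. Problem $\ell$ stops at the first $k$ with $\omega_{\boldsymbol\lambda^{(\ell-1)}}(\boldsymbol\beta^{(\ell,k)})\le\varepsilon$, where $\varepsilon=\varepsilon_c$ for $\ell=1$ (contraction stage) and $\varepsilon=\varepsilon_t$ for $\ell\ge2$ (tightening stage), and $\widetilde{\boldsymbol\beta}^{(\ell)}=\boldsymbol\beta^{(\ell,k)}$.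
   Formalization: C'' may also depend on an upper bound for the value of φ at the end of the contraction stage (φ^{(2,0)}); c_0 and C' do not. Without this the claim is false, since LSE does not control the loss outside the ball and φ^{(2,0)} can be arbitrarily large. *)

theory Defs
  imports
    "HOL-Analysis.Analysis"
    "HOL-Analysis.Finite_Function_Topology"
begin

text \<open>
  The constants in the theorem must not depend on the dimension \<open>d\<close>, so \<open>d\<close> has to be quantified
  inside the statement and cannot be a type. We use the normed space of finitely supported
  sequences and represent \<open>\<real>\<^sup>d\<close> by its subspace of sequences supported in \<open>{..<d}\<close>.
  The library equips the ambient space with the \<open>\<ell>\<^sub>1\<close>-norm. On the finite-dimensional subspace
  \<open>Rn d\<close> all norms are equivalent, so derivatives and continuity within \<open>Rn d\<close> are the usual
  ones; the Euclidean norm is written explicitly with the library's \<open>L2_set\<close>.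
\<close>

type_synonym rvec = "nat \<Rightarrow>\<^sub>0 real"

definition Rn :: "nat \<Rightarrow> rvec set" where
  "Rn d = {x. Poly_Mapping.keys x \<subseteq> {..<d}}"

abbreviation coord :: "rvec \<Rightarrow> nat \<Rightarrow> real" where
  "coord x j \<equiv> Poly_Mapping.lookup x j"

definition mk_vec :: "nat \<Rightarrow> (nat \<Rightarrow> real) \<Rightarrow> rvec" where
  "mk_vec d f = Abs_poly_mapping (\<lambda>j. if j < d then f j else 0)"

lemma coord_mk_vec [simp]: "coord (mk_vec d f) j = (if j < d then f j else 0)"
proof -
  have "finite {j. (if j < d then f j else 0) \<noteq> 0}"
    by (rule finite_subset[of _ "{..<d}"]) (auto split: if_splits)
  then show ?thesis by (simp add: mk_vec_def)
qed

lemma mk_vec_in_Rn [simp]: "mk_vec d f \<in> Rn d"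
  by (auto simp: Rn_def in_keys_iff split: if_splits)

definition dotp :: "nat \<Rightarrow> rvec \<Rightarrow> rvec \<Rightarrow> real" where
  "dotp d x y = (\<Sum>j<d. coord x j * coord y j)"

definition norm1 :: "nat \<Rightarrow> rvec \<Rightarrow> real" where
  "norm1 d x = (\<Sum>j<d. \<bar>coord x j\<bar>)"

definition norm2 :: "nat \<Rightarrow> rvec \<Rightarrow> real" where
  "norm2 d x = L2_set (coord x) {..<d}"

text \<open>Only meaningful for \<open>d > 0\<close>, which holds wherever it is used because the true parameter
  has nonempty support.\<close>
definition norm_max :: "nat \<Rightarrow> rvec \<Rightarrow> real" where
  "norm_max d x = (MAX j\<in>{..<d}. \<bar>coord x j\<bar>)"

definition hadamard :: "nat \<Rightarrow> rvec \<Rightarrow> rvec \<Rightarrow> rvec" where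
  "hadamard d x y = mk_vec d (\<lambda>j. coord x j * coord y j)"

definition restr :: "nat \<Rightarrow> rvec \<Rightarrow> nat set \<Rightarrow> rvec" where
  "restr d v I = mk_vec d (\<lambda>j. if j \<in> I then coord v j else 0)"

definition ball2 :: "nat \<Rightarrow> real \<Rightarrow> rvec \<Rightarrow> rvec set" where
  "ball2 d r bs = {b \<in> Rn d. norm2 d (b - bs) \<le> r}"

text \<open>\<open>g\<close> is the gradient of the loss \<open>L\<close> and \<open>H b\<close>, as a linear map, its Hessian at \<open>b\<close>.\<close>
definition admissible_loss ::
  "nat \<Rightarrow> (rvec \<Rightarrow> real) \<Rightarrow> (rvec \<Rightarrow> rvec) \<Rightarrow> (rvec \<Rightarrow> rvec \<Rightarrow> rvec) \<Rightarrow> rvec \<Rightarrow> real \<Rightarrow> bool" where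
  "admissible_loss d L g H bs r \<longleftrightarrow>
     convex_on (Rn d) L \<and>
     (\<forall>b\<in>Rn d. g b \<in> Rn d \<and> (L has_derivative (\<lambda>h. dotp d (g b) h)) (at b within Rn d)) \<and>
     continuous_on (Rn d) g \<and>
     (\<forall>b\<in>ball2 d r bs. (g has_derivative H b) (at b within Rn d))"

text \<open>The eigenvalues are extended reals, so that an unbounded set of values has supremum \<open>\<infinity>\<close>.\<close>
definition local_quad ::
  "nat \<Rightarrow> (rvec \<Rightarrow> rvec \<Rightarrow> rvec) \<Rightarrow> rvec \<Rightarrow> nat \<Rightarrow> real \<Rightarrow> ereal set" where
  "local_quad d H bs m r =
     {ereal (dotp d (restr d u J) (H b (restr d u J))) | u J b.
        u \<in> Rn d \<and> J \<subseteq> {..<d} \<and> card J \<le> m \<and> norm2 d (restr d u J) = 1 \<and> b \<in> ball2 d r bs}"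

definition rho_plus ::
  "nat \<Rightarrow> (rvec \<Rightarrow> rvec \<Rightarrow> rvec) \<Rightarrow> rvec \<Rightarrow> nat \<Rightarrow> real \<Rightarrow> ereal" where
  "rho_plus d H bs m r = Sup (local_quad d H bs m r)"

definition rho_minus ::
  "nat \<Rightarrow> (rvec \<Rightarrow> rvec \<Rightarrow> rvec) \<Rightarrow> rvec \<Rightarrow> nat \<Rightarrow> real \<Rightarrow> ereal" where
  "rho_minus d H bs m r = Inf (local_quad d H bs m r)"

definition LSE ::
  "nat \<Rightarrow> (rvec \<Rightarrow> rvec \<Rightarrow> rvec) \<Rightarrow> rvec \<Rightarrow> real \<Rightarrow> real \<Rightarrow> real \<Rightarrow> real \<Rightarrow> real \<Rightarrow> bool" where
  "LSE d H bs r rho_lo rho_hi cLSE CLSE \<longleftrightarrow>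
     (let s = card (Poly_Mapping.keys bs) in
      \<exists>st::nat. real st \<ge> cLSE * real s \<and>
        0 < rho_lo \<and>
        ereal rho_lo \<le> rho_minus d H bs (2 * s + 2 * st) r \<and>
        rho_minus d H bs (2 * s + 2 * st) r < rho_plus d H bs (2 * s + 2 * st) r \<and>
        rho_plus d H bs (2 * s + 2 * st) r \<le> ereal rho_hi \<and>
        rho_plus d H bs st r / rho_minus d H bs (2 * s + 2 * st) r
          \<le> ereal (1 + CLSE * real st / real s))"

definition tightening_class :: "(real \<Rightarrow> real) set" where
  "tightening_class =
     {w. (\<forall>t1 t2. t1 \<ge> t2 \<and> t2 \<ge> 0 \<longrightarrow> w t1 \<le> w t2) \<and>
         (\<forall>t\<ge>0. 0 \<le> w t \<and> w t \<le> 1) \<and> (\<forall>t\<le>0. w t = 1)}"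

definition weights :: "nat \<Rightarrow> (real \<Rightarrow> real) \<Rightarrow> real \<Rightarrow> rvec \<Rightarrow> rvec" where
  "weights d w lam b = mk_vec d (\<lambda>j. lam * w \<bar>coord b j\<bar>)"

definition objective :: "nat \<Rightarrow> (rvec \<Rightarrow> real) \<Rightarrow> rvec \<Rightarrow> rvec \<Rightarrow> real" where
  "objective d L b lv = L b + (\<Sum>j<d. coord lv j * \<bar>coord b j\<bar>)"

definition subdiff_norm1 :: "nat \<Rightarrow> rvec \<Rightarrow> rvec set" where
  "subdiff_norm1 d b =
     {xi \<in> Rn d. \<forall>v\<in>Rn d. norm1 d v \<ge> norm1 d b + dotp d xi (v - b)}"

text \<open>The subdifferential is nonempty and compact, so this infimum is a minimum.\<close>
definition omega :: "nat \<Rightarrow> (rvec \<Rightarrow> rvec) \<Rightarrow> rvec \<Rightarrow> rvec \<Rightarrow> real" where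
  "omega d g lv b = (INF xi\<in>subdiff_norm1 d b. norm_max d (g b + hadamard d lv xi))"

definition Psi ::
  "nat \<Rightarrow> (rvec \<Rightarrow> real) \<Rightarrow> (rvec \<Rightarrow> rvec) \<Rightarrow> rvec \<Rightarrow> real \<Rightarrow> rvec \<Rightarrow> rvec \<Rightarrow> real" where
  "Psi d L g lv phi b b' =
     L b' + dotp d (g b') (b - b') + phi / 2 * (norm2 d (b - b'))\<^sup>2
       + (\<Sum>j<d. coord lv j * \<bar>coord b j\<bar>)"

definition prox_step :: "nat \<Rightarrow> (rvec \<Rightarrow> rvec) \<Rightarrow> rvec \<Rightarrow> real \<Rightarrow> rvec \<Rightarrow> rvec" where
  "prox_step d g lv phi b' =
     (let z = b' - inverse phi *\<^sub>R g b'
      in mk_vec d (\<lambda>j. sgn (coord z j) * max (\<bar>coord z j\<bar> - coord lv j / phi) 0))"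

definition majorizes ::
  "nat \<Rightarrow> (rvec \<Rightarrow> real) \<Rightarrow> (rvec \<Rightarrow> rvec) \<Rightarrow> rvec \<Rightarrow> rvec \<Rightarrow> real \<Rightarrow> bool" where
  "majorizes d L g lv b' phi \<longleftrightarrow>
     (let b = prox_step d g lv phi b' in objective d L b lv \<le> Psi d L g lv phi b b')"

text \<open>
  One LAMM iteration, as a relation between successive pairs (iterate, last \<open>\<phi>\<close> used); \<open>i\<close> is the
  number of times \<open>\<phi>\<close> was multiplied by \<open>gu\<close>. The relation is functional, and a pair has no
  successor if the line search does not terminate.
\<close>
definition LAMM_iter ::
  "nat \<Rightarrow> (rvec \<Rightarrow> real) \<Rightarrow> (rvec \<Rightarrow> rvec) \<Rightarrow> real \<Rightarrow> real \<Rightarrow> rvec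
     \<Rightarrow> rvec \<times> real \<Rightarrow> rvec \<times> real \<Rightarrow> bool" where
  "LAMM_iter d L g gu phi0 lv = (\<lambda>(b', phi') (b, phi).
     \<exists>i::nat. phi = gu ^ i * max phi0 (phi' / gu) \<and>
       b = prox_step d g lv phi b' \<and> majorizes d L g lv b' phi \<and>
       (\<forall>j<i. \<not> majorizes d L g lv b' (gu ^ j * max phi0 (phi' / gu))))"

text \<open>The problem with weights \<open>lv\<close>, started at the pair \<open>x\<close>, stops after exactly \<open>k\<close> LAMM
  iterations with the pair \<open>y\<close>.\<close>
definition solved_in ::
  "nat \<Rightarrow> (rvec \<Rightarrow> real) \<Rightarrow> (rvec \<Rightarrow> rvec) \<Rightarrow> real \<Rightarrow> real \<Rightarrow> rvec \<Rightarrow> real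
     \<Rightarrow> nat \<Rightarrow> rvec \<times> real \<Rightarrow> rvec \<times> real \<Rightarrow> bool" where
  "solved_in d L g gu phi0 lv eps k x y \<longleftrightarrow>
     (\<exists>p. p 0 = x \<and> p k = y \<and>
        (\<forall>i<k. omega d g lv (fst (p i)) > eps \<and> LAMM_iter d L g gu phi0 lv (p i) (p (Suc i))) \<and>
        omega d g lv (fst (p k)) \<le> eps)"

text \<open>\<open>st i\<close> is the output of problem \<open>i\<close> (approximate solution and last \<open>\<phi>\<close>) for \<open>i \<le> l\<close>;
  the step from \<open>i = 0\<close> is the contraction stage.\<close>
definition ILAMM_run ::
  "nat \<Rightarrow> (rvec \<Rightarrow> real) \<Rightarrow> (rvec \<Rightarrow> rvec) \<Rightarrow> (real \<Rightarrow> real) \<Rightarrow> real \<Rightarrow> real \<Rightarrow> real \<Rightarrow> real \<Rightarrow> real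
     \<Rightarrow> nat \<Rightarrow> (nat \<Rightarrow> rvec \<times> real) \<Rightarrow> bool" where
  "ILAMM_run d L g w gu phi0 lam eps_c eps_t l st \<longleftrightarrow>
     st 0 = (0, phi0) \<and>
     (\<forall>i<l. \<exists>k. solved_in d L g gu phi0 (weights d w lam (fst (st i)))
                  (if i = 0 then eps_c else eps_t) k (st i) (st (Suc i)))"

end

theory Submission
  imports Defs
begin

text \<open>
  Write \<open>s\<close> for the sparsity of the truth \<open>bs\<close>, \<open>lo\<close> and \<open>hi\<close> for the curvature bounds, and call
  \<open>g x - g bs\<close> the excess gradient at \<open>x\<close>. Proximal gradient descent converges linearly when the
  loss has curvature between \<open>lo\<close> and \<open>hi\<close>; here this holds only near \<open>bs\<close> and only along sparse
  directions, so everything depends on keeping all iterates near \<open>bs\<close> and inside one sparse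
  coordinate subspace. The noise level is at most \<open>lam / 4\<close> and the weights are at least \<open>lam / 2\<close>
  outside a set \<open>E\<close> with at most \<open>2 s\<close> elements, so a coordinate outside \<open>E\<close> can be active only
  where the excess gradient is at least \<open>lam / 4\<close>; sparsity is controlled by counting such
  coordinates.

  \<^bold>\<open>Approximate solutions\<close> (\<open>approximate_solution_error\<close>,
  \<open>card_excess_gradient_approximate_solution\<close>). The error of an approximate solution lies in a cone
  where its \<open>\<ell>\<^sub>1\<close>-mass outside \<open>E\<close> is at most five times that on \<open>E\<close>. Sparse curvature extends to
  this cone once the allowed sparsity is a large multiple of \<open>s\<close>, which is the role of the constant
  \<open>c\<^sub>L\<^sub>S\<^sub>E\<close>. This yields an error of order \<open>lam * sqrt s / lo\<close> and an excess loss of order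
  \<open>lam\<^sup>2 s / lo\<close>; as every coordinate with a large excess gradient permits a descent by a multiple of
  \<open>lam\<^sup>2 / hi\<close>, there are at most a multiple of \<open>s\<close> of these. The error bound also limits the number of
  coordinates whose weight falls below \<open>lam / 2\<close> in the next problem, so the argument repeats.

  \<^bold>\<open>One tightening problem\<close> (\<open>path_length\<close>, \<open>card_active_Suc\<close>, \<open>lamm_seq_controlled\<close>). The step
  parameter inherited from the contraction stage may be arbitrarily large, and then very many short
  steps can occur, so sparsity cannot be bounded step by step. However, the square root of the
  objective gap decreases at each step by a multiple of the step length that is independent of the
  step parameter. Hence the whole trajectory has length of order \<open>lam * sqrt s / lo\<close>, the gradient on
  sparse sets moves by at most \<open>hi\<close> times this, and so all coordinates ever activated together are at
  most a multiple of \<open>s\<close>. Gaps are measured against the latest iterate, which lies in the same sparse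
  subspace. That the trajectory stays near \<open>bs\<close> follows from strong convexity on the sublevel set of
  the starting point (\<open>sublevel_bound\<close>).

  \<^bold>\<open>Counting\<close> (\<open>not_optimal_imp_early\<close>, \<open>solved_in_logarithmic\<close>). The step parameter shrinks by
  \<open>gu\<close> per iteration until it is at most \<open>gu * hi\<close>; this costs a number of iterations that depends only
  on its initial size and is absorbed into the constant \<open>C''\<close>. Afterwards the gap contracts by a fixed
  factor, from at most order \<open>lam\<^sup>2 s\<close> down to order \<open>eps_t\<^sup>2\<close>, below which the stopping rule is met.
\<close>

section \<open>Euclidean geometry of finitely supported sequences\<close>

lemma coord_scaleR [simp]: "coord (c *\<^sub>R x) j = c * coord x j"
proof -
  have "finite {j. c * coord x j \<noteq> 0}"
    by (rule finite_subset[of _ "Poly_Mapping.keys x"]) (auto simp: in_keys_iff)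
  then show ?thesis by (simp add: scaleR_poly_mapping_def)
qed

lemmas coord_simps = lookup_add lookup_minus

lemma coord_eq_0: "Poly_Mapping.keys x \<subseteq> U \<Longrightarrow> j \<notin> U \<Longrightarrow> coord x j = 0"
  by (auto simp: in_keys_iff)

lemma keys_subset_iff: "Poly_Mapping.keys x \<subseteq> U \<longleftrightarrow> (\<forall>j. j \<notin> U \<longrightarrow> coord x j = 0)"
  by (auto simp: in_keys_iff)

lemma Rn_iff: "x \<in> Rn d \<longleftrightarrow> (\<forall>j\<ge>d. coord x j = 0)"
  by (auto simp: Rn_def keys_subset_iff not_less)

lemma Rn_closed [simp, intro]:
  "0 \<in> Rn d" "x \<in> Rn d \<Longrightarrow> y \<in> Rn d \<Longrightarrow> x + y \<in> Rn d"
  "x \<in> Rn d \<Longrightarrow> y \<in> Rn d \<Longrightarrow> x - y \<in> Rn d" "x \<in> Rn d \<Longrightarrow> c *\<^sub>R x \<in> Rn d"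
  "x \<in> Rn d \<Longrightarrow> - x \<in> Rn d"
  by (auto simp: Rn_iff coord_simps)

lemma keys_closed:
  fixes x y :: rvec
  shows
  "Poly_Mapping.keys x \<subseteq> U \<Longrightarrow> Poly_Mapping.keys y \<subseteq> U \<Longrightarrow> Poly_Mapping.keys (x - y) \<subseteq> U"
  "Poly_Mapping.keys x \<subseteq> U \<Longrightarrow> Poly_Mapping.keys y \<subseteq> U \<Longrightarrow> Poly_Mapping.keys (x + y) \<subseteq> U"
  "Poly_Mapping.keys x \<subseteq> U \<Longrightarrow> Poly_Mapping.keys (c *\<^sub>R x) \<subseteq> U"
  unfolding keys_subset_iff by (auto simp: coord_simps)

lemma coord_restr [simp]: "coord (restr d x U) j = (if j \<in> U \<and> j < d then coord x j else 0)"
  by (auto simp: restr_def)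

lemma restr_in_Rn [simp]: "restr d x U \<in> Rn d"
  by (simp add: restr_def)

lemma keys_restr: "Poly_Mapping.keys (restr d x U) \<subseteq> U"
  by (auto simp: keys_subset_iff)

lemma restr_id: "x \<in> Rn d \<Longrightarrow> Poly_Mapping.keys x \<subseteq> U \<Longrightarrow> restr d x U = x"
  by (rule poly_mapping_eqI) (auto simp: keys_subset_iff Rn_iff)

lemma dotp_simps:
  "dotp d (x + y) z = dotp d x z + dotp d y z" "dotp d z (x + y) = dotp d z x + dotp d z y"
  "dotp d (x - y) z = dotp d x z - dotp d y z" "dotp d z (x - y) = dotp d z x - dotp d z y"
  "dotp d (c *\<^sub>R x) z = c * dotp d x z" "dotp d z (c *\<^sub>R x) = c * dotp d z x"
  "dotp d 0 z = 0" "dotp d z 0 = 0" "dotp d (- x) z = - dotp d x z" "dotp d z (- x) = - dotp d z x"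
  by (auto simp: dotp_def coord_simps sum.distrib sum_subtractf sum_negf sum_distrib_left algebra_simps)

lemma dotp_commute: "dotp d x y = dotp d y x"
  by (simp add: dotp_def mult.commute)

lemma dotp_restr_left: "Poly_Mapping.keys h \<subseteq> U \<Longrightarrow> dotp d (restr d x U) h = dotp d x h"
  unfolding dotp_def by (rule sum.cong) (auto simp: coord_eq_0)

lemma dotp_restr_self: "dotp d x (restr d x U) = dotp d (restr d x U) (restr d x U)"
  unfolding dotp_def by (rule sum.cong) auto

lemma norm2_nonneg [simp]: "0 \<le> norm2 d x"
  by (simp add: norm2_def)

lemma norm2_sq: "(norm2 d x)\<^sup>2 = dotp d x x"
  by (simp add: norm2_def dotp_def L2_set_def sum_nonneg power2_eq_square)

lemma norm2_scaleR [simp]: "norm2 d (c *\<^sub>R x) = \<bar>c\<bar> * norm2 d x"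
proof -
  have "(norm2 d (c *\<^sub>R x))\<^sup>2 = (\<bar>c\<bar> * norm2 d x)\<^sup>2"
    unfolding power_mult_distrib norm2_sq dotp_simps by (simp add: power2_eq_square)
  then show ?thesis by (simp add: power2_eq_iff_nonneg)
qed

lemma norm2_minus [simp]: "norm2 d (- x) = norm2 d x"
  using norm2_scaleR[of d "-1" x] by simp

lemma norm2_zero [simp]: "norm2 d 0 = 0"
  using norm2_scaleR[of d 0 0] by simp

lemma norm2_diff_commute: "norm2 d (x - y) = norm2 d (y - x)"
proof -
  have "(norm2 d (x - y))\<^sup>2 = (norm2 d (y - x))\<^sup>2" by (simp add: norm2_sq dotp_simps)
  then show ?thesis by (simp add: power2_eq_iff_nonneg)
qed

lemma norm2_triangle: "norm2 d (x + y) \<le> norm2 d x + norm2 d y"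
  by (simp add: norm2_def coord_simps L2_set_triangle_ineq)

lemma norm2_triangle_diff: "norm2 d (x - z) \<le> norm2 d (x - y) + norm2 d (y - z)"
  using norm2_triangle[of d "x - y" "y - z"] by simp

lemma dotp_le: "dotp d x y \<le> norm2 d x * norm2 d y"
proof -
  have "dotp d x y \<le> (\<Sum>j<d. \<bar>coord x j\<bar> * \<bar>coord y j\<bar>)"
    unfolding dotp_def by (rule sum_mono) (metis abs_ge_self abs_mult)
  also have "\<dots> \<le> norm2 d x * norm2 d y"
    unfolding norm2_def by (rule L2_set_mult_ineq)
  finally show ?thesis .
qed

lemma dotp_ge: "- (norm2 d x * norm2 d y) \<le> dotp d x y"
  using dotp_le[of d "(-1) *\<^sub>R x" y] unfolding norm2_scaleR dotp_simps by simp

lemma norm2_eq_0: "x \<in> Rn d \<Longrightarrow> norm2 d x = 0 \<longleftrightarrow> x = 0"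
  by (auto simp: norm2_def L2_set_eq_0_iff Rn_iff intro!: poly_mapping_eqI)
     (metis lessThan_iff not_less)

lemma norm2_restr: "U \<subseteq> {..<d} \<Longrightarrow> norm2 d (restr d x U) = L2_set (coord x) U"
  unfolding norm2_def L2_set_def
  by (rule arg_cong[of _ _ sqrt], rule sum.mono_neutral_cong_right) auto

lemma abs_coord_le_norm2: "x \<in> Rn d \<Longrightarrow> \<bar>coord x j\<bar> \<le> norm2 d x"
proof (cases "j < d")
  case True
  have "\<bar>coord x j\<bar> \<le> L2_set (\<lambda>j. \<bar>coord x j\<bar>) {..<d}" using True by (intro member_le_L2_set) auto
  then show ?thesis by (simp add: norm2_def L2_set_def)
qed (simp add: Rn_iff)

lemma norm2_le_of_bounded:
  assumes "x \<in> Rn d" "Poly_Mapping.keys x \<subseteq> U" "finite U" "\<And>j. \<bar>coord x j\<bar> \<le> c"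
  shows "norm2 d x \<le> c * sqrt (card U)"
proof -
  have c: "0 \<le> c" using assms(4)[of 0] by linarith
  have "(norm2 d x)\<^sup>2 = (\<Sum>j<d. (coord x j)\<^sup>2)" unfolding norm2_sq dotp_def by (simp add: power2_eq_square)
  also have "\<dots> = (\<Sum>j\<in>{..<d} \<inter> U. (coord x j)\<^sup>2)"
    using assms by (intro sum.mono_neutral_right) (auto simp: coord_eq_0)
  also have "\<dots> \<le> (\<Sum>j\<in>U. (coord x j)\<^sup>2)"
    using assms by (intro sum_mono2) auto
  also have "\<dots> \<le> (\<Sum>j\<in>U. c\<^sup>2)"
    using assms(4) c by (intro sum_mono) (metis abs_le_square_iff abs_of_nonneg)
  also have "\<dots> = (c * sqrt (card U))\<^sup>2" by (simp add: power_mult_distrib)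
  finally show ?thesis using c by (simp add: power2_le_iff_abs_le)
qed

lemma sum_abs_le_sqrt_card:
  fixes f :: "nat \<Rightarrow> real"
  shows "(\<Sum>j\<in>U. \<bar>f j\<bar>) \<le> sqrt (card U) * L2_set f U"
  using L2_set_mult_ineq[of "\<lambda>_. 1" f U] by (simp add: L2_set_constant)

section \<open>Peeling off the largest entries\<close>

lemma exists_top_subset:
  fixes f :: "nat \<Rightarrow> real"
  assumes "finite A"
  shows "\<exists>J\<subseteq>A. card J \<le> m \<and> (\<forall>j\<in>A - J. real m * f j \<le> sum f J) \<and> (J = A \<or> card J = m)"
proof -
  have "\<exists>J\<subseteq>A. card J \<le> m \<and> (J = A \<or> card J = m) \<and> (\<forall>i\<in>J. \<forall>j\<in>A - J. f j \<le> f i)"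
  proof (induction m)
    case 0
    then show ?case by (intro exI[of _ "{}"]) auto
  next
    case (Suc m)
    then obtain J where J: "J \<subseteq> A" "card J \<le> m" "J = A \<or> card J = m" "\<forall>i\<in>J. \<forall>j\<in>A - J. f j \<le> f i"
      by blast
    show ?case
    proof (cases "J = A")
      case True
      then show ?thesis using J by (intro exI[of _ A]) auto
    next
      case False
      then have ne: "A - J \<noteq> {}" and fin: "finite (A - J)" using J assms by auto
      obtain i where i: "i \<in> A - J" "\<forall>j\<in>A - J. f j \<le> f i"
        using Max_in[of "f ` (A - J)"] Max_ge[of "f ` (A - J)"] fin ne by fastforce
      have "finite J" using J(1) assms finite_subset by auto
      then have "card (insert i J) = Suc m" using i J False by auto
      then show ?thesis using i J by (intro exI[of _ "insert i J"]) auto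
    qed
  qed
  then obtain J where J: "J \<subseteq> A" "card J \<le> m" "J = A \<or> card J = m" "\<forall>i\<in>J. \<forall>j\<in>A - J. f j \<le> f i"
    by blast
  have "real m * f j \<le> sum f J" if "j \<in> A - J" for j
    using J that sum_bounded_below[of J "f j" f] by auto
  then show ?thesis using J by blast
qed

text \<open>
  A seminorm controlled only on sparse vectors is controlled on all vectors by a mixture of the
  largest entry and the \<open>\<ell>\<^sub>1\<close>-norm: peel off the \<open>m\<close> largest entries; all remaining
  entries are at most the average of those removed, so the sup-norm term of the remainder is paid
  for by the \<open>\<ell>\<^sub>1\<close>-mass of the removed block.
\<close>
lemma seminorm_le_of_sparse_bound:
  fixes p :: "rvec \<Rightarrow> real"
  assumes sub: "\<And>x y. x \<in> Rn d \<Longrightarrow> y \<in> Rn d \<Longrightarrow> p (x + y) \<le> p x + p y"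
    and sparse: "\<And>x. x \<in> Rn d \<Longrightarrow> card (Poly_Mapping.keys x) \<le> m \<Longrightarrow> p x \<le> R * norm2 d x"
    and m: "0 < m" and R: "0 \<le> R"
    and v: "v \<in> Rn d" "\<And>j. \<bar>coord v j\<bar> \<le> a"
  shows "p v \<le> R * (sqrt m * a + norm1 d v / sqrt m)"
  using v
proof (induction "card (Poly_Mapping.keys v)" arbitrary: v a rule: less_induct)
  case less
  have a: "0 \<le> a" using less.prems(2)[of 0] by linarith
  have n1: "0 \<le> norm1 d x" for x by (simp add: norm1_def sum_nonneg)
  have small: "norm2 d x \<le> sqrt m * a"
    if "x \<in> Rn d" "card (Poly_Mapping.keys x) \<le> m" "\<And>j. \<bar>coord x j\<bar> \<le> a" for x
  proof -
    have "norm2 d x \<le> a * sqrt (card (Poly_Mapping.keys x))"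
      using that by (intro norm2_le_of_bounded) auto
    also have "\<dots> \<le> a * sqrt m" using that a by (intro mult_left_mono) auto
    finally show ?thesis by (simp add: mult.commute)
  qed
  show ?case
  proof (cases "card (Poly_Mapping.keys v) \<le> m")
    case True
    have "p v \<le> R * norm2 d v" using sparse True less.prems by blast
    also have "\<dots> \<le> R * (sqrt m * a + norm1 d v / sqrt m)"
      using small[OF less.prems(1) True less.prems(2)] R n1[of v]
      by (intro mult_left_mono) (auto intro: add_increasing2)
    finally show ?thesis .
  next
    case False
    let ?A = "Poly_Mapping.keys v"
    obtain J where J: "J \<subseteq> ?A" "card J \<le> m" "\<And>j. j \<in> ?A - J \<Longrightarrow> real m * \<bar>coord v j\<bar> \<le> (\<Sum>j\<in>J. \<bar>coord v j\<bar>)"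
      "J = ?A \<or> card J = m"
      using exists_top_subset[of ?A m "\<lambda>j. \<bar>coord v j\<bar>"] by auto
    have cJ: "card J = m" using J False by auto
    have Jd: "J \<subseteq> {..<d}" using J(1) less.prems(1) by (auto simp: Rn_def)
    define x y where "x = restr d v J" and "y = v - restr d v J"
    \<comment> \<open>The average removed entry bounds all remaining entries.\<close>
    define a' where "a' = (\<Sum>j\<in>J. \<bar>coord v j\<bar>) / m"
    have xy: "x \<in> Rn d" "y \<in> Rn d" "v = x + y" using less.prems by (auto simp: x_def y_def)
    have kx: "card (Poly_Mapping.keys x) \<le> m"
      using card_mono[OF finite_subset[OF J(1)] keys_restr[of d v J]] cJ by (simp add: x_def)
    have cy: "coord y j = (if j \<in> J then 0 else coord v j)" for j
      using less.prems(1) Jd by (auto simp: y_def coord_simps Rn_iff)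
    have ky: "Poly_Mapping.keys y = ?A - J" by (auto simp: in_keys_iff cy split: if_splits)
    have "card (Poly_Mapping.keys y) < card ?A"
      unfolding ky using J(1) cJ m finite_subset[OF J(1)] card_mono[OF _ J(1)]
      by (subst card_Diff_subset) auto
    moreover have "\<bar>coord y j\<bar> \<le> a'" for j
    proof (cases "j \<in> ?A - J")
      case True
      then show ?thesis using J(3)[of j] m by (auto simp: cy a'_def field_simps)
    next
      case False
      then have "coord y j = 0" by (metis ky not_in_keys_iff_lookup_eq_zero)
      then show ?thesis by (simp add: a'_def sum_nonneg)
    qed
    ultimately have py: "p y \<le> R * (sqrt m * a' + norm1 d y / sqrt m)"
      using less.hyps xy by blast
    have "norm2 d x \<le> sqrt m * a"
    proof (rule small[OF xy(1) kx])
      show "\<bar>coord x j\<bar> \<le> a" for j using less.prems(2)[of j] a by (auto simp: x_def)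
    qed
    then have px: "p x \<le> R * (sqrt m * a)"
      using sparse[OF xy(1) kx] R by (meson mult_left_mono order_trans)
    have "sqrt m * a' = (\<Sum>j\<in>J. \<bar>coord v j\<bar>) / sqrt m"
      unfolding a'_def using m by (simp add: field_simps)
    moreover have "norm1 d v = (\<Sum>j\<in>J. \<bar>coord v j\<bar>) + norm1 d y"
    proof -
      have "norm1 d v = (\<Sum>j\<in>J. \<bar>coord v j\<bar>) + (\<Sum>j\<in>{..<d} - J. \<bar>coord v j\<bar>)"
        unfolding norm1_def using Jd by (simp add: sum.subset_diff add.commute)
      also have "(\<Sum>j\<in>{..<d} - J. \<bar>coord v j\<bar>) = norm1 d y"
        unfolding norm1_def by (rule sum.mono_neutral_cong_left) (auto simp: cy)
      finally show ?thesis .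
    qed
    ultimately have eq: "sqrt m * a' + norm1 d y / sqrt m = norm1 d v / sqrt m"
      by (simp add: add_divide_distrib)
    have "p v \<le> p x + p y" using sub xy by simp
    also have "\<dots> \<le> R * (sqrt m * a) + R * (norm1 d v / sqrt m)" using px py unfolding eq by simp
    finally show ?thesis by (simp add: distrib_left)
  qed
qed

section \<open>Curvature of the loss on sparse and on nearly sparse directions\<close>

lemma abs_coord_le_norm: "\<bar>coord x j\<bar> \<le> norm x" for x :: rvec
proof (cases "j \<in> Poly_Mapping.keys x")
  case True
  then have "\<bar>coord x j\<bar> \<le> (\<Sum>n\<in>Poly_Mapping.keys x. \<bar>coord x n\<bar>)"
    by (intro member_le_sum) auto
  then show ?thesis by (simp add: norm_poly_mapping_def dist_poly_mapping_def)
qed (simp add: in_keys_iff)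

lemma bounded_linear_dotp: "bounded_linear (\<lambda>x. dotp d x h)"
proof (rule bounded_linear_intro)
  show "norm (dotp d x h) \<le> norm x * (\<Sum>j<d. \<bar>coord h j\<bar>)" for x
    unfolding dotp_def sum_distrib_left real_norm_def
    by (rule order_trans[OF sum_abs]) 
       (auto intro!: sum_mono mult_right_mono abs_coord_le_norm simp: abs_mult)
qed (simp_all add: dotp_simps)

lemma ball2_iff: "b \<in> ball2 d r bs \<longleftrightarrow> b \<in> Rn d \<and> norm2 d (b - bs) \<le> r"
  by (simp add: ball2_def)

lemma ball2_segment:
  assumes "x \<in> ball2 d r bs" "x + h \<in> ball2 d r bs" "h \<in> Rn d" "0 \<le> t" "t \<le> 1"
  shows "x + t *\<^sub>R h \<in> ball2 d r bs"
proof -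
  have "x + t *\<^sub>R h - bs = (1 - t) *\<^sub>R (x - bs) + t *\<^sub>R (x + h - bs)"
    by (simp add: algebra_simps)
  then have "norm2 d (x + t *\<^sub>R h - bs) \<le> (1 - t) * norm2 d (x - bs) + t * norm2 d (x + h - bs)"
    using norm2_triangle[of d "(1 - t) *\<^sub>R (x - bs)" "t *\<^sub>R (x + h - bs)"] assms by simp
  also have "\<dots> \<le> (1 - t) * r + t * r"
    using assms by (intro add_mono mult_left_mono) (auto simp: ball2_iff)
  also have "\<dots> = r" by (simp add: algebra_simps)
  finally show ?thesis using assms by (auto simp: ball2_iff)
qed

text \<open>The discriminant argument runs on the form \<open>z \<mapsto> \<langle>z, A z\<rangle>\<close> itself: the sum \<open>c\<close> of the two cross
  terms takes the place of twice the inner product in the Cauchy-Schwarz inequality.\<close>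
lemma sqrt_quadratic_form_triangle:
  fixes A :: "rvec \<Rightarrow> rvec"
  assumes A: "linear A" and psd: "\<And>z. z \<in> Rn d \<Longrightarrow> 0 \<le> dotp d z (A z)"
    and x: "x \<in> Rn d" and y: "y \<in> Rn d"
  shows "sqrt (dotp d (x + y) (A (x + y))) \<le> sqrt (dotp d x (A x)) + sqrt (dotp d y (A y))"
proof -
  define a b c where "a = sqrt (dotp d x (A x))" and "b = sqrt (dotp d y (A y))"
    and "c = dotp d x (A y) + dotp d y (A x)"
  have sq: "dotp d x (A x) = a\<^sup>2" "dotp d y (A y) = b\<^sup>2" and ab: "0 \<le> a" "0 \<le> b"
    using psd x y by (auto simp: a_def b_def)
  have form: "0 \<le> u\<^sup>2 * a\<^sup>2 + v\<^sup>2 * b\<^sup>2 - u * v * c" for u v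
  proof -
    have "0 \<le> dotp d (u *\<^sub>R x - v *\<^sub>R y) (A (u *\<^sub>R x - v *\<^sub>R y))" using psd x y by blast
    also have "\<dots> = u\<^sup>2 * a\<^sup>2 + v\<^sup>2 * b\<^sup>2 - u * v * c"
      by (simp add: linear_diff[OF A] linear_cmul[OF A] dotp_simps c_def flip: sq)
         (simp add: algebra_simps power2_eq_square)
    finally show ?thesis .
  qed
  have "c \<le> 2 * a * b"
  proof (rule ccontr)
    assume "\<not> c \<le> 2 * a * b"
    then have c: "2 * a * b < c" by simp
    then have c0: "0 < c" using ab by (smt (verit) mult_nonneg_nonneg)
    consider "a > 0" "b > 0" | "a = 0" | "b = 0" using ab by linarith
    then show False
    proof cases
      case 1
      have "(a * b) * c \<le> (a * b) * (2 * a * b)"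
        using form[of b a] by (simp add: algebra_simps power2_eq_square)
      then show False using 1 c by (simp add: mult_le_cancel_left)
    next
      case 2
      then show False using form[of "(b\<^sup>2 + 1) / c" 1] c0 by simp
    next
      case 3
      then show False using form[of 1 "(a\<^sup>2 + 1) / c"] c0 by simp
    qed
  qed
  moreover have "dotp d (x + y) (A (x + y)) = a\<^sup>2 + b\<^sup>2 + c"
    by (simp add: linear_add[OF A] dotp_simps c_def flip: sq)
  ultimately have "dotp d (x + y) (A (x + y)) \<le> (a + b)\<^sup>2"
    by (simp add: power2_sum)
  then have "sqrt (dotp d (x + y) (A (x + y))) \<le> a + b"
    using ab by (intro real_le_lsqrt) auto
  then show ?thesis by (simp add: a_def b_def)
qed

text \<open>Here \<open>q\<close> is the number of coordinates up to which directions count as sparse.\<close>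
locale sparse_spectrum =
  fixes d :: nat and L :: "rvec \<Rightarrow> real" and g :: "rvec \<Rightarrow> rvec" and H :: "rvec \<Rightarrow> rvec \<Rightarrow> rvec"
    and bs :: rvec and r lo hi :: real and q :: nat
  assumes bs [simp]: "bs \<in> Rn d"
    and loss: "admissible_loss d L g H bs r"
    and lo: "0 < lo" and lo_hi: "lo \<le> hi"
    and spectrum: "\<And>b h. b \<in> ball2 d r bs \<Longrightarrow> h \<in> Rn d \<Longrightarrow> card (Poly_Mapping.keys h) \<le> q \<Longrightarrow>
      lo * (norm2 d h)\<^sup>2 \<le> dotp d h (H b h) \<and> dotp d h (H b h) \<le> hi * (norm2 d h)\<^sup>2"
begin

lemma hi: "0 < hi" using lo lo_hi by simp

lemma g_Rn [simp]: "x \<in> Rn d \<Longrightarrow> g x \<in> Rn d"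
  using loss by (simp add: admissible_loss_def)

lemma linear_hessian: "b \<in> ball2 d r bs \<Longrightarrow> linear (H b)"
  using loss unfolding admissible_loss_def by (meson has_derivative_linear)

lemma line_has_derivative: "((\<lambda>t. x + t *\<^sub>R h) has_derivative (\<lambda>u. u *\<^sub>R h)) (at t within A)" for x h :: rvec
  by (auto intro!: derivative_eq_intros)

lemma loss_along_line:
  assumes "x \<in> Rn d" "h \<in> Rn d"
  shows "((\<lambda>t. L (x + t *\<^sub>R h)) has_real_derivative dotp d (g (x + t *\<^sub>R h)) h) (at t)"
proof -
  have "(L has_derivative (\<lambda>k. dotp d (g z) k)) (at z within Rn d)" if "z \<in> Rn d" for z
    using loss that by (simp add: admissible_loss_def)
  from has_derivative_in_compose2[OF this _ _ line_has_derivative]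
  have "((\<lambda>t. L (x + t *\<^sub>R h)) has_derivative (\<lambda>u. dotp d (g (x + t *\<^sub>R h)) (u *\<^sub>R h))) (at t)"
    using assms by (simp add: image_subset_iff)
  then show ?thesis
    by (rule has_derivative_imp_has_field_derivative) (simp add: dotp_simps)
qed

lemma gradient_along_line:
  assumes "x \<in> Rn d" "h \<in> Rn d" "x + t *\<^sub>R h \<in> ball2 d r bs"
  shows "((\<lambda>t. dotp d (g (x + t *\<^sub>R h)) h) has_real_derivative dotp d h (H (x + t *\<^sub>R h) h)) (at t)"
proof -
  have "(g has_derivative H (x + t *\<^sub>R h)) (at (x + t *\<^sub>R h) within Rn d)"
    using loss assms by (simp add: admissible_loss_def)
  then have "(g has_derivative H (x + t *\<^sub>R h)) (at (x + t *\<^sub>R h) within range (\<lambda>t. x + t *\<^sub>R h))"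
    by (rule has_derivative_subset) (use assms in auto)
  then have "((\<lambda>t. g (x + t *\<^sub>R h)) has_derivative (\<lambda>u. H (x + t *\<^sub>R h) (u *\<^sub>R h))) (at t)"
    by (rule has_derivative_in_compose[OF line_has_derivative])
  from bounded_linear.has_derivative[OF bounded_linear_dotp[of d h] this]
  have "((\<lambda>t. dotp d (g (x + t *\<^sub>R h)) h) has_derivative (\<lambda>u. dotp d (H (x + t *\<^sub>R h) (u *\<^sub>R h)) h)) (at t)" .
  then show ?thesis
    by (rule has_derivative_imp_has_field_derivative)
      (simp add: linear_cmul[OF linear_hessian[OF assms(3)]] dotp_simps dotp_commute[of d h])
qed

lemma first_order:
  assumes "x \<in> Rn d" "y \<in> Rn d"
  shows "L x + dotp d (g x) (y - x) \<le> L y"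
proof -
  define h where "h = y - x"
  have h: "h \<in> Rn d" using assms by (simp add: h_def)
  have "convex_on UNIV (\<lambda>t. L (x + t *\<^sub>R h))"
  proof (rule convex_onI)
    fix t u v :: real assume t: "0 < t" "t < 1"
    have "x + ((1 - t) *\<^sub>R u + t *\<^sub>R v) *\<^sub>R h = (1 - t) *\<^sub>R (x + u *\<^sub>R h) + t *\<^sub>R (x + v *\<^sub>R h)"
      by (simp add: algebra_simps)
    then show "L (x + ((1 - t) *\<^sub>R u + t *\<^sub>R v) *\<^sub>R h) \<le> (1 - t) * L (x + u *\<^sub>R h) + t * L (x + v *\<^sub>R h)"
      using loss t assms h by (auto simp: admissible_loss_def intro!: convex_onD)
  qed simp
  from convex_on_imp_above_tangent[OF this, where c = 0 and x = 1 and f' = "dotp d (g x) h"]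
  have "dotp d (g x) h \<le> L (x + h) - L x"
    using loss_along_line[OF assms(1) h, of 0] by simp
  then show ?thesis by (simp add: h_def)
qed

lemma gradient_monotone:
  assumes "x \<in> Rn d" "y \<in> Rn d" shows "0 \<le> dotp d (g y - g x) (y - x)"
  using first_order[OF assms] first_order[OF assms(2,1)] by (simp add: dotp_simps)

lemma gradient_along_line_mono:
  assumes "x \<in> Rn d" "h \<in> Rn d" "t \<le> u"
  shows "dotp d (g (x + t *\<^sub>R h)) h \<le> dotp d (g (x + u *\<^sub>R h)) h"
proof (cases "t = u")
  case False
  have "0 \<le> (u - t) * dotp d (g (x + u *\<^sub>R h) - g (x + t *\<^sub>R h)) h"
    using gradient_monotone[of "x + t *\<^sub>R h" "x + u *\<^sub>R h"] assms
    by (simp add: dotp_simps algebra_simps)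
  then show ?thesis using False assms by (simp add: zero_le_mult_iff dotp_simps)
qed simp

text \<open>Convexity makes the gradient monotone along lines, so the curvature is nonnegative in every
  direction, sparse or not.\<close>
lemma hessian_psd:
  assumes "b \<in> ball2 d r bs" "h \<in> Rn d" shows "0 \<le> dotp d h (H b h)"
proof -
  have "mono_on UNIV (\<lambda>t. dotp d (g (b + t *\<^sub>R h)) h)"
    using assms by (auto intro!: mono_onI gradient_along_line_mono simp: ball2_iff)
  from mono_on_imp_deriv_nonneg[OF this, of "dotp d h (H b h)" 0]
  show ?thesis using gradient_along_line[of b h 0] assms by (simp add: ball2_iff)
qed

text \<open>The second derivative along the segment is trapped between multiples of \<open>(norm2 d h)\<^sup>2\<close>;
  integrating twice gives the quadratic bounds.\<close>
lemma sparse_curvature: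
  assumes x: "x \<in> ball2 d r bs" "x + h \<in> ball2 d r bs" and h: "h \<in> Rn d" "card (Poly_Mapping.keys h) \<le> q"
  shows "L x + dotp d (g x) h + lo / 2 * (norm2 d h)\<^sup>2 \<le> L (x + h)"
    and "L (x + h) \<le> L x + dotp d (g x) h + hi / 2 * (norm2 d h)\<^sup>2"
proof -
  have xR: "x \<in> Rn d" using x by (simp add: ball2_iff)
  define \<psi> where "\<psi> t = dotp d (g (x + t *\<^sub>R h)) h" for t
  have seg: "x + t *\<^sub>R h \<in> ball2 d r bs" if "0 \<le> t" "t \<le> 1" for t
    using ball2_segment[OF x h(1) that] .
  have d\<psi>: "(\<psi> has_real_derivative dotp d h (H (x + t *\<^sub>R h) h)) (at t)" if "0 \<le> t" "t \<le> 1" for t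
    unfolding \<psi>_def using gradient_along_line[OF xR h(1) seg[OF that]] .
  have dL: "((\<lambda>t. L (x + t *\<^sub>R h)) has_real_derivative \<psi> t) (at t)" for t
    unfolding \<psi>_def using loss_along_line[OF xR h(1)] .
  have lower: "\<psi> 0 + t * (lo * (norm2 d h)\<^sup>2) \<le> \<psi> t" 
    and upper: "\<psi> t \<le> \<psi> 0 + t * (hi * (norm2 d h)\<^sup>2)" if t: "0 \<le> t" "t \<le> 1" for t
  proof -
    have "\<psi> 0 - 0 * (lo * (norm2 d h)\<^sup>2) \<le> \<psi> t - t * (lo * (norm2 d h)\<^sup>2)"
    proof (rule DERIV_nonneg_imp_nondecreasing[OF t(1)])
      fix u :: real assume "0 \<le> u" "u \<le> t"
      then show "\<exists>y. ((\<lambda>t. \<psi> t - t * (lo * (norm2 d h)\<^sup>2)) has_real_derivative y) (at u) \<and> 0 \<le> y"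
        using d\<psi>[of u] spectrum[OF seg h, of u] t
        by (intro exI[of _ "dotp d h (H (x + u *\<^sub>R h) h) - lo * (norm2 d h)\<^sup>2"])
           (auto intro!: derivative_eq_intros)
    qed
    then show "\<psi> 0 + t * (lo * (norm2 d h)\<^sup>2) \<le> \<psi> t" by simp
    have "0 * (hi * (norm2 d h)\<^sup>2) - \<psi> 0 \<le> t * (hi * (norm2 d h)\<^sup>2) - \<psi> t"
    proof (rule DERIV_nonneg_imp_nondecreasing[OF t(1)])
      fix u :: real assume "0 \<le> u" "u \<le> t"
      then show "\<exists>y. ((\<lambda>t. t * (hi * (norm2 d h)\<^sup>2) - \<psi> t) has_real_derivative y) (at u) \<and> 0 \<le> y"
        using d\<psi>[of u] spectrum[OF seg h, of u] t
        by (intro exI[of _ "hi * (norm2 d h)\<^sup>2 - dotp d h (H (x + u *\<^sub>R h) h)"])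
           (auto intro!: derivative_eq_intros)
    qed
    then show "\<psi> t \<le> \<psi> 0 + t * (hi * (norm2 d h)\<^sup>2)" by simp
  qed
  have "L (x + 0 *\<^sub>R h) - 0 * \<psi> 0 - lo / 2 * (norm2 d h)\<^sup>2 * 0\<^sup>2
      \<le> L (x + 1 *\<^sub>R h) - 1 * \<psi> 0 - lo / 2 * (norm2 d h)\<^sup>2 * 1\<^sup>2"
  proof (rule DERIV_nonneg_imp_nondecreasing[of 0 1])
    fix u :: real assume "0 \<le> u" "u \<le> 1"
    then show "\<exists>y. ((\<lambda>t. L (x + t *\<^sub>R h) - t * \<psi> 0 - lo / 2 * (norm2 d h)\<^sup>2 * t\<^sup>2) has_real_derivative y) (at u)
      \<and> 0 \<le> y"
      using dL[of u] lower[of u]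
      by (intro exI[of _ "\<psi> u - \<psi> 0 - u * (lo * (norm2 d h)\<^sup>2)"])
         (auto intro!: derivative_eq_intros)
  qed simp
  then show "L x + dotp d (g x) h + lo / 2 * (norm2 d h)\<^sup>2 \<le> L (x + h)" by (simp add: \<psi>_def)
  have "hi / 2 * (norm2 d h)\<^sup>2 * 0\<^sup>2 + 0 * \<psi> 0 - L (x + 0 *\<^sub>R h)
      \<le> hi / 2 * (norm2 d h)\<^sup>2 * 1\<^sup>2 + 1 * \<psi> 0 - L (x + 1 *\<^sub>R h)"
  proof (rule DERIV_nonneg_imp_nondecreasing[of 0 1])
    fix u :: real assume "0 \<le> u" "u \<le> 1"
    then show "\<exists>y. ((\<lambda>t. hi / 2 * (norm2 d h)\<^sup>2 * t\<^sup>2 + t * \<psi> 0 - L (x + t *\<^sub>R h)) has_real_derivative y) (at u)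
      \<and> 0 \<le> y"
      using dL[of u] upper[of u]
      by (intro exI[of _ "\<psi> 0 + u * (hi * (norm2 d h)\<^sup>2) - \<psi> u"])
         (auto intro!: derivative_eq_intros)
  qed simp
  then show "L (x + h) \<le> L x + dotp d (g x) h + hi / 2 * (norm2 d h)\<^sup>2" by (simp add: \<psi>_def)
qed

text \<open>
  Lower curvature in a direction that is merely close to sparse: the Hessian seminorm of the part
  outside \<open>I\<close> is bounded by peeling, and \<open>Q(u - v) \<le> 2 Q(u) + 2 Q(v)\<close> for a nonnegative
  quadratic form \<open>Q\<close> passes the lower bound from the sparse part to the whole direction.
\<close>
lemma nearly_sparse_curvature:
  assumes h: "bs + h \<in> ball2 d r bs" "h \<in> Rn d"
    and I: "card I \<le> q" "I \<subseteq> {..<d}" and m: "0 < m" "m \<le> q"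
    and tail: "\<And>j. j \<notin> I \<Longrightarrow> \<bar>coord h j\<bar> \<le> a"
  shows "lo / 2 * (norm2 d (restr d h I))\<^sup>2 - hi * (sqrt m * a + norm1 d (h - restr d h I) / sqrt m)\<^sup>2
    \<le> dotp d (g (bs + h) - g bs) h"
proof -
  define x v where "x = restr d h I" and "v = h - restr d h I"
  define T where "T = sqrt m * a + norm1 d v / sqrt m"
  have xv: "x \<in> Rn d" "v \<in> Rn d" "x = h - v" using h by (auto simp: x_def v_def)
  have "card (Poly_Mapping.keys x) \<le> card I"
    using I(2) finite_subset[OF I(2)] by (intro card_mono) (auto simp: x_def keys_restr)
  then have kx: "card (Poly_Mapping.keys x) \<le> q" using I by simp
  have r0: "bs \<in> ball2 d r bs" using h order_trans[OF norm2_nonneg] by (auto simp: ball2_iff)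
  obtain j where "j \<notin> I" using finite_subset[OF I(2)] ex_new_if_finite[OF infinite_UNIV_nat] by blast
  then have a: "0 \<le> a" using tail order_trans[OF abs_ge_zero] by blast
  have T: "0 \<le> T" using a by (simp add: T_def norm1_def sum_nonneg)
  have main: "lo / 2 * (norm2 d x)\<^sup>2 - hi * T\<^sup>2 \<le> dotp d h (H (bs + t *\<^sub>R h) h)" if "0 \<le> t" "t \<le> 1" for t
  proof -
    define b where "b = bs + t *\<^sub>R h"
    have b: "b \<in> ball2 d r bs" unfolding b_def using ball2_segment[OF r0 h(1,2) that] .
    have lin: "linear (H b)" using linear_hessian b .
    define Q where "Q z = dotp d z (H b z)" for z
    have psd: "0 \<le> Q z" if "z \<in> Rn d" for z using hessian_psd[OF b that] by (simp add: Q_def)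
    have "sqrt (Q v) \<le> sqrt hi * T" unfolding T_def
    proof (rule seminorm_le_of_sparse_bound[of d "\<lambda>z. sqrt (Q z)"])
      show "sqrt (Q (y + z)) \<le> sqrt (Q y) + sqrt (Q z)" if "y \<in> Rn d" "z \<in> Rn d" for y z
        unfolding Q_def using psd that by (intro sqrt_quadratic_form_triangle[OF lin]) (auto simp: Q_def)
      show "sqrt (Q z) \<le> sqrt hi * norm2 d z" if "z \<in> Rn d" "card (Poly_Mapping.keys z) \<le> m" for z
      proof -
        have "Q z \<le> hi * (norm2 d z)\<^sup>2" using spectrum[OF b that(1)] that(2) m by (simp add: Q_def)
        then have "sqrt (Q z) \<le> sqrt (hi * (norm2 d z)\<^sup>2)" by simp
        then show ?thesis using hi by (simp add: real_sqrt_mult)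
      qed
      show "\<bar>coord v j\<bar> \<le> a" for j
        using tail[of j] a I h(2) by (cases "j < d") (auto simp: v_def coord_simps Rn_iff)
    qed (use m hi xv in auto)
    then have "Q v \<le> (sqrt hi * T)\<^sup>2" using psd[OF xv(2)] by (metis real_sqrt_le_iff real_sqrt_pow2 sqrt_le_D)
    then have Qv: "Q v \<le> hi * T\<^sup>2" using hi by (simp add: power_mult_distrib)
    have "lo * (norm2 d x)\<^sup>2 \<le> Q x" using spectrum[OF b xv(1) kx] by (simp add: Q_def)
    \<comment> \<open>The parallelogram identity, as \<open>x = h - v\<close>.\<close>
    moreover have "Q x + Q (h + v) = 2 * Q h + 2 * Q v"
      unfolding Q_def xv(3) by (simp add: linear_diff[OF lin] linear_add[OF lin] dotp_simps)
    moreover have "0 \<le> Q (h + v)" using psd h(2) xv by blast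
    ultimately have "lo / 2 * (norm2 d x)\<^sup>2 \<le> Q h + Q v" by linarith
    then show ?thesis using Qv by (simp add: Q_def b_def)
  qed
  define c where "c = lo / 2 * (norm2 d x)\<^sup>2 - hi * T\<^sup>2"
  have "dotp d (g (bs + 0 *\<^sub>R h)) h - 0 * c \<le> dotp d (g (bs + 1 *\<^sub>R h)) h - 1 * c"
  proof (rule DERIV_nonneg_imp_nondecreasing[of 0 1])
    fix u :: real assume u: "0 \<le> u" "u \<le> 1"
    show "\<exists>y. ((\<lambda>t. dotp d (g (bs + t *\<^sub>R h)) h - t * c) has_real_derivative y) (at u) \<and> 0 \<le> y"
      using gradient_along_line[OF bs h(2) ball2_segment[OF r0 h(1,2) u]] main[OF u]
      by (intro exI[of _ "dotp d h (H (bs + u *\<^sub>R h) h) - c"])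
         (auto intro!: derivative_eq_intros simp: c_def)
  qed simp
  then show ?thesis by (simp add: c_def dotp_simps x_def T_def v_def)
qed

end

lemma LSE_imp_sparse_spectrum:
  assumes "bs \<in> Rn d" "admissible_loss d L g H bs r" "LSE d H bs r lo hi (real K) CLSE"
    "lo \<le> hi" "q \<le> 2 * (K + 1) * card (Poly_Mapping.keys bs)"
  shows "sparse_spectrum d L g H bs r lo hi q"
proof -
  define s where "s = card (Poly_Mapping.keys bs)"
  obtain st :: nat where st: "real st \<ge> real K * real s" "0 < lo"
    "ereal lo \<le> rho_minus d H bs (2 * s + 2 * st) r" "rho_plus d H bs (2 * s + 2 * st) r \<le> ereal hi"
    using assms(3) by (auto simp: LSE_def Let_def s_def)
  have "K * s \<le> st" using st(1) by (simp flip: of_nat_mult)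
  then have q: "q \<le> 2 * s + 2 * st" using assms(5) by (simp add: s_def algebra_simps)
  show ?thesis
  proof
    fix b h assume b: "b \<in> ball2 d r bs" and h: "h \<in> Rn d" "card (Poly_Mapping.keys h) \<le> q"
    show "lo * (norm2 d h)\<^sup>2 \<le> dotp d h (H b h) \<and> dotp d h (H b h) \<le> hi * (norm2 d h)\<^sup>2"
    proof (cases "h = 0")
      case False
      define n where "n = norm2 d h"
      have n: "0 < n" using False norm2_eq_0[OF h(1)] norm2_nonneg[of d h] by (simp add: n_def less_le)
      define u J where "u = (1 / n) *\<^sub>R h" and "J = Poly_Mapping.keys h"
      have uJ: "restr d u J = u"
        using h keys_closed(3)[of h J "1 / n"] by (intro restr_id) (auto simp: u_def J_def)
      have "u \<in> Rn d" "J \<subseteq> {..<d}" "card J \<le> 2 * s + 2 * st" "norm2 d (restr d u J) = 1"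
        using uJ h q n by (auto simp: u_def n_def J_def Rn_def keys_closed(3))
      then have "ereal (dotp d u (H b u)) \<in> local_quad d H bs (2 * s + 2 * st) r"
        unfolding local_quad_def mem_Collect_eq using b uJ
        by - (rule exI[of _ u], rule exI[of _ J], rule exI[of _ b], simp)
      then have "lo \<le> dotp d u (H b u)" "dotp d u (H b u) \<le> hi"
        using st(3,4) Inf_lower[of "ereal (dotp d u (H b u))"] Sup_upper[of "ereal (dotp d u (H b u))"]
        unfolding rho_minus_def rho_plus_def by (meson ereal_less_eq(3) order_trans)+
      moreover have "linear (H b)"
        using assms(2) b unfolding admissible_loss_def by (meson has_derivative_linear)
      then have "dotp d u (H b u) = dotp d h (H b h) / n\<^sup>2"
        by (simp add: u_def linear_cmul dotp_simps power2_eq_square)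
      ultimately show ?thesis using n by (simp add: field_simps n_def)
    qed (simp add: dotp_simps)
  qed (use assms st in auto)
qed

section \<open>Weighted absolute values, the optimality measure and the proximal step\<close>

text \<open>Membership of \<open>w\<close> in the subdifferential of \<open>\<lambda>t. l * \<bar>t\<bar>\<close> at \<open>t\<close>, for \<open>l \<ge> 0\<close>.\<close>
definition abs_subgradient :: "real \<Rightarrow> real \<Rightarrow> real \<Rightarrow> bool" where
  "abs_subgradient l t w \<longleftrightarrow> \<bar>w\<bar> \<le> l \<and> (t \<noteq> 0 \<longrightarrow> w = l * sgn t)"

lemma abs_subgradient_mult: "abs_subgradient l t w \<Longrightarrow> w * t = l * \<bar>t\<bar>"
  by (cases "t = 0") (auto simp: abs_subgradient_def abs_sgn)

lemma abs_subgradient_ineq: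
  assumes "abs_subgradient l t w" shows "l * \<bar>t\<bar> + w * (y - t) \<le> l * \<bar>y\<bar>"
proof -
  have "w * y \<le> \<bar>w\<bar> * \<bar>y\<bar>" by (metis abs_ge_self abs_mult)
  also have "\<dots> \<le> l * \<bar>y\<bar>" using assms by (intro mult_right_mono) (auto simp: abs_subgradient_def)
  finally show ?thesis using abs_subgradient_mult[OF assms] by (simp add: algebra_simps)
qed

lemma norm_max_le_iff: "0 < d \<Longrightarrow> norm_max d x \<le> c \<longleftrightarrow> (\<forall>j<d. \<bar>coord x j\<bar> \<le> c)"
  unfolding norm_max_def by (subst Max_le_iff) auto

lemma abs_coord_le_norm_max: "j < d \<Longrightarrow> \<bar>coord x j\<bar> \<le> norm_max d x"
  unfolding norm_max_def by (intro Max_ge) auto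

lemma subdiff_norm1_coord:
  assumes "xi \<in> subdiff_norm1 d b" "b \<in> Rn d" "j < d"
  shows "abs_subgradient 1 (coord b j) (coord xi j)"
proof -
  have le: "\<bar>coord b j\<bar> + coord xi j * (t - coord b j) \<le> \<bar>t\<bar>" for t
  proof -
    define v where "v = mk_vec d (\<lambda>i. if i = j then t else coord b i)"
    have "norm1 d v = \<bar>t\<bar> + (\<Sum>i\<in>{..<d} - {j}. \<bar>coord v i\<bar>)"
      unfolding norm1_def using assms(3) by (subst sum.remove[of _ j]) (auto simp: v_def)
    also have "(\<Sum>i\<in>{..<d} - {j}. \<bar>coord v i\<bar>) = (\<Sum>i\<in>{..<d} - {j}. \<bar>coord b i\<bar>)"
      by (rule sum.cong) (auto simp: v_def)
    finally have "norm1 d v + \<bar>coord b j\<bar> = \<bar>t\<bar> + norm1 d b"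
      unfolding norm1_def using assms(3) by (subst (2) sum.remove[of _ j]) auto
    moreover have "dotp d xi (v - b) = (\<Sum>i\<in>{..<d}. if i = j then coord xi j * (t - coord b j) else 0)"
      unfolding dotp_def by (rule sum.cong) (auto simp: v_def coord_simps)
    then have "dotp d xi (v - b) = coord xi j * (t - coord b j)" using assms(3) by simp
    moreover have "norm1 d b + dotp d xi (v - b) \<le> norm1 d v"
      using assms(1) by (simp add: subdiff_norm1_def v_def)
    ultimately show ?thesis by linarith
  qed
  have "\<bar>coord xi j\<bar> \<le> 1" using le[of "coord b j + 1", simplified] le[of "coord b j - 1", simplified] by linarith
  moreover have "coord xi j = sgn (coord b j)" if "coord b j \<noteq> 0"
  proof -
    have "coord xi j * coord b j = \<bar>coord b j\<bar>"
      using le[of 0] le[of "2 * coord b j"] by (simp add: algebra_simps)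
    also have "\<dots> = sgn (coord b j) * coord b j" by (simp add: mult_sgn_abs abs_sgn mult.commute)
    finally show ?thesis using that by simp
  qed
  ultimately show ?thesis by (simp add: abs_subgradient_def)
qed

lemma subdiff_norm1_I:
  assumes "\<And>j. j < d \<Longrightarrow> abs_subgradient 1 (coord b j) (x j)"
  shows "mk_vec d x \<in> subdiff_norm1 d b"
proof -
  have "norm1 d b + dotp d (mk_vec d x) (v - b) \<le> norm1 d v" for v
    unfolding norm1_def dotp_def sum.distrib[symmetric]
    using abs_subgradient_ineq[OF assms] by (intro sum_mono) (auto simp: coord_simps)
  then show ?thesis by (simp add: subdiff_norm1_def)
qed

text \<open>
  The objective and the subdifferential are separable, so the best choice in each coordinate,
  namely the admissible value nearest to the negative partial derivative, is optimal for all of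
  them at once.
\<close>
lemma omega_le_iff:
  assumes "0 < d" "b \<in> Rn d" and lv: "\<And>j. j < d \<Longrightarrow> 0 \<le> coord lv j"
  shows "omega d g lv b \<le> e \<longleftrightarrow>
    (\<exists>w. \<forall>j<d. abs_subgradient (coord lv j) (coord b j) (w j) \<and> \<bar>coord (g b) j + w j\<bar> \<le> e)"
proof
  define N where "N xi = norm_max d (g b + hadamard d lv xi)" for xi
  have N_le: "N xi \<le> c \<longleftrightarrow> (\<forall>j<d. \<bar>coord (g b) j + coord lv j * coord xi j\<bar> \<le> c)" for xi c
    unfolding N_def by (subst norm_max_le_iff[OF assms(1)]) (auto simp: hadamard_def coord_simps)
  assume e: "omega d g lv b \<le> e"
  define w where "w j = (if coord b j \<noteq> 0 then coord lv j * sgn (coord b j)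
      else max (- coord lv j) (min (coord lv j) (- coord (g b) j)))" for j
  have "\<bar>coord (g b) j + w j\<bar> \<le> e" if j: "j < d" for j
  proof -
    have "\<bar>coord (g b) j + w j\<bar> \<le> N xi" if xi: "xi \<in> subdiff_norm1 d b" for xi
    proof -
      have s: "abs_subgradient 1 (coord b j) (coord xi j)" using subdiff_norm1_coord[OF xi assms(2) j] .
      then have "\<bar>coord lv j * coord xi j\<bar> \<le> coord lv j"
        using lv[OF j] by (simp add: abs_mult abs_subgradient_def mult_left_le)
      then have "\<bar>coord (g b) j + w j\<bar> \<le> \<bar>coord (g b) j + coord lv j * coord xi j\<bar>"
        using s lv[OF j] by (auto simp: w_def abs_subgradient_def max_def min_def abs_if split: if_splits)
      also have "\<dots> \<le> N xi" using N_le[of xi "N xi"] j by auto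
      finally show ?thesis .
    qed
    then have "\<bar>coord (g b) j + w j\<bar> \<le> omega d g lv b"
      unfolding omega_def N_def[symmetric]
      by (intro cINF_greatest) (auto intro!: ex_in_conv[THEN iffD1] exI[of _ "mk_vec d (\<lambda>j. sgn (coord b j))"]
          subdiff_norm1_I simp: abs_subgradient_def sgn_if)
    then show ?thesis using e by linarith
  qed
  moreover have "abs_subgradient (coord lv j) (coord b j) (w j)" if "j < d" for j
    using lv[OF that] by (auto simp: abs_subgradient_def w_def abs_mult sgn_if)
  ultimately show "\<exists>w. \<forall>j<d. abs_subgradient (coord lv j) (coord b j) (w j) \<and> \<bar>coord (g b) j + w j\<bar> \<le> e"
    by blast
next
  assume "\<exists>w. \<forall>j<d. abs_subgradient (coord lv j) (coord b j) (w j) \<and> \<bar>coord (g b) j + w j\<bar> \<le> e"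
  then obtain w where w: "\<And>j. j < d \<Longrightarrow> abs_subgradient (coord lv j) (coord b j) (w j)"
    "\<And>j. j < d \<Longrightarrow> \<bar>coord (g b) j + w j\<bar> \<le> e" by blast
  define x where "x j = (if coord lv j = 0 then sgn (coord b j) else w j / coord lv j)" for j
  have "abs_subgradient 1 (coord b j) (x j)" and lx: "coord lv j * x j = w j" if "j < d" for j
    using w(1)[OF that] lv[OF that]
    by (auto simp: x_def abs_subgradient_def sgn_if divide_simps abs_if split: if_splits)
  then have "mk_vec d x \<in> subdiff_norm1 d b" by (intro subdiff_norm1_I)
  then have "omega d g lv b \<le> norm_max d (g b + hadamard d lv (mk_vec d x))"
    unfolding omega_def
    by (intro cINF_lower)
       (auto intro!: bdd_belowI[of _ 0] intro: order_trans[OF abs_ge_zero abs_coord_le_norm_max[OF assms(1)]])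
  also have "\<dots> \<le> e"
    using w(2) lx by (subst norm_max_le_iff[OF assms(1)]) (auto simp: hadamard_def coord_simps)
  finally show "omega d g lv b \<le> e" .
qed

lemma prox_step_in_Rn [simp]: "prox_step d g lv phi x \<in> Rn d"
  by (simp add: prox_step_def Let_def)

text \<open>Soft thresholding solves the optimality condition of the proximal subproblem: the negative
  gradient of its smooth part is a subgradient of the weighted absolute value.\<close>
lemma prox_step_subgradient:
  fixes g :: "rvec \<Rightarrow> rvec" and x :: rvec
  assumes "0 < phi" "0 \<le> coord lv j" "j < d"
  defines "y \<equiv> prox_step d g lv phi x"
  shows "abs_subgradient (coord lv j) (coord y j) (- (coord (g x) j + phi * (coord y j - coord x j)))"
proof -
  define z where "z = coord x j - coord (g x) j / phi"
  have y: "coord y j = sgn z * max (\<bar>z\<bar> - coord lv j / phi) 0"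
    using assms(3) by (simp add: y_def prox_step_def Let_def z_def coord_simps divide_inverse mult.commute)
  have w: "- (coord (g x) j + phi * (coord y j - coord x j)) = phi * z - phi * coord y j"
    using assms(1) by (simp add: z_def field_simps)
  show ?thesis
  proof (cases "\<bar>z\<bar> \<le> coord lv j / phi")
    case True
    then have "phi * \<bar>z\<bar> \<le> coord lv j" using assms(1) by (simp add: field_simps)
    then show ?thesis unfolding w using True y assms(1) by (simp add: abs_subgradient_def abs_mult)
  next
    case False
    then have y': "coord y j = sgn z * (\<bar>z\<bar> - coord lv j / phi)" and z: "\<bar>z\<bar> > coord lv j / phi"
      using y by auto
    have "0 \<le> coord lv j / phi" using assms(1,2) by simp
    then have "z \<noteq> 0" using z by (metis abs_zero not_less)
    with y' z have "sgn (coord y j) = sgn z" by (auto simp: sgn_mult)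
    moreover have "phi * z - phi * coord y j = coord lv j * sgn z"
      unfolding y' using assms(1) by (simp add: algebra_simps) (metis mult.commute mult_sgn_abs)
    ultimately show ?thesis unfolding w using assms(2) by (auto simp: abs_subgradient_def abs_mult sgn_if)
  qed
qed

section \<open>Approximate solutions are close to the truth and sparse\<close>

text \<open>The threshold \<open>lam / 4\<close> is what remains of a weight of at least \<open>lam / 2\<close> after subtracting a
  noise level (and tolerance) of at most \<open>lam / 4\<close>.\<close>
definition excess_gradient :: "nat \<Rightarrow> (rvec \<Rightarrow> rvec) \<Rightarrow> rvec \<Rightarrow> real \<Rightarrow> rvec \<Rightarrow> nat set" where
  "excess_gradient d g bs lam x = {j. j < d \<and> lam / 4 \<le> \<bar>coord (g x - g bs) j\<bar>}"

definition admissible_weights :: "nat \<Rightarrow> rvec \<Rightarrow> real \<Rightarrow> nat set \<Rightarrow> rvec \<Rightarrow> bool" where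
  "admissible_weights d bs lam E lv \<longleftrightarrow>
     Poly_Mapping.keys bs \<subseteq> E \<and> E \<subseteq> {..<d} \<and> card E \<le> 2 * card (Poly_Mapping.keys bs) \<and>
     (\<forall>j<d. 0 \<le> coord lv j \<and> coord lv j \<le> lam) \<and> (\<forall>j<d. j \<notin> E \<longrightarrow> lam / 2 \<le> coord lv j)"

context sparse_spectrum
begin

abbreviation "sparsity \<equiv> card (Poly_Mapping.keys bs)"

text \<open>
  The usual comparison of an upper quadratic model at \<open>y\<close> with the tangent plane at \<open>x\<close>, tested
  in the direction of the gradient difference. All points involved must stay in the ball, which is
  why \<open>x\<close> and \<open>y\<close> are restricted to a quarter of its radius.
\<close>
lemma sparse_gradient_lipschitz:
  assumes x: "x \<in> Rn d" "norm2 d (x - bs) \<le> r / 4" and y: "y \<in> Rn d" "norm2 d (y - bs) \<le> r / 4"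
    and U: "Poly_Mapping.keys (y - x) \<subseteq> U" "U \<subseteq> {..<d}" "card U \<le> q"
  shows "norm2 d (restr d (g y - g x) U) \<le> hi * norm2 d (y - x)"
proof -
  define v D n where "v = restr d (g y - g x) U" and "D = norm2 d (y - x)" and "n = norm2 d v"
  have fin: "finite U" using U(2) finite_subset by blast
  have sparse: "card (Poly_Mapping.keys z) \<le> q" if "Poly_Mapping.keys z \<subseteq> U" for z :: rvec
    using card_mono[OF fin that] U(3) by simp
  show ?thesis
  proof (cases "n = 0 \<or> D = 0")
    case True
    then show ?thesis
    proof
      assume "D = 0"
      then have "y - x = 0" using norm2_eq_0[of "y - x" d] x y by (simp add: D_def)
      then show ?thesis by (simp add: norm2_eq_0 restr_id)
    qed (use hi in \<open>simp add: n_def v_def\<close>)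
  next
    case False
    have pos: "0 < n" "0 < D" using False norm2_nonneg[of d] by (simp_all add: n_def D_def less_le)
    \<comment> \<open>A test step of the same length as \<open>y - x\<close>: it balances the two quadratic errors below.\<close>
    define h where "h = (- (D / n)) *\<^sub>R v"
    have hR: "h \<in> Rn d" by (simp add: h_def v_def)
    have hk: "Poly_Mapping.keys h \<subseteq> U" unfolding h_def v_def by (intro keys_closed(3) keys_restr)
    have hn: "norm2 d h = D" using pos by (simp add: h_def flip: n_def)
    have "D \<le> r / 2"
      using norm2_triangle_diff[of d y x bs] x(2) y(2) norm2_diff_commute[of d bs x] by (simp add: D_def)
    moreover have "norm2 d (y + h - bs) \<le> norm2 d (y - bs) + norm2 d h"
      using norm2_triangle[of d "y - bs" h] by (simp add: algebra_simps)
    moreover have "0 \<le> r" using order_trans[OF norm2_nonneg x(2)] by simp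
    ultimately have "norm2 d (y + h - bs) \<le> r" "norm2 d (y - bs) \<le> r" "norm2 d (x - bs) \<le> r"
      using x(2) y(2) hn by linarith+
    then have b: "y + h \<in> ball2 d r bs" "y \<in> ball2 d r bs" "x \<in> ball2 d r bs"
      using x y hR by (auto simp: ball2_iff)
    have "L x + dotp d (g x) (y + h - x) \<le> L (y + h)" using x y hR by (intro first_order) auto
    moreover have "L (y + h) \<le> L y + dotp d (g y) h + hi / 2 * D\<^sup>2"
      using sparse_curvature(2)[OF b(2,1) hR sparse[OF hk]] hn by simp
    moreover have "L y \<le> L x + dotp d (g x) (y - x) + hi / 2 * D\<^sup>2"
      using sparse_curvature(2)[of x "y - x"] b x y sparse[OF U(1)] by (simp add: D_def)
    ultimately have "dotp d (g x - g y) h \<le> hi * D\<^sup>2" by (simp add: dotp_simps)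
    moreover have "dotp d (g x - g y) h = D * n"
    proof -
      have "dotp d (g y - g x) v = n\<^sup>2" by (simp add: n_def norm2_sq v_def dotp_restr_self)
      moreover have "dotp d (g x - g y) h = D / n * dotp d (g y - g x) v"
        unfolding h_def dotp_simps by (simp add: algebra_simps)
      ultimately show ?thesis using pos by (simp add: power2_eq_square)
    qed
    ultimately have "D * n \<le> D * (hi * D)" by (simp add: power2_eq_square mult_ac)
    then show ?thesis using pos by (simp add: v_def n_def D_def)
  qed
qed

context
  fixes lam :: real and E :: "nat set" and lv :: rvec and e :: real and b :: rvec and w :: "nat \<Rightarrow> real"
  assumes lam: "0 < lam" and weights: "admissible_weights d bs lam E lv"
    and noise: "\<And>j. j < d \<Longrightarrow> \<bar>coord (g bs) j\<bar> + e \<le> lam / 4"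
    and b: "b \<in> Rn d"
    and w: "\<And>j. j < d \<Longrightarrow> abs_subgradient (coord lv j) (coord b j) (w j)"
    and opt: "\<And>j. j < d \<Longrightarrow> \<bar>coord (g b) j + w j\<bar> \<le> e"
begin

text \<open>
  Coordinatewise: the gradient at an approximate solution is the negative of a subgradient up to
  the tolerance, and noise plus tolerance amount to at most \<open>lam / 4\<close>. On \<open>E\<close> the subgradient costs
  at most \<open>lam\<close>; outside \<open>E\<close> the truth vanishes, so it acts with its full size \<open>lam / 2\<close> against the
  error.
\<close>
lemma basic_inequality:
  "dotp d (g b - g bs) (b - bs)
    \<le> 5 / 4 * lam * (\<Sum>j\<in>E. \<bar>coord (b - bs) j\<bar>) - lam / 4 * (\<Sum>j\<in>{..<d} - E. \<bar>coord (b - bs) j\<bar>)"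
proof -
  have E: "E \<subseteq> {..<d}" "Poly_Mapping.keys bs \<subseteq> E" using weights by (auto simp: admissible_weights_def)
  define D where "D = b - bs"
  have term_le: "coord (g b - g bs) j * coord D j \<le> (lam / 4) * \<bar>coord D j\<bar> - w j * coord D j" if "j < d" for j
  proof -
    have "coord (g b - g bs) j * coord D j = (coord (g b) j + w j - coord (g bs) j) * coord D j - w j * coord D j"
      by (simp add: algebra_simps coord_simps)
    also have "(coord (g b) j + w j - coord (g bs) j) * coord D j
        \<le> \<bar>coord (g b) j + w j - coord (g bs) j\<bar> * \<bar>coord D j\<bar>"
      by (metis abs_ge_self abs_mult)
    also have "\<dots> \<le> (lam / 4) * \<bar>coord D j\<bar>"
      using opt[OF that] noise[OF that] by (intro mult_right_mono; linarith)
    finally show ?thesis by simp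
  qed
  have inE: "coord (g b - g bs) j * coord D j \<le> 5 / 4 * lam * \<bar>coord D j\<bar>" if "j \<in> E" for j
  proof -
    have j: "j < d" using that E by auto
    have "- (w j * coord D j) \<le> \<bar>w j\<bar> * \<bar>coord D j\<bar>" by (metis abs_ge_minus_self abs_mult)
    also have "\<dots> \<le> lam * \<bar>coord D j\<bar>"
      using w[OF j] weights j
      by (intro mult_right_mono) (auto simp: abs_subgradient_def admissible_weights_def intro: order_trans)
    finally show ?thesis using term_le[OF j] by (simp add: algebra_simps)
  qed
  have outE: "coord (g b - g bs) j * coord D j \<le> - (lam / 4) * \<bar>coord D j\<bar>" if "j \<in> {..<d} - E" for j
  proof -
    have j: "j < d" using that by auto
    have "coord D j = coord b j" using E that coord_eq_0[of bs E j] by (simp add: D_def coord_simps)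
    then have "w j * coord D j = coord lv j * \<bar>coord D j\<bar>" using abs_subgradient_mult[OF w[OF j]] by simp
    moreover have "lam / 2 * \<bar>coord D j\<bar> \<le> coord lv j * \<bar>coord D j\<bar>"
      using weights that by (intro mult_right_mono) (auto simp: admissible_weights_def)
    ultimately show ?thesis using term_le[OF j] by (simp add: algebra_simps)
  qed
  have "dotp d (g b - g bs) D = (\<Sum>j\<in>E. coord (g b - g bs) j * coord D j) + (\<Sum>j\<in>{..<d} - E. coord (g b - g bs) j * coord D j)"
    unfolding dotp_def using E by (simp add: sum.subset_diff add.commute)
  also have "\<dots> \<le> (\<Sum>j\<in>E. 5 / 4 * lam * \<bar>coord D j\<bar>) + (\<Sum>j\<in>{..<d} - E. - (lam / 4) * \<bar>coord D j\<bar>)"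
    using inE outE by (intro add_mono sum_mono)
  finally show ?thesis unfolding D_def[symmetric] by (simp add: sum_distrib_left sum_negf)
qed

text \<open>
  The basic inequality scales along the segment to the truth and confines the error to the cone
  where the \<open>\<ell>\<^sub>1\<close>-mass outside \<open>E\<close> is at most five times that on \<open>E\<close>. On that cone, retaining the
  \<open>N * sparsity\<close> largest coordinates outside \<open>E\<close> leaves a remainder whose negative contribution to
  the curvature is at most half of the contribution of the retained part.
\<close>
lemma cone_error_bound:
  fixes N :: nat
  assumes N: "200 * hi \<le> real N * lo" "(2 + N) * sparsity \<le> q" and s: "1 \<le> sparsity"
    and t: "0 \<le> t" "t \<le> 1" and ball: "bs + t *\<^sub>R (b - bs) \<in> ball2 d r bs"
  shows "norm2 d (t *\<^sub>R (b - bs)) \<le> 11 * (lam * sqrt sparsity) / lo"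
    and "(\<Sum>j\<in>E. \<bar>coord (t *\<^sub>R (b - bs)) j\<bar>) \<le> 10 * (lam * sparsity) / lo"
proof -
  have E: "E \<subseteq> {..<d}" "card E \<le> 2 * sparsity" "finite E"
    using weights by (auto simp: admissible_weights_def intro: finite_subset)
  define h where "h = t *\<^sub>R (b - bs)"
  have hR: "h \<in> Rn d" using b by (simp add: h_def)
  define SE SC where "SE = (\<Sum>j\<in>E. \<bar>coord h j\<bar>)" and "SC = (\<Sum>j\<in>{..<d} - E. \<bar>coord h j\<bar>)"
  have upper: "dotp d (g (bs + h) - g bs) h \<le> 5 / 4 * lam * SE - lam / 4 * SC"
  proof -
    have "dotp d (g (bs + h) - g bs) h = t * (dotp d (g (bs + t *\<^sub>R (b - bs))) (b - bs) - dotp d (g bs) (b - bs))"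
      by (simp add: h_def dotp_simps algebra_simps)
    also have "\<dots> \<le> t * (dotp d (g (bs + 1 *\<^sub>R (b - bs))) (b - bs) - dotp d (g bs) (b - bs))"
      using gradient_along_line_mono[of bs "b - bs" t 1] b t by (intro mult_left_mono) auto
    also have "\<dots> = t * dotp d (g b - g bs) (b - bs)" by (simp add: dotp_simps)
    also have "\<dots> \<le> t * (5 / 4 * lam * (\<Sum>j\<in>E. \<bar>coord (b - bs) j\<bar>) - lam / 4 * (\<Sum>j\<in>{..<d} - E. \<bar>coord (b - bs) j\<bar>))"
      using basic_inequality t by (intro mult_left_mono)
    also have "\<dots> = 5 / 4 * lam * SE - lam / 4 * SC"
      using t unfolding SE_def SC_def h_def coord_scaleR abs_mult sum_distrib_left[symmetric]
      by (simp add: algebra_simps)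
    finally show ?thesis .
  qed
  have "0 \<le> dotp d (g (bs + h) - g bs) h" using gradient_monotone[of bs "bs + h"] hR by simp
  then have "lam * SC \<le> lam * (5 * SE)" using upper by simp
  then have cone: "SC \<le> 5 * SE" using lam by simp
  define m where "m = N * sparsity"
  have "0 < N" using N(1) hi lo by (intro gr0I) auto
  then have m: "0 < m" "m \<le> q" using s N by (auto simp: m_def)
  obtain J where J: "J \<subseteq> {..<d} - E" "card J \<le> m"
    "\<And>j. j \<in> {..<d} - E - J \<Longrightarrow> real m * \<bar>coord h j\<bar> \<le> (\<Sum>j\<in>J. \<bar>coord h j\<bar>)"
    using exists_top_subset[of "{..<d} - E" m "\<lambda>j. \<bar>coord h j\<bar>"] by auto
  define I a v where "I = E \<union> J" and "a = (\<Sum>j\<in>J. \<bar>coord h j\<bar>) / m" and "v = h - restr d h I"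
  have I: "I \<subseteq> {..<d}" using E J by (auto simp: I_def)
  have "card I \<le> card E + card J" unfolding I_def by (rule card_Un_le)
  also have "\<dots> \<le> q" using E(2) J(2) N(2) by (simp add: m_def algebra_simps)
  finally have cI: "card I \<le> q" .
  have tail: "\<bar>coord h j\<bar> \<le> a" if "j \<notin> I" for j
  proof (cases "j < d")
    case True
    then show ?thesis using J(3)[of j] that m by (simp add: a_def I_def field_simps)
  next
    case False
    then have "coord h j = 0" using hR by (simp add: Rn_iff)
    then show ?thesis by (simp add: a_def sum_nonneg)
  qed
  have vR: "v \<in> Rn d" using hR by (simp add: v_def)
  have vj: "coord v j = (if j \<in> I then 0 else coord h j)" for j
    using hR I by (auto simp: v_def coord_simps Rn_iff)
  have "norm1 d v = (\<Sum>j\<in>{..<d} - I. \<bar>coord h j\<bar>)"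
    unfolding norm1_def by (rule sum.mono_neutral_cong_right) (auto simp: vj)
  moreover have "{..<d} - I = ({..<d} - E) - J" by (auto simp: I_def)
  ultimately have SC: "SC = (\<Sum>j\<in>J. \<bar>coord h j\<bar>) + norm1 d v"
    unfolding SC_def using J(1) by (simp add: sum.subset_diff[of J] add.commute)
  define T where "T = sqrt m * a + norm1 d v / sqrt m"
  have T: "T = SC / sqrt m"
    using m by (simp add: T_def a_def SC add_divide_distrib) (simp add: field_simps)
  define X where "X = norm2 d (restr d h I)"
  have X0: "0 \<le> X" by (simp add: X_def)
  have "L2_set (coord h) E \<le> X"
    unfolding X_def norm2_restr[OF I] L2_set_def using E(3) I finite_subset[OF I]
    by (intro real_sqrt_le_mono sum_mono2) (auto simp: I_def)
  then have SEX: "SE \<le> sqrt (2 * sparsity) * X"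
    unfolding SE_def using E(2) X0
    by (intro order_trans[OF sum_abs_le_sqrt_card] mult_mono) auto
  have SE0: "0 \<le> SE" "0 \<le> SC" by (auto simp: SE_def SC_def sum_nonneg)
  have TX: "real N * T\<^sup>2 \<le> 50 * X\<^sup>2"
  proof -
    have "SC\<^sup>2 \<le> (5 * (sqrt (2 * sparsity) * X))\<^sup>2"
      using cone SEX SE0 by (intro power_mono) auto
    also have "\<dots> = 50 * sparsity * X\<^sup>2" by (simp add: power_mult_distrib)
    finally have "SC\<^sup>2 * real N \<le> 50 * sparsity * X\<^sup>2 * real N" by (rule mult_right_mono) simp
    then have "SC\<^sup>2 * real N \<le> 50 * X\<^sup>2 * m" by (simp add: m_def mult_ac)
    then show ?thesis using m by (simp add: T power_divide field_simps)
  qed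
  have "hi * T\<^sup>2 \<le> lo / 4 * X\<^sup>2"
  proof -
    have "200 * hi * T\<^sup>2 \<le> real N * lo * T\<^sup>2" using N(1) by (intro mult_right_mono) auto
    also have "\<dots> = lo * (real N * T\<^sup>2)" by simp
    also have "\<dots> \<le> lo * (50 * X\<^sup>2)" using TX lo by (intro mult_left_mono) auto
    finally show ?thesis by simp
  qed
  moreover have "lo / 2 * X\<^sup>2 - hi * T\<^sup>2 \<le> dotp d (g (bs + h) - g bs) h"
    unfolding X_def T_def v_def using ball hR cI I m tail
    by (intro nearly_sparse_curvature) (auto simp: h_def)
  moreover have "0 \<le> lam * SC" using lam SE0 by simp
  ultimately have "lo / 4 * X\<^sup>2 \<le> 5 / 4 * lam * SE" using upper by linarith
  also have "\<dots> \<le> 5 / 4 * lam * (sqrt (2 * sparsity) * X)" using SEX lam by (intro mult_left_mono) auto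
  finally have "X * (lo * X) \<le> X * (5 * lam * sqrt (2 * sparsity))"
    by (simp add: power2_eq_square algebra_simps)
  then have "X = 0 \<or> lo * X \<le> 5 * lam * sqrt (2 * sparsity)" using X0 by (auto simp: mult_le_cancel_left)
  then have loX: "lo * X \<le> 5 * lam * sqrt (2 * sparsity)" using lam by auto
  have "norm2 d v \<le> 1 * T" unfolding T_def
  proof (rule seminorm_le_of_sparse_bound)
    show "\<bar>coord v j\<bar> \<le> a" for j
      using tail[of j] m by (auto simp: vj a_def sum_nonneg)
  qed (use vR m in \<open>auto intro: norm2_triangle\<close>)
  moreover have "T \<le> X / 2"
  proof -
    have "200 * lo \<le> real N * lo" using N(1) lo_hi by linarith
    then have "200 \<le> real N" using lo by simp
    then have "200 * T\<^sup>2 \<le> real N * T\<^sup>2" by (intro mult_right_mono) auto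
    then have "T\<^sup>2 \<le> (X / 2)\<^sup>2" using TX by (simp add: power_divide)
    then show ?thesis using X0 by (simp add: power2_le_iff_abs_le)
  qed
  moreover have "norm2 d h \<le> X + norm2 d v"
    using norm2_triangle[of d "restr d h I" v] by (simp add: X_def v_def)
  ultimately have "lo * norm2 d h \<le> lo * (3 / 2 * X)" using lo by (intro mult_left_mono) auto
  also have "\<dots> = 3 / 2 * (lo * X)" by simp
  also have "\<dots> \<le> 3 / 2 * (5 * lam * sqrt (2 * sparsity))" using loX by (rule mult_left_mono) simp
  also have "\<dots> = 15 / 2 * sqrt 2 * (lam * sqrt sparsity)" by (simp add: real_sqrt_mult)
  also have "\<dots> \<le> 11 * (lam * sqrt sparsity)"
  proof -
    have "sqrt 2 \<le> 22 / 15" by (rule real_le_lsqrt) (simp_all add: power_divide)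
    then show ?thesis using lam by (intro mult_right_mono) auto
  qed
  finally show "norm2 d (t *\<^sub>R (b - bs)) \<le> 11 * (lam * sqrt sparsity) / lo"
    using lo by (simp add: h_def field_simps)
  have "lo * SE \<le> lo * (sqrt (2 * sparsity) * X)" using SEX lo by (intro mult_left_mono) auto
  also have "\<dots> = sqrt (2 * sparsity) * (lo * X)" by simp
  also have "\<dots> \<le> sqrt (2 * sparsity) * (5 * lam * sqrt (2 * sparsity))"
    using loX by (rule mult_left_mono) simp
  also have "\<dots> = 10 * (lam * sparsity)" by simp
  finally show "(\<Sum>j\<in>E. \<bar>coord (t *\<^sub>R (b - bs)) j\<bar>) \<le> 10 * (lam * sparsity) / lo"
    using lo by (simp add: SE_def h_def field_simps)
qed

text \<open>Since the error bound holds for every point of the segment inside the ball and is smaller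
  than the radius, the segment cannot leave the ball.\<close>
lemma approximate_solution_error:
  fixes N :: nat
  assumes N: "200 * hi \<le> real N * lo" "(2 + N) * sparsity \<le> q" and s: "1 \<le> sparsity"
    and r: "11 * (lam * sqrt sparsity) / lo < r"
  shows "norm2 d (b - bs) \<le> 11 * (lam * sqrt sparsity) / lo"
    and "(\<Sum>j\<in>E. \<bar>coord (b - bs) j\<bar>) \<le> 10 * (lam * sparsity) / lo"
proof -
  have "norm2 d (b - bs) \<le> r"
  proof (rule ccontr)
    assume "\<not> ?thesis"
    then have n: "r < norm2 d (b - bs)" by simp
    have r0: "0 < r" using r lam lo by (smt (verit) divide_nonneg_pos mult_nonneg_nonneg real_sqrt_ge_zero of_nat_0_le_iff)
    define t where "t = r / norm2 d (b - bs)"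
    have t: "0 \<le> t" "t \<le> 1" using n r0 by (auto simp: t_def divide_simps)
    have "norm2 d (t *\<^sub>R (b - bs)) = r" using n r0 by (simp add: t_def)
    moreover have "norm2 d (t *\<^sub>R (b - bs)) \<le> 11 * (lam * sqrt sparsity) / lo"
      using calculation b by (intro cone_error_bound[OF N s t]) (auto simp: ball2_iff)
    ultimately show False using r by simp
  qed
  then have "bs + 1 *\<^sub>R (b - bs) \<in> ball2 d r bs" using b by (simp add: ball2_iff)
  from cone_error_bound[OF N s _ _ this]
  show "norm2 d (b - bs) \<le> 11 * (lam * sqrt sparsity) / lo"
    "(\<Sum>j\<in>E. \<bar>coord (b - bs) j\<bar>) \<le> 10 * (lam * sparsity) / lo" by simp_all
qed

text \<open>
  Each coordinate with a large excess gradient permits a gradient step that lowers the tilted loss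
  \<open>L - \<langle>g bs, \<cdot>\<rangle>\<close> by a fixed multiple of \<open>lam\<^sup>2\<close>; the tilted loss is minimal at \<open>bs\<close>, so the total
  decrease is at most its excess at the approximate solution, and there are few such coordinates.
\<close>
lemma card_excess_gradient_approximate_solution:
  fixes N K :: nat
  assumes N: "200 * hi \<le> real N * lo" "(2 + N) * sparsity \<le> q" and s: "1 \<le> sparsity"
    and r: "11 * (lam * sqrt sparsity) / lo < r / 2"
    and K: "400 * hi \<le> real K * lo" "K * sparsity + 1 \<le> q"
    and r': "lam / (4 * hi) * sqrt (K * sparsity + 1) \<le> r / 2"
  shows "card (excess_gradient d g bs lam b) \<le> K * sparsity"
proof (rule ccontr)
  assume "\<not> ?thesis"
  \<comment> \<open>A subset that is just too large, yet still sparse enough for the curvature bound.\<close>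
  then obtain A where A: "A \<subseteq> excess_gradient d g bs lam b" "card A = K * sparsity + 1"
    by (metis Suc_eq_plus1 not_less_eq_eq obtain_subset_with_card_n)
  have Ad: "A \<subseteq> {..<d}" "finite A" using A(1) by (auto simp: excess_gradient_def intro: finite_subset)
  have "0 \<le> 11 * (lam * sqrt sparsity) / lo" using lam lo by simp
  then have "0 < r / 2" using r by (rule order_le_less_trans)
  then have r2: "11 * (lam * sqrt sparsity) / lo < r" using r by (auto intro: order_less_le_trans)
  note err = approximate_solution_error[OF N s r2]
  \<comment> \<open>The step size minimizing \<open>hi / 2 * u\<^sup>2 - u * lam / 4\<close>, the change per coordinate.\<close>
  define u where "u = lam / (4 * hi)"
  have u: "0 < u" using lam hi by (simp add: u_def)
  define h where "h = mk_vec d (\<lambda>j. if j \<in> A then - u * sgn (coord (g b - g bs) j) else 0)"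
  have hR: "h \<in> Rn d" by (simp add: h_def)
  have hk: "Poly_Mapping.keys h \<subseteq> A" by (auto simp: keys_subset_iff h_def)
  have hj: "\<bar>coord h j\<bar> \<le> u" for j using u by (auto simp: h_def abs_mult sgn_if)
  have hn: "norm2 d h \<le> u * sqrt (card A)" by (rule norm2_le_of_bounded[OF hR hk Ad(2) hj])
  have hq: "card (Poly_Mapping.keys h) \<le> q" using card_mono[OF Ad(2) hk] A(2) K(2) by simp
  have "norm2 d (b + h - bs) \<le> norm2 d (b - bs) + norm2 d h"
    using norm2_triangle[of d "b - bs" h] by (simp add: algebra_simps)
  moreover have "norm2 d h \<le> r / 2" using hn r' A(2) by (simp add: u_def)
  ultimately have "norm2 d (b + h - bs) \<le> r" using err(1) r by simp
  then have ball: "b \<in> ball2 d r bs" "b + h \<in> ball2 d r bs"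
    using err(1) r2 b hR by (auto simp: ball2_iff)
  have inner: "dotp d (g b - g bs) h \<le> - (u * lam / 4 * card A)"
  proof -
    have "dotp d (g b - g bs) h = (\<Sum>j\<in>A. - (u * \<bar>coord (g b - g bs) j\<bar>))"
      unfolding dotp_def using Ad
      by (intro sum.mono_neutral_cong_right) (auto simp: h_def sgn_if)
    also have "\<dots> \<le> (\<Sum>j\<in>A. - (u * lam / 4))"
    proof (rule sum_mono)
      fix j assume "j \<in> A"
      then have "u * (lam / 4) \<le> u * \<bar>coord (g b - g bs) j\<bar>"
        using A(1) u by (intro mult_left_mono) (auto simp: excess_gradient_def)
      then show "- (u * \<bar>coord (g b - g bs) j\<bar>) \<le> - (u * lam / 4)" by simp
    qed
    finally show ?thesis by (simp add: algebra_simps)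
  qed
  have "L bs + dotp d (g bs) (b + h - bs) \<le> L (b + h)" using b hR by (intro first_order) auto
  also have "L (b + h) \<le> L b + dotp d (g b) h + hi / 2 * (norm2 d h)\<^sup>2"
    using sparse_curvature(2)[OF ball hR hq] .
  also have "L b \<le> L bs + dotp d (g b) (b - bs)" using first_order[OF b bs] by (simp add: dotp_simps)
  finally have "0 \<le> dotp d (g b - g bs) (b - bs) + dotp d (g b - g bs) h + hi / 2 * (norm2 d h)\<^sup>2"
    by (simp add: dotp_simps)
  moreover have "dotp d (g b - g bs) (b - bs) \<le> 5 / 4 * lam * (10 * (lam * sparsity) / lo)"
  proof -
    have "0 \<le> lam / 4 * (\<Sum>j\<in>{..<d} - E. \<bar>coord (b - bs) j\<bar>)" using lam by (simp add: sum_nonneg)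
    moreover have "5 / 4 * lam * (\<Sum>j\<in>E. \<bar>coord (b - bs) j\<bar>) \<le> 5 / 4 * lam * (10 * (lam * sparsity) / lo)"
      using err(2) lam by (intro mult_left_mono) auto
    ultimately show ?thesis using basic_inequality by linarith
  qed
  moreover have "hi / 2 * (norm2 d h)\<^sup>2 \<le> hi / 2 * (u\<^sup>2 * card A)"
    using power_mono[OF hn norm2_nonneg, of 2] hi by (intro mult_left_mono) (auto simp: power_mult_distrib)
  ultimately have "0 \<le> 25 / 2 * lam\<^sup>2 * sparsity / lo - u * lam / 4 * card A + hi / 2 * (u\<^sup>2 * card A)"
    using inner by (simp add: power2_eq_square)
  also have "\<dots> = 25 / 2 * lam\<^sup>2 * sparsity / lo - lam\<^sup>2 * card A / (32 * hi)"
    using hi by (simp add: u_def field_simps power2_eq_square)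
  finally have "lam\<^sup>2 * (card A * lo) \<le> lam\<^sup>2 * (400 * hi * sparsity)"
    using hi lo by (simp add: field_simps)
  then have "real (card A) * lo \<le> 400 * hi * sparsity" using lam by simp
  also have "\<dots> \<le> real K * lo * sparsity" using K(1) by (intro mult_right_mono) auto
  finally have "real (card A) \<le> real (K * sparsity)" using lo by (simp add: mult_ac)
  then show False using A(2) by linarith
qed

text \<open>A nonzero coordinate outside \<open>E\<close> needs a gradient that balances a weight of at least
  \<open>lam / 2\<close>.\<close>
lemma keys_approximate_solution:
  "Poly_Mapping.keys b \<subseteq> E \<union> excess_gradient d g bs lam b"
proof
  fix j assume j: "j \<in> Poly_Mapping.keys b"
  then have jd: "j < d" using b by (auto simp: Rn_def)
  show "j \<in> E \<union> excess_gradient d g bs lam b"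
  proof (cases "j \<in> E")
    case False
    have "lam / 2 \<le> coord lv j" using weights False jd by (auto simp: admissible_weights_def)
    moreover have "\<bar>w j\<bar> = coord lv j"
      using w[OF jd] j weights jd by (auto simp: abs_subgradient_def in_keys_iff abs_mult sgn_if admissible_weights_def)
    ultimately have "lam / 4 \<le> \<bar>coord (g b) j - coord (g bs) j\<bar>"
      using opt[OF jd] noise[OF jd] by linarith
    then show ?thesis using jd by (simp add: excess_gradient_def coord_simps)
  qed simp
qed

end

end

section \<open>One iteration with backtracking\<close>

lemma weighted_norm_convex:
  fixes x y :: rvec
  assumes "\<And>j. j < d \<Longrightarrow> 0 \<le> coord lv j" "0 \<le> t" "t \<le> 1"
  shows "(\<Sum>j<d. coord lv j * \<bar>coord (x + t *\<^sub>R (y - x)) j\<bar>)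
    \<le> (1 - t) * (\<Sum>j<d. coord lv j * \<bar>coord x j\<bar>) + t * (\<Sum>j<d. coord lv j * \<bar>coord y j\<bar>)"
proof -
  have "coord lv j * \<bar>coord (x + t *\<^sub>R (y - x)) j\<bar>
      \<le> (1 - t) * (coord lv j * \<bar>coord x j\<bar>) + t * (coord lv j * \<bar>coord y j\<bar>)" if "j < d" for j
  proof -
    have "coord (x + t *\<^sub>R (y - x)) j = (1 - t) * coord x j + t * coord y j"
      by (simp add: coord_simps algebra_simps)
    then have "\<bar>coord (x + t *\<^sub>R (y - x)) j\<bar> \<le> (1 - t) * \<bar>coord x j\<bar> + t * \<bar>coord y j\<bar>"
      using abs_triangle_ineq[of "(1 - t) * coord x j" "t * coord y j"] assms(2,3) by (simp add: abs_mult)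
    from mult_left_mono[OF this assms(1)[OF that]] show ?thesis by (simp add: algebra_simps)
  qed
  then show ?thesis unfolding sum_distrib_left sum.distrib[symmetric] by (intro sum_mono) auto
qed

lemma objective_convex:
  assumes "convex_on (Rn d) L" "x \<in> Rn d" "y \<in> Rn d" "\<And>j. j < d \<Longrightarrow> 0 \<le> coord lv j" "0 \<le> t" "t \<le> 1"
  shows "objective d L (x + t *\<^sub>R (y - x)) lv \<le> (1 - t) * objective d L x lv + t * objective d L y lv"
proof -
  have "L (x + t *\<^sub>R (y - x)) \<le> (1 - t) * L x + t * L y"
    using convex_onD[OF assms(1,5,6,2,3)] by (simp add: algebra_simps)
  then show ?thesis using weighted_norm_convex[of d lv t x y, OF assms(4-6)]
    by (simp add: objective_def algebra_simps)
qed

text \<open>The optimality condition of the proximal subproblem turns majorization into a decrease of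
  the objective that is quadratic in the step length.\<close>
lemma majorizes_imp_decrease:
  assumes phi: "0 < phi" and lv: "\<And>j. j < d \<Longrightarrow> 0 \<le> coord lv j"
    and maj: "majorizes d L g lv x phi"
  defines "y \<equiv> prox_step d g lv phi x"
  shows "objective d L y lv + phi / 2 * (norm2 d (y - x))\<^sup>2 \<le> objective d L x lv"
    and "L y \<le> L x + dotp d (g x) (y - x) + phi / 2 * (norm2 d (y - x))\<^sup>2"
proof -
  show L: "L y \<le> L x + dotp d (g x) (y - x) + phi / 2 * (norm2 d (y - x))\<^sup>2"
    using maj by (simp add: majorizes_def Let_def objective_def Psi_def y_def)
  have "(\<Sum>j<d. coord lv j * \<bar>coord y j\<bar> + - (coord (g x) j + phi * (coord y j - coord x j)) * (coord x j - coord y j))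
      \<le> (\<Sum>j<d. coord lv j * \<bar>coord x j\<bar>)"
    using abs_subgradient_ineq[OF prox_step_subgradient[OF phi lv], of _ d g x] unfolding y_def
    by (intro sum_mono) auto
  moreover have "(\<Sum>j<d. coord lv j * \<bar>coord y j\<bar> + - (coord (g x) j + phi * (coord y j - coord x j)) * (coord x j - coord y j))
      = (\<Sum>j<d. coord lv j * \<bar>coord y j\<bar>) + dotp d (g x) (y - x) + phi * (norm2 d (y - x))\<^sup>2"
    unfolding norm2_sq dotp_def sum_distrib_left sum.distrib[symmetric]
    by (rule sum.cong) (auto simp: coord_simps algebra_simps)
  ultimately show "objective d L y lv + phi / 2 * (norm2 d (y - x))\<^sup>2 \<le> objective d L x lv"
    using L by (simp add: objective_def)
qed

text \<open>Outside \<open>E\<close> the threshold is at least \<open>lam / 2\<close>, so a zero coordinate can become nonzero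
  only where the excess gradient is large, whatever the step parameter.\<close>
lemma keys_prox_step:
  assumes phi: "0 < phi" and wt: "admissible_weights d bs lam E lv"
    and noise: "\<And>j. j < d \<Longrightarrow> \<bar>coord (g bs) j\<bar> \<le> lam / 4"
  shows "Poly_Mapping.keys (prox_step d g lv phi x)
    \<subseteq> Poly_Mapping.keys x \<union> E \<union> excess_gradient d g bs lam x"
proof
  define y where "y = prox_step d g lv phi x"
  fix j assume j: "j \<in> Poly_Mapping.keys (prox_step d g lv phi x)"
  have jd: "j < d" using j prox_step_in_Rn[of d g lv phi x] by (auto simp: Rn_def)
  show "j \<in> Poly_Mapping.keys x \<union> E \<union> excess_gradient d g bs lam x"
  proof (cases "j \<in> Poly_Mapping.keys x \<union> E")
    case False
    then have x0: "coord x j = 0" by (simp add: in_keys_iff)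
    have y0: "coord y j \<noteq> 0" using j by (simp add: y_def in_keys_iff)
    have lvj: "lam / 2 \<le> coord lv j" "0 \<le> coord lv j"
      using wt False jd by (auto simp: admissible_weights_def)
    have "- (coord (g x) j + phi * coord y j) = coord lv j * sgn (coord y j)"
      using prox_step_subgradient[OF phi lvj(2) jd, of g x] x0 y0 by (simp add: abs_subgradient_def y_def)
    then have "coord (g x) j = - (phi * coord y j + coord lv j * sgn (coord y j))" by linarith
    moreover have "\<bar>phi * coord y j + coord lv j * sgn (coord y j)\<bar> = phi * \<bar>coord y j\<bar> + coord lv j"
    proof (cases "0 < coord y j")
      case True
      then show ?thesis using mult_pos_pos[OF phi True] lvj(2) by simp
    next
      case False
      then have "coord y j < 0" using y0 by simp
      then show ?thesis using mult_pos_neg[OF phi, of "coord y j"] lvj(2) by simp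
    qed
    ultimately have "\<bar>coord (g x) j\<bar> = phi * \<bar>coord y j\<bar> + coord lv j" by (simp only: abs_minus_cancel)
    moreover have "0 \<le> phi * \<bar>coord y j\<bar>" using phi by simp
    ultimately have "coord lv j \<le> \<bar>coord (g x) j\<bar>" by linarith
    then have "lam / 4 \<le> \<bar>coord (g x) j - coord (g bs) j\<bar>" using lvj noise[OF jd] by linarith
    then show ?thesis using jd by (simp add: excess_gradient_def coord_simps)
  qed simp
qed

lemma LAMM_iterE:
  assumes "LAMM_iter d L g gu phi0 lv (x, a') (y, a)" "1 < gu" "0 < phi0"
  obtains "0 < a" "y = prox_step d g lv a x" "majorizes d L g lv x a"
  using assms by (auto simp: LAMM_iter_def intro!: mult_pos_pos simp: less_max_iff_disj)

text \<open>The search stops at the latest at the first trial value above \<open>hi\<close>, and each trial is at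
  most \<open>gu\<close> times the previous one.\<close>
lemma line_search_bound:
  assumes iter: "LAMM_iter d L g gu phi0 lv (x, a') (y, a)" and gu: "1 < gu" and phi0: "phi0 \<le> hi" "0 < hi"
    and large: "\<And>phi. hi \<le> phi \<Longrightarrow> majorizes d L g lv x phi"
  shows "a \<le> max (gu * hi) (a' / gu)"
proof -
  obtain i where i: "a = gu ^ i * max phi0 (a' / gu)" "\<And>j. j < i \<Longrightarrow> \<not> majorizes d L g lv x (gu ^ j * max phi0 (a' / gu))"
    using iter by (auto simp: LAMM_iter_def)
  show ?thesis
  proof (cases i)
    case 0
    have "1 * hi \<le> gu * hi" using gu phi0 by (intro mult_right_mono) auto
    then have "phi0 \<le> gu * hi" using phi0 by linarith
    then show ?thesis using i(1) 0 by auto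
  next
    case (Suc k)
    then have "gu ^ k * max phi0 (a' / gu) < hi" using i(2)[of k] large by (meson lessI not_le)
    then have "gu * (gu ^ k * max phi0 (a' / gu)) \<le> gu * hi" using gu by (intro mult_left_mono) auto
    then show ?thesis using i(1) Suc by (simp add: mult.assoc)
  qed
qed

lemma line_search_terminates:
  assumes gu: "1 < gu" and phi0: "0 < phi0" and large: "\<And>phi. hi \<le> phi \<Longrightarrow> majorizes d L g lv x phi"
  shows "\<exists>y. LAMM_iter d L g gu phi0 lv (x, a') y"
proof -
  define c where "c = max phi0 (a' / gu)"
  have c: "0 < c" using phi0 by (simp add: c_def less_max_iff_disj)
  obtain n where "hi / c < gu ^ n" using real_arch_pow[OF gu] by blast
  then have "majorizes d L g lv x (gu ^ n * c)" using c large by (simp add: field_simps)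
  then have ex: "\<exists>n. majorizes d L g lv x (gu ^ n * c)" by blast
  define i where "i = (LEAST n. majorizes d L g lv x (gu ^ n * c))"
  have "majorizes d L g lv x (gu ^ i * c)" "\<And>j. j < i \<Longrightarrow> \<not> majorizes d L g lv x (gu ^ j * c)"
    using LeastI_ex[OF ex] not_less_Least by (auto simp: i_def)
  then show ?thesis
    by (intro exI[of _ "(prox_step d g lv (gu ^ i * c) x, gu ^ i * c)"])
       (auto simp: LAMM_iter_def c_def intro!: exI[of _ i])
qed

section \<open>Trajectories of the iteration\<close>

lemma L2_set_sum_le:
  fixes f :: "nat \<Rightarrow> 'a \<Rightarrow> real" and n :: nat
  shows "L2_set (\<lambda>j. \<Sum>k<n. f k j) A \<le> (\<Sum>k<n. L2_set (f k) A)"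
proof (induction n)
  case (Suc n)
  have "L2_set (\<lambda>j. (\<Sum>k<n. f k j) + f n j) A \<le> L2_set (\<lambda>j. \<Sum>k<n. f k j) A + L2_set (f n) A"
    by (rule L2_set_triangle_ineq)
  then show ?case using Suc by simp
qed (simp add: L2_set_0')

text \<open>
  A quadratic decrease \<open>a D\<^sup>2 / 2\<close> together with a gap of order \<open>(a D)\<^sup>2\<close> makes the square root of
  the gap decrease by a multiple of \<open>D\<close> that does not depend on \<open>a\<close>. This is what bounds path
  lengths uniformly in the step parameter.
\<close>
lemma sqrt_gap_decrease:
  fixes a D M lo gap gap' :: real
  assumes lo: "0 < lo" "lo \<le> a" and D: "0 \<le> D" and M: "1 \<le> M" and gap': "0 \<le> gap'"
    and dec: "gap' + a / 2 * D\<^sup>2 \<le> gap" and ub: "gap' \<le> (M * a * D)\<^sup>2 / (2 * lo)"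
  shows "sqrt (2 * lo) / (2 * (2 * M + 1)) * D \<le> sqrt gap - sqrt gap'"
proof -
  \<comment> \<open>The claim is \<open>(x + c * D)\<^sup>2 \<le> gap\<close>; multiplying the increment by \<open>2 * N\<^sup>2\<close> clears denominators.\<close>
  define x c N where "x = sqrt gap'" and "c = sqrt (2 * lo) / (2 * (2 * M + 1))" and "N = 2 * M + 1"
  have N: "3 \<le> N" using M by (simp add: N_def)
  have x: "0 \<le> x" "x\<^sup>2 = gap'" using gap' by (auto simp: x_def)
  have c0: "0 \<le> c" using lo M by (simp add: c_def)
  have cN: "c * N = sqrt (2 * lo) / 2" using N by (simp add: c_def N_def[symmetric])
  have "sqrt (2 * lo) * x \<le> M * a * D"
  proof -
    have "(sqrt (2 * lo) * x)\<^sup>2 \<le> (M * a * D)\<^sup>2" using ub lo x by (simp add: power_mult_distrib field_simps)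
    then show ?thesis by (rule power2_le_imp_le) (use lo M D in simp)
  qed
  moreover have "2 * N * (c * x) = 2 * (c * N) * x" by simp
  then have "2 * N * (c * x) = sqrt (2 * lo) * x" unfolding cN by simp
  ultimately have cx: "2 * N * (c * x) \<le> M * a * D" by (simp only:)
  have cc: "2 * N\<^sup>2 * c\<^sup>2 \<le> a"
  proof -
    have "(c * N)\<^sup>2 = lo / 2" unfolding cN using lo by (simp add: power_divide)
    then show ?thesis using lo by (simp add: power_mult_distrib mult_ac)
  qed
  have "2 * N\<^sup>2 * (2 * x * (c * D) + (c * D)\<^sup>2) = 2 * N * D * (2 * N * (c * x)) + (2 * N\<^sup>2 * c\<^sup>2) * D\<^sup>2"
    by (simp add: algebra_simps power2_eq_square)
  also have "\<dots> \<le> 2 * N * D * (M * a * D) + a * D\<^sup>2"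
    using cx cc N D by (intro add_mono mult_left_mono mult_right_mono) auto
  also have "\<dots> = (N * (N - 1) + 1) * (a * D\<^sup>2)" by (simp add: N_def algebra_simps power2_eq_square)
  also have "\<dots> \<le> N\<^sup>2 * (a * D\<^sup>2)"
    using N lo mult_nonneg_nonneg[of a "D\<^sup>2"] by (intro mult_right_mono) (auto simp: algebra_simps power2_eq_square)
  also have "\<dots> = 2 * N\<^sup>2 * (a / 2 * D\<^sup>2)" by simp
  finally have "2 * x * (c * D) + (c * D)\<^sup>2 \<le> a / 2 * D\<^sup>2" using N by (simp add: mult_le_cancel_left)
  then have "(x + c * D)\<^sup>2 \<le> gap" using dec x(2) by (simp add: power2_sum)
  then have "x + c * D \<le> sqrt gap" using x c0 D by (intro real_le_rsqrt) auto
  then show ?thesis by (simp add: x_def c_def)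
qed

text \<open>
  One weighted problem started at \<open>x0\<close>, where \<open>g x0 + w0\<close> is a subgradient of the objective that is
  of order \<open>lam\<close> and vanishes outside a set of at most \<open>K0 * sparsity\<close> coordinates. The assumption
  on \<open>K2\<close> says that a gradient movement over the path length from \<open>bs\<close> to the end of the trajectory
  raises the excess gradient to \<open>lam / 4\<close> on at most \<open>K2 * sparsity\<close> coordinates. The last three
  assumptions make the ball large compared with all distances that occur.
\<close>
locale lamm_problem = sparse_spectrum +
  fixes lam gu phi0 :: real and E :: "nat set" and lv x0 :: rvec and w0 :: "nat \<Rightarrow> real"
    and K0 K2 :: nat and M :: real
  assumes lam: "0 < lam" and gu: "1 < gu" and phi0: "0 < phi0" "phi0 \<le> hi"
    and s: "1 \<le> sparsity"
    and weights: "admissible_weights d bs lam E lv"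
    and noise: "\<And>j. j < d \<Longrightarrow> \<bar>coord (g bs) j\<bar> \<le> lam / 4"
    and x0: "x0 \<in> Rn d" "norm2 d (x0 - bs) \<le> 11 * (lam * sqrt sparsity) / lo"
    and card_start: "card (E \<union> Poly_Mapping.keys x0 \<union> excess_gradient d g bs lam x0) \<le> K0 * sparsity"
    and w0: "\<And>j. j < d \<Longrightarrow> abs_subgradient (coord lv j) (coord x0 j) (w0 j)"
    and w0_bound: "\<And>j. j < d \<Longrightarrow> \<bar>coord (g x0) j + w0 j\<bar> \<le> 5 / 4 * lam"
    and w0_zero: "\<And>j. j < d \<Longrightarrow> j \<notin> E \<union> Poly_Mapping.keys x0 \<union> excess_gradient d g bs lam x0 \<Longrightarrow>
      coord (g x0) j + w0 j = 0"
    and M: "M = 1 + hi / lo" and K0: "1 \<le> K0"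
    and K2: "16 * (hi / lo * (11 + 5 / 4 * (2 * M + 1) * K0))\<^sup>2 \<le> K2"
    and q: "(K0 + 2 * K2 + 1) * sparsity \<le> q"
    and r1: "11 * (lam * sqrt sparsity) / lo \<le> r / 8"
    and r2: "5 / 2 * K0 * (lam * sqrt sparsity) / lo \<le> r / 8"
    and r3: "5 / 4 * (K0 + K2) * (lam * sqrt sparsity) / hi \<le> r / 4"
begin

abbreviation "F z \<equiv> objective d L z lv"
abbreviation "G \<equiv> excess_gradient d g bs lam"
abbreviation "start_set \<equiv> E \<union> Poly_Mapping.keys x0 \<union> G x0"

lemma lv: "j < d \<Longrightarrow> 0 \<le> coord lv j" "j < d \<Longrightarrow> coord lv j \<le> lam"
  using weights by (auto simp: admissible_weights_def)

lemma M1: "1 \<le> M" using hi lo by (simp add: M)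

lemma r: "0 \<le> r"
  using order_trans[OF norm2_nonneg x0(2)] r1 by linarith

lemma G_subset: "G x \<subseteq> {..<d}" by (auto simp: excess_gradient_def)

lemma start_set_subset: "start_set \<subseteq> {..<d}"
  using weights x0(1) by (auto simp: admissible_weights_def Rn_def excess_gradient_def)

lemma objective_lower:
  assumes "y \<in> ball2 d r bs" "z \<in> ball2 d r bs" "card (Poly_Mapping.keys (z - y)) \<le> q"
    and w: "\<And>j. j < d \<Longrightarrow> abs_subgradient (coord lv j) (coord y j) (w j)"
  shows "F y + dotp d (g y + mk_vec d w) (z - y) + lo / 2 * (norm2 d (z - y))\<^sup>2 \<le> F z"
proof -
  have "L y + dotp d (g y) (z - y) + lo / 2 * (norm2 d (z - y))\<^sup>2 \<le> L z"
    using sparse_curvature(1)[of y "z - y"] assms by (auto simp: ball2_iff)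
  moreover have "(\<Sum>j<d. coord lv j * \<bar>coord y j\<bar>) + dotp d (mk_vec d w) (z - y) \<le> (\<Sum>j<d. coord lv j * \<bar>coord z j\<bar>)"
    unfolding dotp_def sum.distrib[symmetric] using abs_subgradient_ineq[OF w]
    by (intro sum_mono) (auto simp: coord_simps)
  ultimately show ?thesis by (simp add: objective_def dotp_simps)
qed

text \<open>At most \<open>K0 * sparsity\<close> coordinates of size \<open>5 / 4 * lam\<close>; the factor \<open>K0\<close> instead of its
  square root keeps the constants simple.\<close>
lemma start_gradient_norm:
  "norm2 d (g x0 + mk_vec d w0) \<le> 5 / 4 * K0 * (lam * sqrt sparsity)"
proof -
  have "norm2 d (g x0 + mk_vec d w0) \<le> 5 / 4 * lam * sqrt (card start_set)"
  proof (rule norm2_le_of_bounded)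
    have out: "coord (g x0 + mk_vec d w0) j = 0" if "\<not> j < d" for j
      using x0 that g_Rn[of x0] by (simp add: coord_simps Rn_iff)
    show "Poly_Mapping.keys (g x0 + mk_vec d w0) \<subseteq> start_set"
      unfolding keys_subset_iff
    proof (intro allI impI)
      fix j assume "j \<notin> start_set"
      then show "coord (g x0 + mk_vec d w0) j = 0"
        using out[of j] w0_zero[of j] by (cases "j < d") (simp_all add: coord_simps)
    qed
    show "\<bar>coord (g x0 + mk_vec d w0) j\<bar> \<le> 5 / 4 * lam" for j
      using w0_bound[of j] out[of j] lam by (cases "j < d") (auto simp: coord_simps)
    show "finite start_set" using start_set_subset finite_subset by blast
  qed (use x0 in auto)
  also have "\<dots> \<le> 5 / 4 * lam * (K0 * sqrt sparsity)"
  proof (intro mult_left_mono)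
    have "card start_set \<le> K0 * (K0 * sparsity)" using card_start K0 by (simp add: order_trans)
    then have "real (card start_set) \<le> real (K0 * (K0 * sparsity))" by (simp only: of_nat_le_iff)
    then have "sqrt (card start_set) \<le> sqrt ((real K0)\<^sup>2 * sparsity)"
      by (simp add: power2_eq_square mult.assoc)
    then show "sqrt (card start_set) \<le> K0 * sqrt sparsity" by (simp add: real_sqrt_mult)
  qed (use lam in auto)
  finally show ?thesis by (simp add: mult_ac)
qed

text \<open>
  Strong convexity along sparse directions keeps points of the sublevel set that lie in the ball close
  to \<open>x0\<close>. A point of the sublevel set far away would, by convexity of the objective, produce one at
  distance exactly \<open>r / 2\<close>, which is excluded.
\<close>
lemma sublevel_bound:
  assumes z: "z \<in> Rn d" "F z \<le> F x0" and sparse: "card (Poly_Mapping.keys (z - x0)) \<le> q"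
  shows "norm2 d (z - bs) \<le> r / 4"
proof -
  define P where "P = 5 / 2 * K0 * (lam * sqrt sparsity) / lo"
  have bound: "norm2 d (t *\<^sub>R (z - x0)) \<le> P"
    if t: "0 \<le> t" "t \<le> 1" and le: "norm2 d (t *\<^sub>R (z - x0)) \<le> r / 2" for t
  proof -
    define z' where "z' = x0 + t *\<^sub>R (z - x0)"
    have "norm2 d (z' - bs) \<le> norm2 d (x0 - bs) + norm2 d (t *\<^sub>R (z - x0))"
      unfolding z'_def using norm2_triangle[of d "x0 - bs" "t *\<^sub>R (z - x0)"] by (simp add: algebra_simps)
    then have b: "z' \<in> ball2 d r bs" "x0 \<in> ball2 d r bs"
      using x0 r1 r le z(1) by (auto simp: ball2_iff z'_def)
    define D where "D = norm2 d (z' - x0)"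
    have "Poly_Mapping.keys (z' - x0) \<subseteq> Poly_Mapping.keys (z - x0)"
      unfolding z'_def using keys_closed(3)[of "z - x0" _ t] by simp
    then have k: "card (Poly_Mapping.keys (z' - x0)) \<le> q"
      using sparse card_mono[OF finite_keys] order_trans by blast
    have "F z' \<le> (1 - t) * F x0 + t * F z"
      unfolding z'_def using loss x0 z lv t by (intro objective_convex) (auto simp: admissible_loss_def)
    also have "\<dots> \<le> (1 - t) * F x0 + t * F x0" using z(2) t by (intro add_left_mono mult_left_mono) auto
    also have "\<dots> = F x0" by (simp add: algebra_simps)
    finally have "F z' \<le> F x0" .
    moreover have "F x0 + dotp d (g x0 + mk_vec d w0) (z' - x0) + lo / 2 * D\<^sup>2 \<le> F z'"
      unfolding D_def using b k w0 by (intro objective_lower) auto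
    moreover have "- (norm2 d (g x0 + mk_vec d w0) * D) \<le> dotp d (g x0 + mk_vec d w0) (z' - x0)"
      unfolding D_def by (rule dotp_ge)
    moreover have "norm2 d (g x0 + mk_vec d w0) * D \<le> 5 / 4 * K0 * (lam * sqrt sparsity) * D"
      using start_gradient_norm by (intro mult_right_mono) (auto simp: D_def)
    ultimately have "lo / 2 * D\<^sup>2 \<le> 5 / 4 * K0 * (lam * sqrt sparsity) * D" by linarith
    then have "D * (lo * D) \<le> D * (5 / 2 * K0 * (lam * sqrt sparsity))"
      by (simp add: power2_eq_square algebra_simps)
    then have "lo * D \<le> 5 / 2 * K0 * (lam * sqrt sparsity)" if "0 < D"
      using that by (rule mult_left_le_imp_le)
    moreover have "0 \<le> P" using lo lam by (simp add: P_def)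
    moreover have "0 < D \<or> D = 0" by (simp add: D_def less_le)
    ultimately have "D \<le> P" using lo by (auto simp: P_def pos_le_divide_eq mult.commute)
    then show ?thesis by (simp add: D_def z'_def)
  qed
  have P: "P \<le> r / 8" using r2 by (simp add: P_def)
  have "norm2 d (z - x0) \<le> r / 2"
  proof (rule ccontr)
    assume "\<not> ?thesis"
    then have n: "r / 2 < norm2 d (z - x0)" by simp
    then have n0: "0 < norm2 d (z - x0)" using r by simp
    define t where "t = r / 2 / norm2 d (z - x0)"
    have "norm2 d (t *\<^sub>R (z - x0)) = r / 2" using n0 r by (simp add: t_def)
    moreover have "0 \<le> t" "t \<le> 1" using n n0 r by (simp_all add: t_def pos_divide_le_eq)
    ultimately have "r / 2 \<le> P" using bound[of t] by simp
    then have "r = 0" using P r by simp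
    then have "P \<le> 0" using P by simp
    moreover have "0 < P" unfolding P_def using K0 lam lo s by simp
    ultimately show False by simp
  qed
  then have "norm2 d (z - x0) \<le> P" using bound[of 1] by simp
  then show ?thesis using norm2_triangle_diff[of d z bs x0] x0(2) r1 P by linarith
qed

definition lamm_seq :: "(nat \<Rightarrow> rvec \<times> real) \<Rightarrow> nat \<Rightarrow> bool" where
  "lamm_seq p n \<longleftrightarrow> fst (p 0) = x0 \<and> (\<forall>i<n. LAMM_iter d L g gu phi0 lv (p i) (p (Suc i)))"

text \<open>Only coordinates in \<open>start_set\<close>, or with a large excess gradient at an earlier iterate, can be
  nonzero at time \<open>n\<close>, by \<open>keys_prox_step\<close>.\<close>
definition active_set :: "(nat \<Rightarrow> rvec \<times> real) \<Rightarrow> nat \<Rightarrow> nat set" where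
  "active_set p n = start_set \<union> (\<Union>k<n. G (fst (p k)))"

text \<open>The invariant: one sparse set carries the whole trajectory, which stays near \<open>bs\<close>.\<close>
definition controlled :: "(nat \<Rightarrow> rvec \<times> real) \<Rightarrow> nat \<Rightarrow> bool" where
  "controlled p n \<longleftrightarrow> card (active_set p n) \<le> (K0 + K2) * sparsity \<and>
     (\<forall>k\<le>n. fst (p k) \<in> Rn d \<and> Poly_Mapping.keys (fst (p k)) \<subseteq> active_set p n
        \<and> norm2 d (fst (p k) - bs) \<le> r / 4)"

lemma active_set_subset: "active_set p n \<subseteq> {..<d}"
  using start_set_subset G_subset unfolding active_set_def by blast

lemma finite_active_set: "finite (active_set p n)"
  using active_set_subset finite_subset by blast

lemma keys_bs_active: "Poly_Mapping.keys bs \<subseteq> active_set p n"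
  using weights by (auto simp: active_set_def admissible_weights_def)

lemma active_set_mono: "k \<le> n \<Longrightarrow> active_set p k \<subseteq> active_set p n"
  unfolding active_set_def by (intro Un_mono UN_mono) auto

lemma lamm_step:
  assumes "lamm_seq p n" "k < n"
  shows "0 < snd (p (Suc k))" "fst (p (Suc k)) = prox_step d g lv (snd (p (Suc k))) (fst (p k))"
    "majorizes d L g lv (fst (p k)) (snd (p (Suc k)))"
proof -
  have "LAMM_iter d L g gu phi0 lv (fst (p k), snd (p k)) (fst (p (Suc k)), snd (p (Suc k)))"
    using assms by (simp add: lamm_seq_def)
  from LAMM_iterE[OF this gu phi0(1)] show "0 < snd (p (Suc k))"
    "fst (p (Suc k)) = prox_step d g lv (snd (p (Suc k))) (fst (p k))"
    "majorizes d L g lv (fst (p k)) (snd (p (Suc k)))" by blast+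
qed

lemma step_decrease:
  assumes "lamm_seq p n" "k < n"
  defines "x \<equiv> fst (p k)" and "y \<equiv> fst (p (Suc k))" and "a \<equiv> snd (p (Suc k))"
  shows "F y + a / 2 * (norm2 d (y - x))\<^sup>2 \<le> F x"
    and "L y \<le> L x + dotp d (g x) (y - x) + a / 2 * (norm2 d (y - x))\<^sup>2"
  using majorizes_imp_decrease[OF lamm_step(1)[OF assms(1,2)] lv(1) lamm_step(3)[OF assms(1,2)]]
    lamm_step(2)[OF assms(1,2)]
  by (simp_all add: x_def y_def a_def)

lemma objective_antimono:
  assumes "lamm_seq p n" "k \<le> j" "j \<le> n" shows "F (fst (p j)) \<le> F (fst (p k))"
  using assms(2,3)
proof (induction j rule: dec_induct)
  case (step j)
  have "0 \<le> snd (p (Suc j)) / 2 * (norm2 d (fst (p (Suc j)) - fst (p j)))\<^sup>2"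
    using lamm_step(1)[OF assms(1), of j] step by simp
  then show ?case using step_decrease(1)[OF assms(1), of j] step by simp
qed simp

context
  fixes p :: "nat \<Rightarrow> rvec \<times> real" and n :: nat
  assumes seq: "lamm_seq p n" and ctl: "controlled p n"
begin

abbreviation "x k \<equiv> fst (p k)"
abbreviation "a k \<equiv> snd (p (Suc k))"
abbreviation "D k \<equiv> norm2 d (x (Suc k) - x k)"
abbreviation "gap k \<equiv> F (x k) - F (x n)"

lemma x_props:
  assumes "k \<le> n"
  shows "x k \<in> Rn d" "Poly_Mapping.keys (x k) \<subseteq> active_set p n" "norm2 d (x k - bs) \<le> r / 4" "x k \<in> ball2 d r bs"
  using ctl assms r by (auto simp: controlled_def ball2_iff intro: order_trans)

lemma card_active_q: "card (active_set p n) + K2 * sparsity + 1 \<le> q"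
  using ctl q s by (simp add: controlled_def algebra_simps)

lemma sparse_diff:
  assumes "k \<le> n" "j \<le> n" shows "card (Poly_Mapping.keys (x k - x j)) \<le> q"
proof -
  have "Poly_Mapping.keys (x k - x j) \<subseteq> active_set p n"
    using x_props(2)[OF assms(1)] x_props(2)[OF assms(2)] by (rule keys_closed(1))
  then have "card (Poly_Mapping.keys (x k - x j)) \<le> card (active_set p n)"
    by (intro card_mono finite_active_set)
  then show ?thesis using card_active_q by linarith
qed

lemma gradient_step:
  assumes "k < n" "A \<subseteq> {..<d}" "card A \<le> K2 * sparsity + 1"
  shows "norm2 d (restr d (g (x (Suc k)) - g (x k)) (active_set p n \<union> A)) \<le> hi * D k"
proof -
  have "card (active_set p n \<union> A) \<le> q"
    using card_Un_le[of "active_set p n" A] card_active_q assms(3) by linarith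
  moreover have "Poly_Mapping.keys (x (Suc k) - x k) \<subseteq> active_set p n"
    using x_props(2) assms(1) by (intro keys_closed(1)) auto
  ultimately show ?thesis
    using x_props assms active_set_subset by (intro sparse_gradient_lipschitz) auto
qed

text \<open>A quadratic model with less curvature than \<open>lo\<close> cannot majorize a loss with curvature \<open>lo\<close>.\<close>
lemma step_parameter_lower:
  assumes "k < n" "0 < D k" shows "lo \<le> a k"
proof -
  have "x k + (x (Suc k) - x k) = x (Suc k)" by simp
  then have "L (x k) + dotp d (g (x k)) (x (Suc k) - x k) + lo / 2 * (D k)\<^sup>2 \<le> L (x (Suc k))"
    using sparse_curvature(1)[of "x k" "x (Suc k) - x k"] x_props assms(1) sparse_diff by auto
  then have "lo * (D k)\<^sup>2 \<le> a k * (D k)\<^sup>2" using step_decrease(2)[OF seq assms(1)] by simp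
  then show ?thesis using assms(2) by (simp add: mult_le_cancel_right)
qed

text \<open>A step that moves satisfies \<open>lo \<le> a k\<close>, so \<open>hi\<close> is at most \<open>hi / lo\<close> times \<open>a k\<close>; this is where
  \<open>M = 1 + hi / lo\<close> comes from.\<close>
lemma step_residual_le: "k < n \<Longrightarrow> (a k + hi) * D k \<le> M * a k * D k"
proof (cases "D k = 0")
  case False
  assume k: "k < n"
  have "0 < D k" using False by (simp add: less_le)
  with k have "lo \<le> a k" by (rule step_parameter_lower)
  then have "hi * lo \<le> hi * a k" using hi by simp
  then have "hi \<le> hi / lo * a k" using lo by (simp add: field_simps)
  then have "a k + hi \<le> M * a k" by (simp add: M algebra_simps)
  then show ?thesis by (intro mult_right_mono) auto
qed simp

lemma step_subgradient:
  assumes "k < n" "j < d"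
  shows "abs_subgradient (coord lv j) (coord (x (Suc k)) j)
    (- (coord (g (x k)) j + a k * (coord (x (Suc k)) j - coord (x k) j)))"
  using prox_step_subgradient[OF lamm_step(1)[OF seq assms(1)] lv(1)[OF assms(2)] assms(2), of g "x k"]
    lamm_step(2)[OF seq assms(1)] by simp

text \<open>
  The subgradient of the objective produced by a step has norm at most \<open>M * a k * D k\<close> on sparse
  sets, and strong convexity bounds the gap to any other point in terms of it. The point of
  comparison is the latest iterate \<open>x n\<close>, which lies in the same sparse subspace.
\<close>
lemma gap_le:
  assumes k: "k < n" shows "gap (Suc k) \<le> (M * a k * D k)\<^sup>2 / (2 * lo)"
proof -
  define w where "w j = - (coord (g (x k)) j + a k * (coord (x (Suc k)) j - coord (x k) j))" for j
  define z where "z = x n - x (Suc k)"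
  define e where "e = norm2 d z"
  have R: "x k \<in> Rn d" "x (Suc k) \<in> Rn d" using x_props(1) k by auto
  have zk: "Poly_Mapping.keys z \<subseteq> active_set p n"
    unfolding z_def using x_props(2) k by (intro keys_closed(1)) auto
  have "F (x (Suc k)) + dotp d (g (x (Suc k)) + mk_vec d w) z + lo / 2 * e\<^sup>2 \<le> F (x n)"
    unfolding z_def e_def using x_props(4) k sparse_diff step_subgradient[OF k]
    by (intro objective_lower) (auto simp: w_def)
  moreover have "dotp d (g (x (Suc k)) + mk_vec d w) z
      = dotp d (restr d (g (x (Suc k)) - g (x k)) (active_set p n)) z - a k * dotp d (x (Suc k) - x k) z"
  proof -
    have "g (x (Suc k)) + mk_vec d w = (g (x (Suc k)) - g (x k)) - a k *\<^sub>R (x (Suc k) - x k)"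
    proof (rule poly_mapping_eqI)
      fix j show "coord (g (x (Suc k)) + mk_vec d w) j = coord ((g (x (Suc k)) - g (x k)) - a k *\<^sub>R (x (Suc k) - x k)) j"
        using R g_Rn[OF R(1)] g_Rn[OF R(2)] by (auto simp: w_def coord_simps Rn_iff algebra_simps)
    qed
    then show ?thesis using dotp_restr_left[OF zk] by (simp add: dotp_simps)
  qed
  moreover have "- (hi * D k * e) \<le> dotp d (restr d (g (x (Suc k)) - g (x k)) (active_set p n)) z"
  proof -
    have "norm2 d (restr d (g (x (Suc k)) - g (x k)) (active_set p n)) * e \<le> hi * D k * e"
      using gradient_step[OF k, of "{}"] by (intro mult_right_mono) (auto simp: e_def)
    then show ?thesis using dotp_ge[of d "restr d (g (x (Suc k)) - g (x k)) (active_set p n)" z]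
      by (simp add: e_def)
  qed
  moreover have "a k * dotp d (x (Suc k) - x k) z \<le> a k * (D k * e)"
    using lamm_step(1)[OF seq k] dotp_le by (intro mult_left_mono) (auto simp: e_def)
  ultimately have "gap (Suc k) \<le> (a k + hi) * D k * e - lo / 2 * e\<^sup>2"
    by (simp add: algebra_simps)
  also have "\<dots> \<le> M * a k * D k * e - lo / 2 * e\<^sup>2"
    by (intro diff_right_mono mult_right_mono[OF step_residual_le[OF k]]) (simp add: e_def)
  also have "\<dots> = (M * a k * D k)\<^sup>2 / (2 * lo) - (lo * e - M * a k * D k)\<^sup>2 / (2 * lo)"
    using lo by (simp add: field_simps power2_eq_square)
  also have "\<dots> \<le> (M * a k * D k)\<^sup>2 / (2 * lo)" using lo by simp
  finally show ?thesis .
qed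

lemma gap_nonneg: "k \<le> n \<Longrightarrow> 0 \<le> gap k"
  using objective_antimono[OF seq] by simp

lemma gap_0: "gap 0 \<le> (5 / 4 * K0 * (lam * sqrt sparsity))\<^sup>2 / (2 * lo)"
proof -
  define c where "c = 5 / 4 * K0 * (lam * sqrt sparsity)"
  define e where "e = norm2 d (x n - x0)"
  have p0: "x 0 = x0" using seq by (simp add: lamm_seq_def)
  have "F x0 + dotp d (g x0 + mk_vec d w0) (x n - x0) + lo / 2 * e\<^sup>2 \<le> F (x n)"
    unfolding e_def using x_props(4)[of 0] x_props(4)[of n] sparse_diff[of n 0] w0
    by (intro objective_lower) (auto simp: p0)
  moreover have "- (norm2 d (g x0 + mk_vec d w0) * e) \<le> dotp d (g x0 + mk_vec d w0) (x n - x0)"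
    unfolding e_def by (rule dotp_ge)
  moreover have "norm2 d (g x0 + mk_vec d w0) * e \<le> c * e"
    unfolding c_def e_def using start_gradient_norm by (intro mult_right_mono) auto
  ultimately have "gap 0 \<le> c * e - lo / 2 * e\<^sup>2" by (simp add: p0)
  also have "\<dots> = c\<^sup>2 / (2 * lo) - (lo * e - c)\<^sup>2 / (2 * lo)"
    using lo by (simp add: field_simps power2_eq_square)
  also have "\<dots> \<le> c\<^sup>2 / (2 * lo)" using lo by simp
  finally show ?thesis by (simp add: c_def)
qed

text \<open>Telescoping the decrease of the square root of the gap.\<close>
lemma path_length: "(\<Sum>k<n. D k) \<le> 5 / 4 * (2 * M + 1) * K0 * (lam * sqrt sparsity) / lo"
proof -
  define c where "c = sqrt (2 * lo) / (2 * (2 * M + 1))"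
  have c: "0 < c" using lo M1 by (simp add: c_def)
  have "c * D k \<le> sqrt (gap k) - sqrt (gap (Suc k))" if k: "k < n" for k
  proof (cases "D k = 0")
    case True
    have "gap (Suc k) \<le> gap k" using objective_antimono[OF seq, of k "Suc k"] k by simp
    then show ?thesis using True by simp
  next
    case False
    then have "0 < D k" by (simp add: less_le)
    with k have "lo \<le> a k" by (rule step_parameter_lower)
    then show ?thesis unfolding c_def
      using lo M1 gap_nonneg[of "Suc k"] step_decrease(1)[OF seq k] gap_le[OF k] k
      by (intro sqrt_gap_decrease[where a = "a k"]) auto
  qed
  then have "(\<Sum>k<n. c * D k) \<le> (\<Sum>k<n. sqrt (gap k) - sqrt (gap (Suc k)))" by (intro sum_mono) auto
  also have "\<dots> = sqrt (gap 0) - sqrt (gap n)" by (rule sum_lessThan_telescope')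
  also have "\<dots> = sqrt (gap 0)" by simp
  also have "\<dots> \<le> sqrt ((5 / 4 * K0 * (lam * sqrt sparsity))\<^sup>2 / (2 * lo))" using gap_0 by simp
  also have "\<dots> = 5 / 4 * K0 * (lam * sqrt sparsity) / sqrt (2 * lo)"
    using lam by (simp add: real_sqrt_divide)
  finally have "c * (\<Sum>k<n. D k) \<le> 5 / 4 * K0 * (lam * sqrt sparsity) / sqrt (2 * lo)"
    by (simp add: sum_distrib_left)
  also have "\<dots> = c * (5 / 4 * (2 * M + 1) * K0 * (lam * sqrt sparsity) / lo)"
  proof -
    have "sqrt (2 * lo) * sqrt (2 * lo) = 2 * lo" using lo by simp
    moreover have "2 * M + 1 \<noteq> 0" using M1 by simp
    ultimately show ?thesis using lo by (simp add: c_def divide_simps) (simp add: algebra_simps)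
  qed
  finally show ?thesis using c by (rule mult_left_le_imp_le)
qed

text \<open>
  The gradient moves by at most \<open>hi\<close> times the path length, measured on any sparse set of
  coordinates. A coordinate whose excess gradient is ever large uses up a fixed amount of that
  movement, so only a bounded multiple of the sparsity can ever be activated.
\<close>
lemma card_active_Suc: "card (active_set p (Suc n)) \<le> (K0 + K2) * sparsity"
proof -
  define V where "V = (\<Union>k\<le>n. G (x k))"
  have Vd: "V \<subseteq> {..<d}" using G_subset by (auto simp: V_def)
  have "card V \<le> K2 * sparsity"
  proof (rule ccontr)
    assume "\<not> ?thesis"
    \<comment> \<open>One coordinate more than allowed: still sparse, so gradient differences are controlled on it.\<close>
    then obtain A where A: "A \<subseteq> V" "card A = K2 * sparsity + 1"
      by (metis Suc_eq_plus1 not_less_eq_eq obtain_subset_with_card_n)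
    have Ad: "A \<subseteq> {..<d}" using A(1) Vd by simp
    then have fA: "finite A" using finite_subset by blast
    define U where "U = active_set p n \<union> A"
    have Ud: "U \<subseteq> {..<d}" using Ad active_set_subset by (auto simp: U_def)
    have cU: "card U \<le> q" unfolding U_def
      using card_Un_le[of "active_set p n" A] card_active_q A(2) by linarith
    have p0: "x 0 = x0" using seq by (simp add: lamm_seq_def)
    have restrict: "L2_set (\<lambda>j. \<bar>coord v j\<bar>) A \<le> norm2 d (restr d v U)" for v
    proof -
      have "L2_set (\<lambda>j. \<bar>coord v j\<bar>) A = L2_set (coord v) A" by (simp add: L2_set_def)
      also have "\<dots> \<le> L2_set (coord v) U" unfolding L2_set_def
        using finite_subset[OF Ud] by (intro real_sqrt_le_mono sum_mono2) (auto simp: U_def)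
      finally show ?thesis using norm2_restr[OF Ud] by simp
    qed
    define P where "P = hi / lo * (11 + 5 / 4 * (2 * M + 1) * K0)"
    define f where "f k j = \<bar>coord (g (x (Suc k)) - g (x k)) j\<bar>" for k j
    \<comment> \<open>The total movement of the partial derivative along \<open>bs\<close>, \<open>x0\<close>, \<open>\<dots>\<close>, \<open>x n\<close>.\<close>
    define h where "h j = \<bar>coord (g x0 - g bs) j\<bar> + (\<Sum>k<n. f k j)" for j
    have h_large: "lam / 4 \<le> h j" if jA: "j \<in> A" for j
    proof -
      obtain k where k: "k \<le> n" "j \<in> G (x k)" using jA A(1) by (auto simp: V_def)
      have "coord (g (x k)) j - coord (g x0) j = (\<Sum>i<k. coord (g (x (Suc i)) - g (x i)) j)"
        unfolding coord_simps by (subst sum_lessThan_telescope) (simp add: p0)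
      then have "\<bar>coord (g (x k)) j - coord (g x0) j\<bar> \<le> (\<Sum>i<k. f i j)"
        unfolding f_def by (simp only: sum_abs)
      also have "\<dots> \<le> (\<Sum>i<n. f i j)" using k(1) by (intro sum_mono2) (auto simp: f_def)
      moreover have "lam / 4 \<le> \<bar>coord (g (x k)) j - coord (g bs) j\<bar>"
        using k(2) by (simp add: excess_gradient_def coord_simps)
      ultimately show ?thesis unfolding h_def coord_simps by linarith
    qed
    have "sqrt (card A) * (lam / 4) = L2_set (\<lambda>j. lam / 4) A" using lam by (simp add: L2_set_constant)
    also have "\<dots> \<le> L2_set h A" using h_large lam by (intro L2_set_mono) auto
    also have "\<dots> \<le> L2_set (\<lambda>j. \<bar>coord (g x0 - g bs) j\<bar>) A + L2_set (\<lambda>j. \<Sum>k<n. f k j) A"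
      unfolding h_def by (rule L2_set_triangle_ineq)
    also have "\<dots> \<le> L2_set (\<lambda>j. \<bar>coord (g x0 - g bs) j\<bar>) A + (\<Sum>k<n. L2_set (f k) A)"
      using L2_set_sum_le[of f n A] by simp
    also have "\<dots> \<le> hi * norm2 d (x0 - bs) + (\<Sum>k<n. hi * D k)"
    proof (intro add_mono sum_mono)
      have "Poly_Mapping.keys (x0 - bs) \<subseteq> U"
        using x_props(2)[of 0] keys_bs_active[of p n] p0 unfolding U_def
        by (intro keys_closed(1)) auto
      then have "norm2 d (restr d (g x0 - g bs) U) \<le> hi * norm2 d (x0 - bs)"
        using x_props(1,3)[of 0] p0 r Ud cU by (intro sparse_gradient_lipschitz) auto
      then show "L2_set (\<lambda>j. \<bar>coord (g x0 - g bs) j\<bar>) A \<le> hi * norm2 d (x0 - bs)"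
        using restrict order_trans by blast
      fix k assume "k \<in> {..<n}"
      then have "norm2 d (restr d (g (x (Suc k)) - g (x k)) U) \<le> hi * D k"
        unfolding U_def using Ad A(2) by (intro gradient_step) auto
      then show "L2_set (f k) A \<le> hi * D k" unfolding f_def using restrict order_trans by blast
    qed
    also have "\<dots> = hi * (norm2 d (x0 - bs) + (\<Sum>k<n. D k))" by (simp add: sum_distrib_left distrib_left)
    also have "\<dots> \<le> hi * (11 * (lam * sqrt sparsity) / lo + 5 / 4 * (2 * M + 1) * K0 * (lam * sqrt sparsity) / lo)"
      using x0(2) path_length hi by (intro mult_left_mono add_mono) auto
    also have "\<dots> = hi / lo * (11 + 5 / 4 * (2 * M + 1) * K0) * (lam * sqrt sparsity)"
      using lo by (simp add: field_simps)
    finally have "sqrt (card A) * (lam / 4) \<le> P * (lam * sqrt sparsity)" by (simp only: P_def)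
    then have "lam * sqrt (card A) \<le> lam * (4 * P * sqrt sparsity)"
      by (simp add: algebra_simps)
    then have "sqrt (card A) \<le> 4 * P * sqrt sparsity"
      using lam by (simp only: mult_le_cancel_left_pos)
    then have "(sqrt (card A))\<^sup>2 \<le> (4 * P * sqrt sparsity)\<^sup>2"
      by (intro power_mono) auto
    also have "\<dots> = 16 * P\<^sup>2 * sparsity" by (simp add: power_mult_distrib)
    also have "\<dots> \<le> real K2 * sparsity" using K2 by (intro mult_right_mono) (auto simp: P_def)
    finally have "real (card A) \<le> real (K2 * sparsity)" by simp
    then show False using A(2) by linarith
  qed
  moreover have "active_set p (Suc n) = start_set \<union> V"
    unfolding active_set_def V_def by (simp add: lessThan_Suc_atMost)
  ultimately show ?thesis using card_Un_le[of start_set V] card_start by (simp add: algebra_simps)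
qed

text \<open>For a large step parameter the proximal step is short enough to stay inside the ball, where
  the curvature bound applies to it.\<close>
lemma majorizes_large:
  assumes phi: "hi \<le> phi" shows "majorizes d L g lv (x n) phi"
proof -
  define y where "y = prox_step d g lv phi (x n)"
  have phi0: "0 < phi" using phi hi by simp
  define U where "U = active_set p (Suc n)"
  have Ud: "U \<subseteq> {..<d}" "finite U" unfolding U_def by (rule active_set_subset finite_active_set)+
  have kx: "Poly_Mapping.keys (x n) \<subseteq> U"
    using x_props(2)[of n] active_set_mono[of n "Suc n" p] by (auto simp: U_def)
  have "G (x n) \<subseteq> U" "E \<subseteq> U" by (auto simp: U_def active_set_def)
  then have ky: "Poly_Mapping.keys y \<subseteq> U"
    using keys_prox_step[where g = g and bs = bs and lam = lam and x = "x n", OF phi0 weights noise] kx unfolding y_def by blast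
  have cU: "card U \<le> q" and cU': "card U \<le> (K0 + K2) * sparsity"
    using card_active_Suc q by (auto simp: U_def algebra_simps intro: order_trans)
  have kd: "Poly_Mapping.keys (y - x n) \<subseteq> U" using ky kx by (rule keys_closed(1))
  define w where "w j = - (coord (g (x n)) j + phi * (coord y j - coord (x n) j))" for j
  have w: "\<bar>w j\<bar> \<le> lam" if "j < d" for j
    using prox_step_subgradient[OF phi0 lv(1)[OF that] that, of g "x n"] lv(2)[OF that]
    by (simp add: abs_subgradient_def w_def y_def)
  have xR: "x n \<in> Rn d" and yR: "y \<in> Rn d" using x_props(1)[of n] by (auto simp: y_def)
  define v where "v = restr d (mk_vec d (\<lambda>j. coord (g bs) j + w j)) U"
  have eq: "phi *\<^sub>R (y - x n) = (-1) *\<^sub>R (restr d (g (x n) - g bs) U + v)"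
  proof (rule poly_mapping_eqI)
    fix j show "coord (phi *\<^sub>R (y - x n)) j = coord ((-1) *\<^sub>R (restr d (g (x n) - g bs) U + v)) j"
      using coord_eq_0[OF kd, of j] Ud by (auto simp: v_def w_def coord_simps algebra_simps)
  qed
  have "phi * norm2 d (y - x n) = norm2 d (phi *\<^sub>R (y - x n))" using phi0 by simp
  also have "\<dots> = norm2 d (restr d (g (x n) - g bs) U + v)" unfolding eq norm2_scaleR by simp
  also have "\<dots> \<le> norm2 d (restr d (g (x n) - g bs) U) + norm2 d v" by (rule norm2_triangle)
  also have "\<dots> \<le> hi * norm2 d (x n - bs) + 5 / 4 * lam * sqrt (card U)"
  proof (intro add_mono)
    have "Poly_Mapping.keys (x n - bs) \<subseteq> U"
      using kx keys_bs_active[of p "Suc n"] unfolding U_def by (intro keys_closed(1))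
    then show "norm2 d (restr d (g (x n) - g bs) U) \<le> hi * norm2 d (x n - bs)"
      using x_props(3)[of n] xR r Ud cU by (intro sparse_gradient_lipschitz) auto
    show "norm2 d v \<le> 5 / 4 * lam * sqrt (card U)"
    proof (rule norm2_le_of_bounded)
      fix j
      have "\<bar>coord (g bs) j + w j\<bar> \<le> 5 / 4 * lam" if "j < d"
        using w[OF that] noise[OF that] by linarith
      then show "\<bar>coord v j\<bar> \<le> 5 / 4 * lam" using lam by (auto simp: v_def)
    qed (auto simp: v_def keys_restr Ud)
  qed
  also have "\<dots> \<le> phi * (r / 4) + phi * (r / 4)"
  proof (intro add_mono)
    show "hi * norm2 d (x n - bs) \<le> phi * (r / 4)"
      using phi x_props(3)[of n] hi r by (intro mult_mono) auto
    have "card U \<le> (K0 + K2) * ((K0 + K2) * sparsity)" using cU' K0 by (simp add: order_trans)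
    then have "real (card U) \<le> real ((K0 + K2) * ((K0 + K2) * sparsity))" by (simp only: of_nat_le_iff)
    then have "sqrt (card U) \<le> sqrt ((real (K0 + K2))\<^sup>2 * sparsity)"
      by (simp add: power2_eq_square mult.assoc)
    then have "sqrt (card U) \<le> real (K0 + K2) * sqrt sparsity" by (simp add: real_sqrt_mult)
    then have "5 / 4 * lam * sqrt (card U) \<le> 5 / 4 * lam * (real (K0 + K2) * sqrt sparsity)"
      using lam by (intro mult_left_mono) auto
    also have "\<dots> = hi * (5 / 4 * (K0 + K2) * (lam * sqrt sparsity) / hi)" using hi by simp
    also have "\<dots> \<le> hi * (r / 4)" using r3 hi by (intro mult_left_mono) auto
    also have "\<dots> \<le> phi * (r / 4)" using phi r by (intro mult_right_mono) auto
    finally show "5 / 4 * lam * sqrt (card U) \<le> phi * (r / 4)" .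
  qed
  also have "\<dots> = phi * (r / 2)" by simp
  finally have "norm2 d (y - x n) \<le> r / 2" using phi0 by (simp add: mult_le_cancel_left)
  then have "norm2 d (y - bs) \<le> r"
    using norm2_triangle_diff[of d y bs "x n"] x_props(3)[of n] r by linarith
  then have yb: "y \<in> ball2 d r bs" using yR by (simp add: ball2_iff)
  have "card (Poly_Mapping.keys (y - x n)) \<le> q" using card_mono[OF Ud(2) kd] cU by simp
  then have "L y \<le> L (x n) + dotp d (g (x n)) (y - x n) + hi / 2 * (norm2 d (y - x n))\<^sup>2"
    using sparse_curvature(2)[of "x n" "y - x n"] x_props(4)[of n] yb xR yR by simp
  also have "\<dots> \<le> L (x n) + dotp d (g (x n)) (y - x n) + phi / 2 * (norm2 d (y - x n))\<^sup>2"
    using phi by (intro add_left_mono mult_right_mono) auto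
  finally show ?thesis
    by (simp add: majorizes_def Let_def objective_def Psi_def flip: y_def)
qed

text \<open>The subgradient produced by the last step is a certificate for the optimality measure; a single
  additional coordinate keeps the active set sparse, so its partial derivatives are controlled.\<close>
lemma omega_le:
  assumes n: "n = Suc m" shows "omega d g lv (x n) \<le> M * a m * D m"
proof -
  have m: "m < n" using n by simp
  have d0: "0 < d"
  proof -
    have "card (Poly_Mapping.keys bs) \<le> card {..<d}"
      using bs by (intro card_mono) (auto simp: Rn_def)
    then show ?thesis using s by simp
  qed
  define w where "w j = - (coord (g (x m)) j + a m * (coord (x n) j - coord (x m) j))" for j
  have "\<bar>coord (g (x n)) j + w j\<bar> \<le> M * a m * D m" if j: "j < d" for j
  proof -
    have "\<bar>coord (g (x n) - g (x m)) j\<bar> \<le> norm2 d (restr d (g (x n) - g (x m)) (active_set p n \<union> {j}))"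
      using abs_coord_le_norm2[of "restr d (g (x n) - g (x m)) (active_set p n \<union> {j})" d j] j by simp
    also have "\<dots> \<le> hi * D m" using gradient_step[OF m, of "{j}"] j n by simp
    finally have "\<bar>coord (g (x n)) j - coord (g (x m)) j\<bar> \<le> hi * D m" by (simp add: coord_simps)
    moreover have "\<bar>a m * (coord (x n) j - coord (x m) j)\<bar> \<le> a m * D m"
      using abs_coord_le_norm2[of "x n - x m" d j] x_props(1) m n lamm_step(1)[OF seq m]
      by (simp add: abs_mult coord_simps)
    ultimately have "\<bar>coord (g (x n)) j + w j\<bar> \<le> hi * D m + a m * D m" unfolding w_def by linarith
    then show ?thesis using step_residual_le[OF m] by (simp add: algebra_simps)
  qed
  then show ?thesis
    using d0 lv(1) x_props(1)[of n] step_subgradient[OF m] n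
    by (subst omega_le_iff) (auto simp: w_def intro!: exI[of _ w])
qed

end

text \<open>
  The induction closes because the bound on the enlarged active set depends only on the iterates
  already known to be controlled. The new iterate is then supported in that set, and it is close to
  \<open>bs\<close> because the objective has not increased.
\<close>
lemma lamm_seq_controlled: "lamm_seq p n \<Longrightarrow> controlled p n"
proof (induction n)
  case 0
  then have p0: "fst (p 0) = x0" by (simp add: lamm_seq_def)
  have "card (active_set p 0) \<le> (K0 + K2) * sparsity"
    using card_start by (simp add: active_set_def algebra_simps)
  moreover have "norm2 d (x0 - bs) \<le> r / 4" using x0(2) r1 r by linarith
  ultimately show ?case using x0 p0 by (auto simp: controlled_def active_set_def)
next
  case (Suc n)
  have seq: "lamm_seq p n" using Suc.prems by (auto simp: lamm_seq_def)
  have ctl: "controlled p n" using Suc.IH seq .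
  have p0: "fst (p 0) = x0" using seq by (simp add: lamm_seq_def)
  define y where "y = fst (p (Suc n))"
  define U where "U = active_set p (Suc n)"
  have mono: "active_set p n \<subseteq> U" unfolding U_def by (rule active_set_mono) simp
  have cU: "card U \<le> (K0 + K2) * sparsity" using card_active_Suc[OF seq ctl] by (simp add: U_def)
  have y: "y = prox_step d g lv (snd (p (Suc n))) (fst (p n))" "0 < snd (p (Suc n))"
    using lamm_step[OF Suc.prems, of n] by (auto simp: y_def)
  have "G (fst (p n)) \<subseteq> U" "E \<subseteq> U" by (auto simp: U_def active_set_def)
  then have ky: "Poly_Mapping.keys y \<subseteq> U"
    using keys_prox_step[where g = g and bs = bs and lam = lam and x = "fst (p n)", OF y(2) weights noise] mono x_props(2)[OF seq ctl, of n]
    unfolding y(1) by blast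
  have k0: "Poly_Mapping.keys x0 \<subseteq> U" by (auto simp: U_def active_set_def)
  have "card (Poly_Mapping.keys (y - x0)) \<le> card U"
    using keys_closed(1)[OF ky k0] finite_active_set[of p "Suc n"] by (intro card_mono) (auto simp: U_def)
  then have "card (Poly_Mapping.keys (y - x0)) \<le> q" using cU q by (simp add: algebra_simps)
  then have "norm2 d (y - bs) \<le> r / 4"
    using objective_antimono[OF Suc.prems, of 0 "Suc n"] p0 y(1) by (intro sublevel_bound) (auto simp: y_def)
  then show ?case
    using ctl cU mono ky y(1) by (auto simp: controlled_def U_def y_def le_Suc_eq)
qed

lemma lamm_seq_extends:
  assumes "lamm_seq p n" shows "\<exists>y. LAMM_iter d L g gu phi0 lv (p n) y"
proof -
  have "majorizes d L g lv (fst (p n)) phi" if "hi \<le> phi" for phi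
    using majorizes_large[OF assms lamm_seq_controlled[OF assms] that] .
  from line_search_terminates[where a' = "snd (p n)", OF gu phi0(1) this] show ?thesis by simp
qed

text \<open>Each line search starts at the previous value divided by \<open>gu\<close>, and it only raises this value
  while it is below \<open>hi\<close>.\<close>
lemma step_parameter_bound:
  assumes seq: "lamm_seq p n" and start: "snd (p 0) \<le> Phi" and k: "k \<le> n"
  shows "snd (p k) \<le> max (gu * hi) (Phi / gu ^ k)"
  using k
proof (induction k)
  case (Suc k)
  have seqk: "lamm_seq p k" using seq Suc.prems by (auto simp: lamm_seq_def)
  have "LAMM_iter d L g gu phi0 lv (fst (p k), snd (p k)) (fst (p (Suc k)), snd (p (Suc k)))"
    using seq Suc.prems by (simp add: lamm_seq_def)
  from line_search_bound[OF this gu phi0(2) hi majorizes_large[OF seqk lamm_seq_controlled[OF seqk]]]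
  have "snd (p (Suc k)) \<le> max (gu * hi) (snd (p k) / gu)" .
  also have "\<dots> \<le> max (gu * hi) (Phi / gu ^ Suc k)"
  proof (intro max.boundedI)
    have "snd (p k) / gu \<le> max (gu * hi) (Phi / gu ^ k) / gu"
      using Suc gu by (intro divide_right_mono) auto
    also have "\<dots> = max hi (Phi / gu ^ Suc k)" using gu by (simp add: max_divide_distrib_right mult.commute)
    also have "\<dots> \<le> max (gu * hi) (Phi / gu ^ Suc k)"
    proof -
      have "1 * hi \<le> gu * hi" using gu hi by (intro mult_right_mono) auto
      then show ?thesis by (intro max.mono) auto
    qed
    finally show "snd (p k) / gu \<le> max (gu * hi) (Phi / gu ^ Suc k)" .
  qed simp
  finally show ?case .
qed (use start in \<open>simp add: le_max_iff_disj\<close>)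

text \<open>
  Once the step parameter has come down to \<open>gu * hi\<close>, the gap contracts by a fixed factor; an
  iterate that is not yet optimal up to \<open>e\<close> was reached by a step of length of order \<open>e\<close>, which
  bounds the gap before that step from below.
\<close>
lemma not_optimal_imp_early:
  assumes seq: "lamm_seq p n" and start: "snd (p 0) \<le> Phi" and Phi: "Phi \<le> gu ^ k0 * (gu * hi)"
    and n: "k0 < n" and e: "0 < e" "e < omega d g lv (fst (p n))"
  defines "th \<equiv> M\<^sup>2 * gu * hi / lo"
  shows "((1 + th) / th) ^ (n - 1 - k0) \<le> (5 / 4 * K0 * M * gu * hi / lo * (lam * sqrt sparsity / e))\<^sup>2"
proof -
  note ctl = lamm_seq_controlled[OF seq]
  define X where "X k = fst (p k)" for k
  define A where "A k = snd (p (Suc k))" for k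
  define Dl where "Dl k = norm2 d (X (Suc k) - X k)" for k
  define gp where "gp k = F (X k) - F (X n)" for k
  note defs = X_def A_def Dl_def gp_def
  have th: "0 < th" using M1 gu hi lo by (simp add: th_def)
  have A_le: "A k \<le> gu * hi" if "k0 \<le> k" "k < n" for k
  proof -
    have "Phi / gu ^ Suc k \<le> gu * hi"
    proof -
      have "Phi \<le> gu ^ k0 * (gu * hi)" by (rule Phi)
      also have "\<dots> \<le> gu ^ Suc k * (gu * hi)"
        using gu hi that by (intro mult_right_mono power_increasing) auto
      finally show ?thesis using gu by (simp add: divide_le_eq mult.commute)
    qed
    then show ?thesis using step_parameter_bound[OF seq start, of "Suc k"] that by (simp add: A_def)
  qed
  have contr: "(1 + th) * gp (Suc k) \<le> th * gp k" if k: "k0 \<le> k" "k < n" for k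
  proof -
    have A0: "0 < A k" using lamm_step(1)[OF seq k(2)] by (simp add: A_def)
    have "gp (Suc k) \<le> (M * A k * Dl k)\<^sup>2 / (2 * lo)"
      using gap_le[OF seq ctl k(2)] by (simp add: defs)
    also have "\<dots> = (M\<^sup>2 * A k / lo) * (A k / 2 * (Dl k)\<^sup>2)"
      using lo by (simp add: field_simps power2_eq_square)
    also have "\<dots> \<le> th * (A k / 2 * (Dl k)\<^sup>2)"
    proof (intro mult_right_mono)
      have "M\<^sup>2 * A k \<le> M\<^sup>2 * (gu * hi)" using A_le[OF k] by (intro mult_left_mono) auto
      then show "M\<^sup>2 * A k / lo \<le> th" unfolding th_def using lo by (simp add: divide_right_mono mult.assoc)
    qed (use A0 in simp)
    also have "\<dots> \<le> th * (gp k - gp (Suc k))"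
      using step_decrease(1)[OF seq k(2)] th by (intro mult_left_mono) (auto simp: defs)
    finally show ?thesis by (simp add: algebra_simps)
  qed
  define rt where "rt = (1 + th) / th"
  have rt: "0 < rt" using th by (simp add: rt_def)
  have geo: "rt ^ i * gp (k0 + i) \<le> gp 0" if "k0 + i < n" for i
    using that
  proof (induction i)
    case 0
    then show ?case using objective_antimono[OF seq, of 0 k0] by (simp add: gp_def X_def)
  next
    case (Suc i)
    have "rt * gp (k0 + Suc i) \<le> gp (k0 + i)"
      using contr[of "k0 + i"] Suc.prems th by (simp add: rt_def field_simps)
    then have "rt ^ i * (rt * gp (k0 + Suc i)) \<le> rt ^ i * gp (k0 + i)"
      using rt by (intro mult_left_mono) auto
    then show ?case using Suc by (simp add: mult_ac)
  qed
  obtain m where m: "n = Suc m" using n by (cases n) auto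
  have mn: "m < n" "k0 \<le> m" using m n by auto
  have Am: "0 < A m" using lamm_step(1)[OF seq mn(1)] by (simp add: A_def)
  have D0: "0 \<le> Dl m" by (simp add: Dl_def)
  have "e < M * A m * Dl m" using e(2) omega_le[OF seq ctl m] by (simp add: defs)
  also have "M * A m * Dl m \<le> M * (gu * hi) * Dl m"
    using A_le[OF mn(2,1)] M1 D0 by (intro mult_right_mono mult_left_mono) auto
  finally have eD: "e < M * (gu * hi) * Dl m" .
  have "Dl m \<noteq> 0" using eD e(1) by auto
  then have Dpos: "0 < Dl m" using D0 by simp
  have loA: "lo \<le> A m" using step_parameter_lower[OF seq ctl mn(1)] Dpos by (simp add: defs)
  have "lo / 2 * (Dl m)\<^sup>2 \<le> A m / 2 * (Dl m)\<^sup>2" using loA by (intro mult_right_mono) auto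
  also have "\<dots> \<le> gp m" using step_decrease(1)[OF seq mn(1)] by (simp add: defs m)
  finally have gm: "lo / 2 * (Dl m)\<^sup>2 \<le> gp m" .
  define Q where "Q = 5 / 4 * K0 * (lam * sqrt sparsity)"
  have "rt ^ (m - k0) * (lo / 2 * (Dl m)\<^sup>2) \<le> rt ^ (m - k0) * gp m"
    using gm rt by (intro mult_left_mono) auto
  also have "\<dots> \<le> gp 0" using geo[of "m - k0"] mn by simp
  also have "\<dots> \<le> Q\<^sup>2 / (2 * lo)" using gap_0[OF seq ctl] by (simp add: Q_def defs)
  finally have "rt ^ (m - k0) * (lo / 2 * (Dl m)\<^sup>2) \<le> Q\<^sup>2 / (2 * lo)" .
  then have main: "rt ^ (m - k0) * (lo * Dl m)\<^sup>2 \<le> Q\<^sup>2"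
    using lo by (simp add: field_simps power2_eq_square)
  define W where "W = M * gu * hi"
  have W: "0 < W" using M1 gu hi by (simp add: W_def)
  have "e\<^sup>2 \<le> (W * Dl m)\<^sup>2" using eD e(1) by (intro power_mono) (auto simp: W_def mult_ac)
  then have "rt ^ (m - k0) * (lo\<^sup>2 * e\<^sup>2) \<le> rt ^ (m - k0) * (lo\<^sup>2 * (W * Dl m)\<^sup>2)"
    using rt by (intro mult_left_mono) auto
  also have "\<dots> = W\<^sup>2 * (rt ^ (m - k0) * (lo * Dl m)\<^sup>2)" by (simp add: power_mult_distrib)
  also have "\<dots> \<le> W\<^sup>2 * Q\<^sup>2" using main by (intro mult_left_mono) auto
  finally have "rt ^ (m - k0) \<le> (W * Q / (lo * e))\<^sup>2"
    using lo e(1) by (simp add: power_mult_distrib power_divide pos_le_divide_eq)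
  also have "W * Q / (lo * e) = 5 / 4 * K0 * M * gu * hi / lo * (lam * sqrt sparsity / e)"
    using lo e(1) by (simp add: W_def Q_def field_simps)
  finally show ?thesis using m by (simp add: rt_def)
qed

text \<open>Taking logarithms in the previous bound limits the index of any iterate that does not meet the
  stopping rule; since every line search terminates, a later iterate exists and meets it.\<close>
lemma solved_in_logarithmic:
  assumes init: "fst init = x0" "snd init \<le> Phi" and Phi: "Phi \<le> gu ^ k0 * (gu * hi)"
    and e: "0 < e" "4 * e \<le> lam"
  defines "th \<equiv> M\<^sup>2 * gu * hi / lo" and "Z \<equiv> 5 / 4 * K0 * M * gu * hi / lo"
  shows "\<exists>k y. solved_in d L g gu phi0 lv e k init y \<and>
    real k \<le> real k0 + 2 + 2 / ln ((1 + th) / th) * ln (Z * (lam * sqrt sparsity / e))"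
proof -
  define X where "X = Z * (lam * sqrt sparsity / e)"
  define bound where "bound = real k0 + 1 + 2 / ln ((1 + th) / th) * ln X"
  have th: "0 < th" using M1 gu hi lo by (simp add: th_def)
  then have rt: "1 < (1 + th) / th" by simp
  then have lnrt: "0 < ln ((1 + th) / th)" by simp
  have X1: "1 \<le> X"
  proof -
    have "1 * 1 \<le> hi / lo * gu" using lo_hi lo gu by (intro mult_mono) auto
    then have "1 * 1 \<le> M * (hi / lo * gu)" using M1 by (intro mult_mono[of 1 M 1]) auto
    then have "1 * 1 \<le> 5 / 4 * K0 * (M * (hi / lo * gu))" using K0 by (intro mult_mono[of 1 _ 1]) auto
    then have Z1: "1 \<le> Z" by (simp add: Z_def mult_ac)
    have "1 * 1 \<le> lam / e * sqrt sparsity" using e s lam by (intro mult_mono) auto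
    then have "1 * 1 \<le> Z * (lam / e * sqrt sparsity)" using Z1 by (intro mult_mono) auto
    then show ?thesis by (simp add: X_def)
  qed
  define p where "p = rec_nat init (\<lambda>_ z. SOME y. LAMM_iter d L g gu phi0 lv z y)"
  have p_Suc: "p (Suc n) = (SOME y. LAMM_iter d L g gu phi0 lv (p n) y)" and p_0: "p 0 = init" for n
    by (simp_all add: p_def)
  have seq: "lamm_seq p n" for n
  proof (induction n)
    case (Suc n)
    from someI_ex[OF lamm_seq_extends[OF Suc]] Suc show ?case
      by (simp add: lamm_seq_def less_Suc_eq flip: p_Suc)
  qed (simp add: lamm_seq_def p_0 init)
  have early: "real n \<le> bound" if not_opt: "e < omega d g lv (fst (p n))" for n
  proof (cases "k0 < n")
    case True
    have "((1 + th) / th) ^ (n - 1 - k0) \<le> X\<^sup>2"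
      using not_optimal_imp_early[OF seq _ Phi True e(1) not_opt] init(2)
      by (simp add: th_def X_def Z_def p_0)
    then have "ln (((1 + th) / th) ^ (n - 1 - k0)) \<le> ln (X\<^sup>2)"
      using rt X1 by (intro ln_mono) auto
    then have "real (n - 1 - k0) * ln ((1 + th) / th) \<le> 2 * ln X"
      using rt X1 by (simp add: ln_realpow)
    then have "real (n - 1 - k0) \<le> 2 / ln ((1 + th) / th) * ln X" using lnrt by (simp add: field_simps)
    then show ?thesis using True by (simp add: bound_def of_nat_diff)
  next
    case False
    have "0 \<le> 2 / ln ((1 + th) / th) * ln X" using lnrt X1 by simp
    moreover have "real n \<le> real k0" using False by simp
    ultimately show ?thesis by (simp add: bound_def)
  qed
  have "\<exists>n. omega d g lv (fst (p n)) \<le> e"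
  proof -
    obtain n :: nat where "bound < real n" using reals_Archimedean2 by blast
    then show ?thesis using early[of n] by (meson not_le)
  qed
  define k where "k = (LEAST n. omega d g lv (fst (p n)) \<le> e)"
  have k: "omega d g lv (fst (p k)) \<le> e" "\<And>i. i < k \<Longrightarrow> e < omega d g lv (fst (p i))"
    using LeastI_ex[OF \<open>\<exists>n. omega d g lv (fst (p n)) \<le> e\<close>] not_less_Least
    by (force simp: k_def not_le)+
  have "solved_in d L g gu phi0 lv e k init (p k)"
    unfolding solved_in_def using k seq[of k] by (intro exI[of _ p]) (auto simp: p_0 lamm_seq_def)
  moreover have "real k \<le> bound + 1"
  proof (cases k)
    case 0
    have "0 \<le> 2 / ln ((1 + th) / th) * ln X" using lnrt X1 by simp
    then show ?thesis using 0 by (simp add: bound_def)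
  next
    case (Suc n)
    then show ?thesis using early[OF k(2)[of n]] by simp
  qed
  ultimately show ?thesis by (intro exI[of _ k] exI[of _ "p k"]) (simp add: bound_def X_def)
qed

end

section \<open>The tightening stage\<close>

text \<open>
  All conditions on the parameters in one place. The number \<open>4 + K1\<close> bounds the size of the initial
  active set relative to the sparsity: two for \<open>E\<close> of the old and of the new problem each, and \<open>K1\<close>
  for the coordinates with a large excess gradient.
\<close>
locale tightening_stage = sparse_spectrum +
  fixes w :: "real \<Rightarrow> real" and u lam gu phi0 eps_c eps_t :: real and N K1 K2 :: nat
  assumes lam: "0 < lam" and gu: "1 < gu" and phi0: "0 < phi0" "phi0 \<le> hi" and s: "1 \<le> sparsity"
    and w: "w \<in> tightening_class" "1 / 2 \<le> w u" and u: "18 * lam / lo \<le> u"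
    and eps: "0 < eps_c" "0 < eps_t"
    and noise_eps: "\<And>j. j < d \<Longrightarrow> \<bar>coord (g bs) j\<bar> + max eps_t eps_c \<le> lam / 4"
    and N: "200 * hi \<le> real N * lo" "(2 + N) * sparsity \<le> q"
    and K1: "400 * hi \<le> real K1 * lo" "K1 * sparsity + 1 \<le> q"
    and K2: "16 * (hi / lo * (11 + 5 / 4 * (2 * (1 + hi / lo) + 1) * real (4 + K1)))\<^sup>2 \<le> K2"
    and q: "(4 + K1 + 2 * K2 + 1) * sparsity \<le> q"
    and r: "0 < r"
    and r1: "11 * (lam * sqrt sparsity) / lo \<le> r / 8"
    and r2: "5 / 2 * real (4 + K1) * (lam * sqrt sparsity) / lo \<le> r / 8"
    and r3: "5 / 4 * (real (4 + K1) + K2) * (lam * sqrt sparsity) / hi \<le> r / 4"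
    and r4: "lam / (4 * hi) * sqrt (K1 * sparsity + 1) \<le> r / 2"
begin

definition large_coords :: "rvec \<Rightarrow> nat set" where
  "large_coords x = {j. j < d \<and> j \<notin> Poly_Mapping.keys bs \<and> u < \<bar>coord x j\<bar>}"

definition support_set :: "rvec \<Rightarrow> nat set" where
  "support_set x = Poly_Mapping.keys bs \<union> large_coords x"

lemma u_pos: "0 < u"
proof -
  have "0 < 18 * lam / lo" using lam lo by simp
  then show ?thesis using u by (rule less_le_trans)
qed

text \<open>Each such coordinate contributes at least \<open>u\<^sup>2 \<ge> (18 * lam / lo)\<^sup>2\<close> to a squared error of at most
  \<open>(11 * lam / lo)\<^sup>2 * sparsity\<close>.\<close>
lemma card_large_coords:
  assumes x: "x \<in> Rn d" "norm2 d (x - bs) \<le> 11 * (lam * sqrt sparsity) / lo"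
  shows "card (large_coords x) \<le> sparsity"
proof -
  let ?A = "large_coords x"
  have A: "?A \<subseteq> {..<d}" by (auto simp: large_coords_def)
  have "real (card ?A) * u\<^sup>2 = (\<Sum>j\<in>?A. u\<^sup>2)" by simp
  also have "\<dots> \<le> (\<Sum>j\<in>?A. (coord (x - bs) j)\<^sup>2)"
  proof (rule sum_mono)
    fix j assume "j \<in> ?A"
    then have "u \<le> \<bar>coord (x - bs) j\<bar>" by (auto simp: large_coords_def coord_simps in_keys_iff)
    then have "u\<^sup>2 \<le> \<bar>coord (x - bs) j\<bar>\<^sup>2" using u_pos by (intro power_mono) auto
    then show "u\<^sup>2 \<le> (coord (x - bs) j)\<^sup>2" by simp
  qed
  also have "\<dots> \<le> (norm2 d (x - bs))\<^sup>2"
    unfolding norm2_sq dotp_def unfolding power2_eq_square using A by (intro sum_mono2) auto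
  also have "\<dots> \<le> (11 * (lam * sqrt sparsity) / lo)\<^sup>2" using x(2) by (intro power_mono) auto
  also have "\<dots> \<le> (u * sqrt sparsity)\<^sup>2"
  proof (rule power_mono)
    have "11 * lam / lo \<le> 18 * lam / lo" using lam lo by (intro divide_right_mono) auto
    then have "11 * lam / lo * sqrt sparsity \<le> u * sqrt sparsity" using u by (intro mult_right_mono) auto
    then show "11 * (lam * sqrt sparsity) / lo \<le> u * sqrt sparsity" by (simp add: mult.assoc)
  qed (use lam lo in simp)
  also have "\<dots> = real sparsity * u\<^sup>2" by (simp add: power_mult_distrib)
  finally show ?thesis using u_pos by (simp add: mult_le_cancel_right)
qed

lemma admissible_weights_I:
  assumes "card (large_coords x) \<le> sparsity"
  shows "admissible_weights d bs lam (support_set x) (weights d w lam x)"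
  unfolding admissible_weights_def
proof (intro conjI allI impI)
  have w01: "0 \<le> w \<bar>t\<bar>" "w \<bar>t\<bar> \<le> 1" for t using w(1) by (auto simp: tightening_class_def)
  show "Poly_Mapping.keys bs \<subseteq> support_set x" by (simp add: support_set_def)
  show "support_set x \<subseteq> {..<d}" using bs by (auto simp: support_set_def large_coords_def Rn_def)
  show "card (support_set x) \<le> 2 * sparsity"
    unfolding support_set_def using card_Un_le[of "Poly_Mapping.keys bs" "large_coords x"] assms by linarith
  fix j assume j: "j < d"
  show "0 \<le> coord (weights d w lam x) j" using j lam w01 by (simp add: weights_def)
  show "coord (weights d w lam x) j \<le> lam" using j lam w01 by (simp add: weights_def)
  assume "j \<notin> support_set x"
  then have "\<bar>coord x j\<bar> \<le> u" using j by (auto simp: support_set_def large_coords_def)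
  then have "w u \<le> w \<bar>coord x j\<bar>" using w(1) by (auto simp: tightening_class_def)
  then have "lam * (1 / 2) \<le> lam * w \<bar>coord x j\<bar>" using w(2) lam by (intro mult_left_mono) auto
  then show "lam / 2 \<le> coord (weights d w lam x) j" using j by (simp add: weights_def)
qed

lemma d_pos: "0 < d"
proof -
  have "card (Poly_Mapping.keys bs) \<le> card {..<d}" using bs by (intro card_mono) (auto simp: Rn_def)
  then show ?thesis using s by simp
qed

text \<open>Quantified over the weights and with the larger tolerance, so that the property has the same
  form for the contraction stage and for every tightening problem.\<close>
definition approximate_solution :: "rvec \<Rightarrow> bool" where
  "approximate_solution b \<longleftrightarrow> b \<in> Rn d \<and>
     (\<exists>E lv. admissible_weights d bs lam E lv \<and> omega d g lv b \<le> max eps_t eps_c)"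

text \<open>
  Replacing the old weights by the new ones changes each partial derivative by at most \<open>lam\<close>, and
  coordinates that vanish and have a small excess gradient can absorb the change: hence the start
  is already nearly stationary for the new problem, on a sparse set.
\<close>
lemma approximate_solution_starts_problem:
  assumes "approximate_solution b"
  shows "\<exists>w0. lamm_problem d L g H bs r lo hi q lam gu phi0 (support_set b) (weights d w lam b) b w0
    (4 + K1) K2 (1 + hi / lo)"
proof -
  obtain E' lv' where old: "admissible_weights d bs lam E' lv'" "omega d g lv' b \<le> max eps_t eps_c"
    and b: "b \<in> Rn d" using assms by (auto simp: approximate_solution_def)
  have lv': "0 \<le> coord lv' j" "coord lv' j \<le> lam" if "j < d" for j
    using old(1) that by (auto simp: admissible_weights_def)
  obtain v where v: "\<And>j. j < d \<Longrightarrow> abs_subgradient (coord lv' j) (coord b j) (v j)"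
    "\<And>j. j < d \<Longrightarrow> \<bar>coord (g b) j + v j\<bar> \<le> max eps_t eps_c"
    using old(2) omega_le_iff[OF d_pos b lv'(1), of g "max eps_t eps_c"] by blast
  have half: "11 * (lam * sqrt sparsity) / lo < r / 2" "11 * (lam * sqrt sparsity) / lo < r"
    using r1 r by linarith+
  note approx = lam old(1) noise_eps b v
  have close: "norm2 d (b - bs) \<le> 11 * (lam * sqrt sparsity) / lo"
    by (rule approximate_solution_error(1)[OF approx N s half(2)])
  have cG: "card (excess_gradient d g bs lam b) \<le> K1 * sparsity"
    by (rule card_excess_gradient_approximate_solution[OF approx N s half(1) K1 r4])
  have kb: "Poly_Mapping.keys b \<subseteq> E' \<union> excess_gradient d g bs lam b"
    by (rule keys_approximate_solution[OF approx])
  define E lv where "E = support_set b" and "lv = weights d w lam b"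
  have new: "admissible_weights d bs lam E lv"
    unfolding E_def lv_def using card_large_coords[OF b close] by (rule admissible_weights_I)
  have lv: "0 \<le> coord lv j" "coord lv j \<le> lam" if "j < d" for j
    using new that by (auto simp: admissible_weights_def)
  have noise: "\<bar>coord (g bs) j\<bar> \<le> lam / 4" "max eps_t eps_c \<le> lam / 4" if "j < d" for j
    using noise_eps[OF that] eps by linarith+
  \<comment> \<open>The subgradient that minimizes each partial derivative in absolute value.\<close>
  define w0 where "w0 j = (if coord b j \<noteq> 0 then coord lv j * sgn (coord b j)
      else max (- coord lv j) (min (coord lv j) (- coord (g b) j)))" for j
  let ?G = "excess_gradient d g bs lam b"
  have "lamm_problem d L g H bs r lo hi q lam gu phi0 E lv b w0 (4 + K1) K2 (1 + hi / lo)"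
  proof
    have fin: "finite E'" "finite ?G"
      using old(1) by (auto simp: admissible_weights_def excess_gradient_def intro: finite_subset)
    have "card (E \<union> Poly_Mapping.keys b \<union> ?G) \<le> card (E \<union> (E' \<union> ?G))"
      using kb new fin by (intro card_mono) (auto simp: admissible_weights_def intro: finite_subset)
    also have "\<dots> \<le> card E + (card E' + card ?G)"
      by (meson add_left_mono card_Un_le order_trans)
    also have "\<dots> \<le> 2 * sparsity + (2 * sparsity + K1 * sparsity)"
      using old(1) new cG by (intro add_mono) (auto simp: admissible_weights_def)
    finally show "card (E \<union> Poly_Mapping.keys b \<union> ?G) \<le> (4 + K1) * sparsity" by (simp add: algebra_simps)
    fix j assume j: "j < d"
    show "abs_subgradient (coord lv j) (coord b j) (w0 j)"
      using lv[OF j] by (auto simp: abs_subgradient_def w0_def abs_mult sgn_if)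
    show "\<bar>coord (g b) j + w0 j\<bar> \<le> 5 / 4 * lam"
    proof (cases "coord b j = 0")
      case True
      have "\<bar>v j\<bar> \<le> lam" using v(1)[OF j] lv'[OF j] by (simp add: abs_subgradient_def)
      then have "\<bar>coord (g b) j\<bar> \<le> 5 / 4 * lam" using v(2)[OF j] noise(2)[OF j] by linarith
      then show ?thesis using True lv[OF j] by (auto simp: w0_def max_def min_def)
    next
      case False
      have "\<bar>w0 j - v j\<bar> = \<bar>coord lv j - coord lv' j\<bar>"
        using v(1)[OF j] False by (auto simp: abs_subgradient_def w0_def sgn_if)
      also have "\<dots> \<le> lam" using lv[OF j] lv'[OF j] by linarith
      finally show ?thesis using v(2)[OF j] noise(2)[OF j] by linarith
    qed
    assume out: "j \<notin> E \<union> Poly_Mapping.keys b \<union> ?G"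
    have "lam / 2 \<le> coord lv j" using new out j by (auto simp: admissible_weights_def)
    moreover have "\<bar>coord (g b) j - coord (g bs) j\<bar> < lam / 4"
      using out j by (auto simp: excess_gradient_def coord_simps)
    ultimately have "\<bar>coord (g b) j\<bar> \<le> coord lv j" using noise(1)[OF j] by linarith
    then show "coord (g b) j + w0 j = 0" using out by (auto simp: w0_def in_keys_iff)
  qed (use lam gu phi0 s new noise b close K2 q r1 r2 r3 in auto)
  then show ?thesis unfolding E_def lv_def by blast
qed

lemma solved_in_approximate_solution:
  assumes solved: "solved_in d L g gu phi0 lv e k x y" and lv: "admissible_weights d bs lam E lv"
    and x: "fst x \<in> Rn d" and e: "e \<le> max eps_t eps_c"
  shows "approximate_solution (fst y)"
proof -
  obtain p where p: "p 0 = x" "p k = y" "\<And>i. i < k \<Longrightarrow> LAMM_iter d L g gu phi0 lv (p i) (p (Suc i))"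
    "omega d g lv (fst (p k)) \<le> e"
    using solved by (auto simp: solved_in_def)
  have "fst (p k) \<in> Rn d"
  proof (cases k)
    case (Suc i)
    then have "LAMM_iter d L g gu phi0 lv (fst (p i), snd (p i)) (fst (p k), snd (p k))" using p(3)[of i] by simp
    then show ?thesis by (auto simp: LAMM_iter_def)
  qed (use x p in simp)
  then show ?thesis using p e lv by (auto simp: approximate_solution_def intro!: order_trans[OF p(4)])
qed

text \<open>At the initial point \<open>0\<close> no coordinate is large, so the contraction stage fits the same scheme
  as the later problems; step parameters never exceed the larger of their initial bound and
  \<open>gu * hi\<close>.\<close>
lemma run_invariant:
  assumes run: "ILAMM_run d L g w gu phi0 lam eps_c eps_t n st" and phi: "snd (st 1) \<le> Phi" "gu * hi \<le> Phi"
    and i: "1 \<le> i" "i \<le> n"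
  shows "approximate_solution (fst (st i)) \<and> snd (st i) \<le> Phi"
  using i
proof (induction i rule: dec_induct)
  case base
  have st0: "st 0 = (0, phi0)" using run by (simp add: ILAMM_run_def)
  obtain k where k: "solved_in d L g gu phi0 (weights d w lam (fst (st 0))) eps_c k (st 0) (st (Suc 0))"
    using run base unfolding ILAMM_run_def by force
  have "large_coords 0 = {}" using u_pos by (auto simp: large_coords_def)
  then have "admissible_weights d bs lam (support_set 0) (weights d w lam 0)"
    by (intro admissible_weights_I) simp
  then show ?case using solved_in_approximate_solution[OF k] st0 phi by simp
next
  case (step i)
  then have IH: "approximate_solution (fst (st i))" "snd (st i) \<le> Phi" by auto
  obtain w0 where "lamm_problem d L g H bs r lo hi q lam gu phi0 (support_set (fst (st i)))
      (weights d w lam (fst (st i))) (fst (st i)) w0 (4 + K1) K2 (1 + hi / lo)"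
    using approximate_solution_starts_problem[OF IH(1)] by blast
  then interpret P: lamm_problem d L g H bs r lo hi q lam gu phi0 "support_set (fst (st i))"
    "weights d w lam (fst (st i))" "fst (st i)" w0 "4 + K1" K2 "1 + hi / lo" .
  have "i < n" "i \<noteq> 0" using step by auto
  then obtain k where k: "solved_in d L g gu phi0 (weights d w lam (fst (st i))) eps_t k (st i) (st (Suc i))"
    using run by (auto simp: ILAMM_run_def)
  have "approximate_solution (fst (st (Suc i)))"
    using solved_in_approximate_solution[OF k P.weights P.x0(1)] by simp
  moreover obtain p where p: "p 0 = st i" "p k = st (Suc i)"
    "\<And>i'. i' < k \<Longrightarrow> LAMM_iter d L g gu phi0 (weights d w lam (fst (st i))) (p i') (p (Suc i'))"
    using k by (auto simp: solved_in_def)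
  have "P.lamm_seq p k" using p by (simp add: P.lamm_seq_def)
  from P.step_parameter_bound[OF this, of Phi k] have "snd (st (Suc i)) \<le> max (gu * hi) (Phi / gu ^ k)"
    using p IH(2) by simp
  moreover have "Phi / gu ^ k \<le> Phi"
  proof -
    have "0 \<le> Phi" using phi(2) gu hi by (intro order_trans[OF _ phi(2)]) simp
    moreover have "1 \<le> gu ^ k" using gu by simp
    ultimately show ?thesis by (simp add: divide_le_eq mult_left_le_one_le mult_ge1_I) (metis mult_left_mono mult.right_neutral)
  qed
  ultimately show ?case using phi(2) by simp
qed

lemma tightening_iteration_count:
  assumes run: "ILAMM_run d L g w gu phi0 lam eps_c eps_t (l - 1) st" and l: "2 \<le> l"
    and phi: "snd (st 1) \<le> Phi" "gu * hi \<le> Phi" "Phi \<le> gu ^ k0 * (gu * hi)"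
  defines "th \<equiv> (1 + hi / lo)\<^sup>2 * gu * hi / lo" and "Z \<equiv> 5 / 4 * real (4 + K1) * (1 + hi / lo) * gu * hi / lo"
  shows "\<exists>k y. solved_in d L g gu phi0 (weights d w lam (fst (st (l - 1)))) eps_t k (st (l - 1)) y \<and>
    real k \<le> real k0 + 2 + 2 / ln ((1 + th) / th) * ln (Z * (lam * sqrt sparsity / eps_t))"
proof -
  have inv: "approximate_solution (fst (st (l - 1)))" "snd (st (l - 1)) \<le> Phi"
    using run_invariant[OF run phi(1,2), of "l - 1"] l by auto
  then obtain w0 where "lamm_problem d L g H bs r lo hi q lam gu phi0 (support_set (fst (st (l - 1))))
      (weights d w lam (fst (st (l - 1)))) (fst (st (l - 1))) w0 (4 + K1) K2 (1 + hi / lo)"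
    using approximate_solution_starts_problem by blast
  then interpret P: lamm_problem d L g H bs r lo hi q lam gu phi0 "support_set (fst (st (l - 1)))"
    "weights d w lam (fst (st (l - 1)))" "fst (st (l - 1))" w0 "4 + K1" K2 "1 + hi / lo" .
  have "4 * eps_t \<le> lam" using noise_eps[OF d_pos] by linarith
  then show ?thesis unfolding th_def Z_def
    using P.solved_in_logarithmic[OF refl inv(2) phi(3) eps(2)] by blast
qed

end

theorem proposition4p6:
  fixes rho_lo rho_hi :: real
  assumes "0 < rho_lo" and "rho_lo \<le> rho_hi"
  shows "\<exists>cLSE>0. \<exists>CLSE>0. \<forall>\<delta> gu. 0 < \<delta> \<and> \<delta> < 1 \<and> gu > 1 \<longrightarrow>
    (\<exists>c0>0. \<exists>phi_max>0. \<exists>C'>0. \<forall>phi_c>0. \<exists>C''>0.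
      \<forall>(d::nat) L g H bs r w lam eps_c eps_t phi0.
        bs \<in> Rn d \<and> card (Poly_Mapping.keys bs) \<ge> 1 \<and>
        admissible_loss d L g H bs r \<and>
        LSE d H bs r rho_lo rho_hi cLSE CLSE \<and>
        w \<in> tightening_class \<and> w (18 * inverse rho_lo * inverse \<delta> * lam) \<ge> 1/2 \<and>
        eps_c > 0 \<and> eps_t > 0 \<and> lam > 0 \<and>
        4 * (norm_max d (g bs) + max eps_t eps_c) \<le> lam \<and>
        lam \<le> c0 * r / sqrt (real (card (Poly_Mapping.keys bs))) \<and>
        0 < phi0 \<and> phi0 \<le> phi_max
        \<longrightarrow>
        (\<forall>l\<ge>2. \<forall>st. ILAMM_run d L g w gu phi0 lam eps_c eps_t (l - 1) st \<and> snd (st 1) \<le> phi_c \<longrightarrow>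
          (\<exists>k y. solved_in d L g gu phi0 (weights d w lam (fst (st (l - 1)))) eps_t k (st (l - 1)) y \<and>
             real k \<le> C' * ln (C'' * (lam * sqrt (real (card (Poly_Mapping.keys bs))) / eps_t)))))"
proof -
  \<comment> \<open>\<open>N\<close> makes the cone condition effective, \<open>K1\<close> bounds large excess gradients at approximate
    solutions, \<open>K2\<close> those along a trajectory; \<open>K\<close> exceeds every sparsity level that occurs.\<close>
  define N K1 where "N = nat \<lceil>200 * rho_hi / rho_lo\<rceil>" and "K1 = nat \<lceil>400 * rho_hi / rho_lo\<rceil>"
  define K2 where "K2 = nat \<lceil>16 * (rho_hi / rho_lo * (11 + 5 / 4 * (2 * (1 + rho_hi / rho_lo) + 1) * real (4 + K1)))\<^sup>2\<rceil>"
  define K where "K = 4 + K1 + 2 * K2 + N + 3"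
  have pos: "0 < rho_lo" "0 < rho_hi" using assms by auto
  have N: "200 * rho_hi \<le> real N * rho_lo" and K1: "400 * rho_hi \<le> real K1 * rho_lo"
    using pos unfolding N_def K1_def by (simp_all flip: pos_divide_le_eq)
  have K2: "16 * (rho_hi / rho_lo * (11 + 5 / 4 * (2 * (1 + rho_hi / rho_lo) + 1) * real (4 + K1)))\<^sup>2 \<le> real K2"
    unfolding K2_def by (rule real_nat_ceiling_ge)
  \<comment> \<open>The four terms correspond to the four requirements that the ball be large.\<close>
  define C where "C = 88 / rho_lo + 20 * real (4 + K1) / rho_lo + 5 * (real (4 + K1) + K2) / rho_hi
    + (real K1 + 1) / (2 * rho_hi)"
  have C_parts: "0 < 88 / rho_lo" "0 \<le> 20 * real (4 + K1) / rho_lo"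
    "0 \<le> 5 * (real (4 + K1) + K2) / rho_hi" "0 \<le> (real K1 + 1) / (2 * rho_hi)"
    using pos by simp_all
  then have C: "0 < C" unfolding C_def by linarith
  show ?thesis
  proof (rule exI[of _ "real K"], rule conjI, simp add: K_def, rule exI[of _ "1 :: real"], rule conjI, simp,
      intro allI impI)
    fix \<delta> gu :: real assume dg: "0 < \<delta> \<and> \<delta> < 1 \<and> 1 < gu"
    define th where "th = (1 + rho_hi / rho_lo)\<^sup>2 * gu * rho_hi / rho_lo"
    define Z where "Z = 5 / 4 * real (4 + K1) * (1 + rho_hi / rho_lo) * gu * rho_hi / rho_lo"
    define C' where "C' = 2 / ln ((1 + th) / th)"
    have M: "0 < 1 + rho_hi / rho_lo" using pos by (simp add: add_pos_pos)
    have th: "0 < th" and Z: "0 < Z" using pos dg M by (simp_all add: th_def Z_def)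
    have C': "0 < C'" unfolding C'_def using th by simp
    show "\<exists>c0>0. \<exists>phi_max>0. \<exists>C'>0. \<forall>phi_c>0. \<exists>C''>0.
      \<forall>(d::nat) L g H bs r w lam eps_c eps_t phi0.
        bs \<in> Rn d \<and> card (Poly_Mapping.keys bs) \<ge> 1 \<and>
        admissible_loss d L g H bs r \<and>
        LSE d H bs r rho_lo rho_hi (real K) 1 \<and>
        w \<in> tightening_class \<and> w (18 * inverse rho_lo * inverse \<delta> * lam) \<ge> 1/2 \<and>
        eps_c > 0 \<and> eps_t > 0 \<and> lam > 0 \<and>
        4 * (norm_max d (g bs) + max eps_t eps_c) \<le> lam \<and>
        lam \<le> c0 * r / sqrt (real (card (Poly_Mapping.keys bs))) \<and>
        0 < phi0 \<and> phi0 \<le> phi_max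
        \<longrightarrow>
        (\<forall>l\<ge>2. \<forall>st. ILAMM_run d L g w gu phi0 lam eps_c eps_t (l - 1) st \<and> snd (st 1) \<le> phi_c \<longrightarrow>
          (\<exists>k y. solved_in d L g gu phi0 (weights d w lam (fst (st (l - 1)))) eps_t k (st (l - 1)) y \<and>
             real k \<le> C' * ln (C'' * (lam * sqrt (real (card (Poly_Mapping.keys bs))) / eps_t))))"
    proof (rule exI[of _ "1 / C"], rule conjI, use C in simp, rule exI[of _ rho_hi], rule conjI, use pos in simp,
        rule exI[of _ C'], rule conjI, use C' in simp, intro allI impI)
      fix phi_c :: real assume "0 < phi_c"
      \<comment> \<open>A bound for all step parameters, and the number of divisions by \<open>gu\<close> that bring it down to
        \<open>gu * rho_hi\<close>; only \<open>C''\<close> depends on it.\<close>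
      define Phi where "Phi = max phi_c (gu * rho_hi)"
      obtain k0 where "Phi / (gu * rho_hi) < gu ^ k0" using real_arch_pow dg by blast
      then have k0: "Phi \<le> gu ^ k0 * (gu * rho_hi)" using dg pos by (simp add: pos_divide_less_eq)
      define C'' where "C'' = Z * exp ((real k0 + 2) / C')"
      have C'': "0 < C''" using Z by (simp add: C''_def)
      show "\<exists>C''>0. \<forall>(d::nat) L g H bs r w lam eps_c eps_t phi0.
        bs \<in> Rn d \<and> card (Poly_Mapping.keys bs) \<ge> 1 \<and>
        admissible_loss d L g H bs r \<and>
        LSE d H bs r rho_lo rho_hi (real K) 1 \<and>
        w \<in> tightening_class \<and> w (18 * inverse rho_lo * inverse \<delta> * lam) \<ge> 1/2 \<and>
        eps_c > 0 \<and> eps_t > 0 \<and> lam > 0 \<and>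
        4 * (norm_max d (g bs) + max eps_t eps_c) \<le> lam \<and>
        lam \<le> 1 / C * r / sqrt (real (card (Poly_Mapping.keys bs))) \<and>
        0 < phi0 \<and> phi0 \<le> rho_hi
        \<longrightarrow>
        (\<forall>l\<ge>2. \<forall>st. ILAMM_run d L g w gu phi0 lam eps_c eps_t (l - 1) st \<and> snd (st 1) \<le> phi_c \<longrightarrow>
          (\<exists>k y. solved_in d L g gu phi0 (weights d w lam (fst (st (l - 1)))) eps_t k (st (l - 1)) y \<and>
             real k \<le> C' * ln (C'' * (lam * sqrt (real (card (Poly_Mapping.keys bs))) / eps_t))))"
      proof (rule exI[of _ C''], rule conjI, use C'' in simp, intro allI impI)
        fix d :: nat and L g H bs w and r lam eps_c eps_t phi0 :: real and l :: nat and st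
        assume A: "bs \<in> Rn d \<and> card (Poly_Mapping.keys bs) \<ge> 1 \<and>
          admissible_loss d L g H bs r \<and>
          LSE d H bs r rho_lo rho_hi (real K) 1 \<and>
          w \<in> tightening_class \<and> w (18 * inverse rho_lo * inverse \<delta> * lam) \<ge> 1/2 \<and>
          eps_c > 0 \<and> eps_t > 0 \<and> lam > 0 \<and>
          4 * (norm_max d (g bs) + max eps_t eps_c) \<le> lam \<and>
          lam \<le> 1 / C * r / sqrt (real (card (Poly_Mapping.keys bs))) \<and>
          0 < phi0 \<and> phi0 \<le> rho_hi"
          and l: "2 \<le> l"
          and run: "ILAMM_run d L g w gu phi0 lam eps_c eps_t (l - 1) st \<and> snd (st 1) \<le> phi_c"
        define s where "s = card (Poly_Mapping.keys bs)"
        have s: "1 \<le> s" and lam: "0 < lam" using A by (auto simp: s_def)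
        have noise: "4 * (norm_max d (g bs) + max eps_t eps_c) \<le> lam" using A by blast
        define B where "B = lam * sqrt s"
        have B: "0 < B" using lam s by (simp add: B_def)
        have "lam \<le> 1 / C * r / sqrt s" using A unfolding s_def by blast
        moreover have "0 < sqrt s" using s by simp
        ultimately have "lam * sqrt s \<le> 1 / C * r" by (simp only: pos_le_divide_eq)
        then have CB: "C * B \<le> r" using C by (simp add: B_def field_simps)
        then have r: "0 < r" using mult_pos_pos[OF C B] by linarith
        have parts: "88 / rho_lo * B \<le> r" "20 * real (4 + K1) / rho_lo * B \<le> r"
          "5 * (real (4 + K1) + K2) / rho_hi * B \<le> r" "(real K1 + 1) / (2 * rho_hi) * B \<le> r"
          using C_parts B by (auto intro!: order_trans[OF mult_right_mono CB] simp only: C_def)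
        interpret sparse_spectrum d L g H bs r rho_lo rho_hi "K * s"
          using A assms(2) by (intro LSE_imp_sparse_spectrum[where K = K and CLSE = 1]) (auto simp: s_def)
        interpret tightening_stage d L g H bs r rho_lo rho_hi "K * s" w "18 * inverse rho_lo * inverse \<delta> * lam"
          lam gu phi0 eps_c eps_t N K1 K2
        proof
          show "18 * lam / rho_lo \<le> 18 * inverse rho_lo * inverse \<delta> * lam"
          proof -
            have "1 \<le> inverse \<delta>" using dg by (simp add: one_le_inverse)
            then have "18 * lam / rho_lo * 1 \<le> 18 * lam / rho_lo * inverse \<delta>"
              using lam pos by (intro mult_left_mono) auto
            then show ?thesis by (simp add: divide_inverse mult_ac)
          qed
          show "\<bar>coord (g bs) j\<bar> + max eps_t eps_c \<le> lam / 4" if "j < d" for j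
            using noise add_right_mono[OF abs_coord_le_norm_max[OF that, of "g bs"], of "max eps_t eps_c"]
            by (simp add: field_simps)
          show "(2 + N) * sparsity \<le> K * s" unfolding s_def[symmetric] by (intro mult_right_mono) (auto simp: K_def)
          have "K1 * s + 1 * 1 \<le> K1 * s + 7 * s" using s by (intro add_left_mono mult_mono) auto
          also have "\<dots> \<le> K * s" by (simp add: K_def algebra_simps)
          finally show "K1 * sparsity + 1 \<le> K * s" by (simp add: s_def)
          show "(4 + K1 + 2 * K2 + 1) * sparsity \<le> K * s"
            unfolding s_def[symmetric] by (intro mult_right_mono) (auto simp: K_def)
          show "11 * (lam * sqrt sparsity) / rho_lo \<le> r / 8" using parts(1) by (simp add: B_def s_def)
          show "5 / 2 * real (4 + K1) * (lam * sqrt sparsity) / rho_lo \<le> r / 8"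
          proof -
            have "5 / 2 * x * b / rho_lo = 20 * x / rho_lo * b / 8" for x b :: real by simp
            then show ?thesis using divide_right_mono[OF parts(2), of 8] by (simp only: B_def s_def)
          qed
          show "5 / 4 * (real (4 + K1) + K2) * (lam * sqrt sparsity) / rho_hi \<le> r / 4"
          proof -
            have "5 / 4 * x * b / rho_hi = 5 * x / rho_hi * b / 4" for x b :: real by simp
            then show ?thesis using divide_right_mono[OF parts(3), of 4] by (simp only: B_def s_def)
          qed
          have "K1 * s + 1 \<le> (K1 + 1) * ((K1 + 1) * s)" using s by (simp add: algebra_simps)
          then have "real (K1 * s + 1) \<le> real ((K1 + 1) * ((K1 + 1) * s))" by (simp only: of_nat_le_iff)
          then have "sqrt (real (K1 * s + 1)) \<le> sqrt (real ((K1 + 1) * ((K1 + 1) * s)))"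
            by (rule real_sqrt_le_mono)
          also have "\<dots> = sqrt ((real (K1 + 1))\<^sup>2 * s)"
            by (simp only: of_nat_mult power2_eq_square mult.assoc)
          also have "\<dots> = (real K1 + 1) * sqrt s" by (simp add: real_sqrt_mult)
          finally have "sqrt (K1 * s + 1) \<le> (real K1 + 1) * sqrt s" .
          then have "lam / (4 * rho_hi) * sqrt (K1 * s + 1) \<le> lam / (4 * rho_hi) * ((real K1 + 1) * sqrt s)"
            using lam pos by (intro mult_left_mono) auto
          also have "\<dots> = (real K1 + 1) / (2 * rho_hi) * B / 2" by (simp add: B_def)
          also have "\<dots> \<le> r / 2" using parts(4) by (simp add: mult.commute)
          finally show "lam / (4 * rho_hi) * sqrt (K1 * sparsity + 1) \<le> r / 2" by (simp add: s_def)
        qed (use A dg N K1 K2 r in auto)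
        have "snd (st 1) \<le> Phi" "gu * rho_hi \<le> Phi" using run by (auto simp: Phi_def)
        from tightening_iteration_count[OF run[THEN conjunct1] l this k0]
        obtain k y where k: "solved_in d L g gu phi0 (weights d w lam (fst (st (l - 1)))) eps_t k (st (l - 1)) y"
          "real k \<le> real k0 + 2 + C' * ln (Z * (B / eps_t))"
          unfolding C'_def th_def Z_def B_def s_def by blast
        have "0 < Z * (B / eps_t)" using Z B A by simp
        then have "ln (Z * (B / eps_t) * exp ((real k0 + 2) / C')) = ln (Z * (B / eps_t)) + (real k0 + 2) / C'"
          by (simp only: ln_mult_pos exp_gt_zero ln_exp)
        moreover have "C'' * (B / eps_t) = Z * (B / eps_t) * exp ((real k0 + 2) / C')"
          by (simp add: C''_def)
        ultimately have "ln (C'' * (B / eps_t)) = ln (Z * (B / eps_t)) + (real k0 + 2) / C'" by (simp only:)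
        then have "real k \<le> C' * ln (C'' * (B / eps_t))" using k(2) C' by (simp only: distrib_left) simp
        then show "\<exists>k y. solved_in d L g gu phi0 (weights d w lam (fst (st (l - 1)))) eps_t k (st (l - 1)) y \<and>
             real k \<le> C' * ln (C'' * (lam * sqrt (real (card (Poly_Mapping.keys bs))) / eps_t))"
          using k(1) unfolding B_def s_def by blast
      qed
    qed
  qed
qed

end
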